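(* Let $\mathbf k$ be a field of characteristic $0$, $\lambda\in\mathbf k$, and $\mathfrak g$ a vector space over $\mathbf k$. Let $M=\mathrm{Hom}(\bar\wedge\mathfrak g,\mathfrak g)$ and $A=\mathrm{Hom}(\bar\wedge\mathfrak g,\mathfrak g)$, with $\mathrm{Hom}(\wedge^{n+1}\mathfrak g,\mathfrak g)$ in degree $n$. Then there is an $L_\infty[1]$-algebra structure on $sM\oplus A$ with $$l_2(sf,sg)=(-1)^{|f|}s[f,g]_{\mathrm{NR}},\qquad l_2(sf,\xi)=[f,\xi]_{\mathrm{NR}},$$ and for $3\le i\le n+2$, $$l_i(sf,\xi_1,\dots,\xi_{i-1})=\sum_{\tau\in\mathrm{Sh}(m_{i-1}+1,\dots,m_1+1,n+2-i)}(-1)^{\sum_{j=1}^{i-1}(m_1+\cdots+m_{j-1})m_j}\lambda^{i-2}f\big(\xi_{i-1}\otimes\cdots\otimes\xi_1\otimes\mathrm{Id}^{\otimes n+2-i}\big)\tau^{-1}$$ for $f\in\mathrm{Hom}(\wedge^{n+1}\mathfrak g,\mathfrak g)\subseteq M$, $g\in\mathrm{Hom}(\wedge^{m+1}\mathfrak g,\mathfrak g)\subseteq M$, $\xi\in\mathrm{Hom}(\wedge^{m+1}\mathfrak g,\mathfrak g)\subseteq A$, $\xi_j\in\mathrm{Hom}(\wedge^{m_j+1}\mathfrak g,\mathfrak g)\subseteq A$ ($1\le j\le i-1$), all other components vanishing (apart from those determined by graded symmetry).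
   Context: $\bar\wedge V=\bigoplus_{k\ge1}\wedge^kV$. Nijenhuis-Richardson bracket on $\mathrm{Hom}(\bar\wedge\mathfrak g,\mathfrak g)$: $[f,g]_{\mathrm{NR}}=f\bar\circ g-(-1)^{pq}g\bar\circ f$ for $f,g$ of degrees $p,q$, where $f\bar\circ g(x_1,\dots,x_{p+q+1})=\sum_{\sigma\in\mathrm{Sh}(q+1,p)}\mathrm{sgn}(\sigma)f(g(x_{\sigma(1)},\dots,x_{\sigma(q+1)}),x_{\sigma(q+2)},\dots,x_{\sigma(p+q+1)})$. $\mathrm{Sh}(i_1,\dots,i_r)$ is the set of permutations increasing on each of the consecutive blocks of sizes $i_1,\dots,i_r$. $\tau^{-1}(x_1,\dots,x_t)=\mathrm{sgn}(\tau)(x_{\tau(1)},\dots,x_{\tau(t)})$. The tensor product of maps is evaluated with the Koszul sign rule, where $\xi_j$ has degree $m_j$ and each $x\in\mathfrak g$ is treated as an odd element (i.e. as an element of $s\mathfrak g$); thus, with $r=i-1$ and $a_r,\dots,a_1,b$ the consecutive blocks of arguments of sizes $m_r+1,\dots,m_1+1,n+1-r$, $$(\xi_r\otimes\cdots\otimes\xi_1\otimes\mathrm{Id}^{\otimes n+1-r})(a_r,\dots,a_1,b)=(-1)^{\sum_{1\le k<j\le r}m_k(m_j+1)}(\xi_r(a_r),\dots,\xi_1(a_1),b).$$ All graded spaces are $\mathbb Z$-graded; $(sV)^n=V^{n+1}$. An $L_\infty[1]$-algebra is a graded vector space $\mathfrak L$ with degree $1$ linear maps $l_n:\mathfrak L^{\otimes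 n}\to\mathfrak L$, $n\ge1$, that are graded symmetric (with Koszul sign $\varepsilon(\sigma)$) and satisfy $\sum_{i=1}^n\sum_{\sigma\in\mathrm{Sh}(i,n-i)}\varepsilon(\sigma)l_{n-i+1}(l_i(x_{\sigma(1)},\dots,x_{\sigma(i)}),x_{\sigma(i+1)},\dots,x_{\sigma(n)})=0$ for $n\ge1$. *)

theory Defs
  imports
    Complex_Main
    "HOL-Combinatorics.Permutations"
    "HOL-Library.Function_Algebras"
    "HOL-Library.Product_Plus"
begin

section \<open>Shuffles and multilinear maps\<close>

text \<open>Positions are counted from \<open>0\<close>, and \<open>permute_list \<sigma> xs\<close> is the tuple
  \<open>(x\<^bsub>\<sigma>(1)\<^esub>, \<dots>, x\<^bsub>\<sigma>(t)\<^esub>)\<close>.  Blocks are allowed to be empty.\<close>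

definition Sh :: "nat list \<Rightarrow> (nat \<Rightarrow> nat) set" where
  "Sh bs = {\<sigma>. \<sigma> permutes {..<sum_list bs} \<and>
     (\<forall>b<length bs. strict_mono_on {sum_list (take b bs)..<sum_list (take (Suc b) bs)} \<sigma>)}"

text \<open>A linear map on the \<open>n\<close>-th tensor power of a subspace \<open>V\<close> is rendered as a function on
  lists that is multilinear on the lists of length \<open>n\<close> with entries in \<open>V\<close>.\<close>

definition multilinear_on ::
  "('k \<Rightarrow> 'a::ab_group_add \<Rightarrow> 'a) \<Rightarrow> ('k \<Rightarrow> 'b::ab_group_add \<Rightarrow> 'b) \<Rightarrow>
   'a set \<Rightarrow> nat \<Rightarrow> ('a list \<Rightarrow> 'b) \<Rightarrow> bool" where
  "multilinear_on s1 s2 V n F \<longleftrightarrow>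
     (\<forall>xs i. length xs = n \<and> set xs \<subseteq> V \<and> i < n \<longrightarrow>
        (\<forall>x\<in>V. \<forall>y\<in>V. F (xs[i := x + y]) = F (xs[i := x]) + F (xs[i := y])) \<and>
        (\<forall>c. \<forall>x\<in>V. F (xs[i := s1 c x]) = s2 c (F (xs[i := x]))))"


section \<open>\<open>L\<^sub>\<infinity>[1]\<close>-algebras\<close>

text \<open>A \<open>\<int>\<close>-graded vector space is given by its homogeneous components, which are independent
  subspaces of an ambient vector space; the graded vector space itself is their (internal)
  direct sum, not the whole ambient space.\<close>

locale graded_vector_space = vector_space scale
  for scale :: "'k::field \<Rightarrow> 'a::ab_group_add \<Rightarrow> 'a" +
  fixes V :: "int \<Rightarrow> 'a set"
  assumes subspace_component: "subspace (V d)"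
    and independent_components:
      "finite D \<Longrightarrow> (\<And>d. d \<in> D \<Longrightarrow> x d \<in> V d) \<Longrightarrow> (\<Sum>d\<in>D. x d) = 0 \<Longrightarrow> d \<in> D \<Longrightarrow> x d = 0"
begin

definition total :: "'a set" where
  "total = span (\<Union>d. V d)"

definition homogeneous :: "int list \<Rightarrow> 'a list \<Rightarrow> bool" where
  "homogeneous ds xs \<longleftrightarrow> list_all2 (\<lambda>d x. x \<in> V d) ds xs"

end

text \<open>The sign \<open>\<epsilon>(\<sigma>)\<close> determined by
  \<open>x\<^sub>1 \<cdots> x\<^sub>n = \<epsilon>(\<sigma>) x\<^bsub>\<sigma>(1)\<^esub> \<cdots> x\<^bsub>\<sigma>(n)\<^esub>\<close> in the free graded commutative algebra, where \<open>x\<^sub>i\<close>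
  has degree \<open>ds ! i\<close>.\<close>

definition koszul_sign :: "int list \<Rightarrow> (nat \<Rightarrow> nat) \<Rightarrow> 'k::field" where
  "koszul_sign ds \<sigma> =
     (\<Prod>(i, j)\<in>{(i, j). i < j \<and> j < length ds \<and> \<sigma> j < \<sigma> i}. (-1) powi (ds ! \<sigma> i * ds ! \<sigma> j))"

locale L_infinity_1_algebra = graded_vector_space scale V
  for scale :: "'k::field \<Rightarrow> 'a::ab_group_add \<Rightarrow> 'a" and V :: "int \<Rightarrow> 'a set" +
  fixes l :: "nat \<Rightarrow> 'a list \<Rightarrow> 'a"
  assumes multilinear: "n \<ge> 1 \<Longrightarrow> multilinear_on scale scale total n (l n)"
    and degree_one:
      "n \<ge> 1 \<Longrightarrow> length xs = n \<Longrightarrow> homogeneous ds xs \<Longrightarrow> l n xs \<in> V (sum_list ds + 1)"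
    and graded_symmetric:
      "n \<ge> 1 \<Longrightarrow> length xs = n \<Longrightarrow> homogeneous ds xs \<Longrightarrow> \<sigma> permutes {..<n} \<Longrightarrow>
         l n xs = scale (koszul_sign ds \<sigma>) (l n (permute_list \<sigma> xs))"
    and generalized_Jacobi:
      "n \<ge> 1 \<Longrightarrow> length xs = n \<Longrightarrow> homogeneous ds xs \<Longrightarrow>
         (\<Sum>i=1..n. \<Sum>\<sigma>\<in>Sh [i, n - i].
            scale (koszul_sign ds \<sigma>)
              (l (n - i + 1)
                (l i (take i (permute_list \<sigma> xs)) # drop i (permute_list \<sigma> xs)))) = 0"


section \<open>Operations on graded spaces\<close>

definition shift :: "(int \<Rightarrow> 'a set) \<Rightarrow> int \<Rightarrow> 'a set" where
  "shift V d = V (d + 1)"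

definition dsum :: "(int \<Rightarrow> 'a set) \<Rightarrow> (int \<Rightarrow> 'b set) \<Rightarrow> int \<Rightarrow> ('a \<times> 'b) set" where
  "dsum V W d = V d \<times> W d"

definition fun_scale :: "('k \<Rightarrow> 'v \<Rightarrow> 'v) \<Rightarrow> 'k \<Rightarrow> ('x \<Rightarrow> 'v) \<Rightarrow> 'x \<Rightarrow> 'v" where
  "fun_scale s c f = (\<lambda>x. s c (f x))"

definition prod_scale ::
  "('k \<Rightarrow> 'a \<Rightarrow> 'a) \<Rightarrow> ('k \<Rightarrow> 'b \<Rightarrow> 'b) \<Rightarrow> 'k \<Rightarrow> 'a \<times> 'b \<Rightarrow> 'a \<times> 'b" where
  "prod_scale s1 s2 c = map_prod (s1 c) (s2 c)"


section \<open>The graded space \<open>Hom(\<And>\<gg>, \<gg>)\<close>\<close>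

text \<open>The vector space \<open>\<gg>\<close> is the type \<open>'v\<close> with scalar multiplication \<open>s\<close>.  Linear maps
  \<open>\<And>\<^sup>n\<gg> \<rightarrow> \<gg>\<close> are rendered as alternating multilinear maps of \<open>n\<close> arguments.  They are extended
  by \<open>0\<close> to lists of other lengths, so that each of them is represented by exactly one
  function and maps of different arities are linearly independent.\<close>

definition alternating_maps ::
  "('k::field \<Rightarrow> 'v::ab_group_add \<Rightarrow> 'v) \<Rightarrow> nat \<Rightarrow> ('v list \<Rightarrow> 'v) set" where
  "alternating_maps s n =
     {f. multilinear_on s s UNIV n f \<and>
         (\<forall>xs i j. length xs = n \<and> i < j \<and> j < n \<and> xs ! i = xs ! j \<longrightarrow> f xs = 0) \<and>
         (\<forall>xs. length xs \<noteq> n \<longrightarrow> f xs = 0)}"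

definition Hom_ext ::
  "('k::field \<Rightarrow> 'v::ab_group_add \<Rightarrow> 'v) \<Rightarrow> int \<Rightarrow> ('v list \<Rightarrow> 'v) set" where
  "Hom_ext s d = (if d \<ge> 0 then alternating_maps s (nat d + 1) else {0})"

text \<open>The space \<open>sM \<oplus> A\<close> with \<open>M = A = Hom(\<And>\<gg>, \<gg>)\<close>: the pair \<open>(f, 0)\<close> is \<open>sf\<close>, and \<open>(0, \<xi>)\<close> is
  \<open>\<xi> \<in> A\<close>.\<close>

definition sM_A :: "('k::field \<Rightarrow> 'v::ab_group_add \<Rightarrow> 'v) \<Rightarrow>
   int \<Rightarrow> (('v list \<Rightarrow> 'v) \<times> ('v list \<Rightarrow> 'v)) set" where
  "sM_A s = dsum (shift (Hom_ext s)) (Hom_ext s)"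

definition sM_A_scale :: "('k::field \<Rightarrow> 'v::ab_group_add \<Rightarrow> 'v) \<Rightarrow>
   'k \<Rightarrow> ('v list \<Rightarrow> 'v) \<times> ('v list \<Rightarrow> 'v) \<Rightarrow> ('v list \<Rightarrow> 'v) \<times> ('v list \<Rightarrow> 'v)" where
  "sM_A_scale s = prod_scale (fun_scale s) (fun_scale s)"

text \<open>\<open>nr_comp s p q f g\<close> is \<open>f \<circ>\<^sup>- g\<close> for \<open>f\<close> of degree \<open>p\<close> and \<open>g\<close> of degree \<open>q\<close>.\<close>

definition nr_comp ::
  "('k::field \<Rightarrow> 'v::ab_group_add \<Rightarrow> 'v) \<Rightarrow> nat \<Rightarrow> nat \<Rightarrow>
   ('v list \<Rightarrow> 'v) \<Rightarrow> ('v list \<Rightarrow> 'v) \<Rightarrow> 'v list \<Rightarrow> 'v" where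
  "nr_comp s p q f g = (\<lambda>xs. if length xs = p + q + 1 then
     (\<Sum>\<sigma>\<in>Sh [q + 1, p]. s (of_int (sign \<sigma>))
        (f (g (take (q + 1) (permute_list \<sigma> xs)) # drop (q + 1) (permute_list \<sigma> xs))))
     else 0)"

definition nr_bracket ::
  "('k::field \<Rightarrow> 'v::ab_group_add \<Rightarrow> 'v) \<Rightarrow> nat \<Rightarrow> nat \<Rightarrow>
   ('v list \<Rightarrow> 'v) \<Rightarrow> ('v list \<Rightarrow> 'v) \<Rightarrow> 'v list \<Rightarrow> 'v" where
  "nr_bracket s p q f g =
     nr_comp s p q f g - fun_scale s ((-1) ^ (p * q)) (nr_comp s q p g f)"


section \<open>The higher operations\<close>

text \<open>In the following \<open>ms = [m\<^sub>1, \<dots>, m\<^sub>r]\<close> and \<open>\<xi>s = [\<xi>\<^sub>1, \<dots>, \<xi>\<^sub>r]\<close> with \<open>\<xi>\<^sub>j\<close> of degree \<open>m\<^sub>j\<close>.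
  Since list positions start at \<open>0\<close>, \<open>ms ! j\<close> stands for \<open>m\<^bsub>j+1\<^esub>\<close>.\<close>

fun blocks :: "nat list \<Rightarrow> 'a list \<Rightarrow> 'a list list" where
  "blocks [] xs = []"
| "blocks (b # bs) xs = take b xs # blocks bs (drop b xs)"

text \<open>The function \<open>comp_tensor s n f ms \<xi>s\<close> is
  \<open>f (\<xi>\<^sub>r \<otimes> \<cdots> \<otimes> \<xi>\<^sub>1 \<otimes> Id\<^bsup>\<otimes> n+1-r\<^esup>)\<close> on tuples of vectors, where the leading scalar is the Koszul
  sign \<open>(-1)\<close> to the \<open>\<Sum>\<^bsub>k<j\<^esub> m\<^sub>k (m\<^sub>j + 1)\<close> arising from moving the \<open>\<xi>\<^sub>k\<close> past the arguments, each of
  which counts as odd.\<close>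

definition comp_tensor ::
  "('k::field \<Rightarrow> 'v::ab_group_add \<Rightarrow> 'v) \<Rightarrow> nat \<Rightarrow> ('v list \<Rightarrow> 'v) \<Rightarrow>
   nat list \<Rightarrow> ('v list \<Rightarrow> 'v) list \<Rightarrow> 'v list \<Rightarrow> 'v" where
  "comp_tensor s n f ms \<xi>s = (\<lambda>xs.
     if length xs = sum_list (map Suc ms) + (n + 1 - length ms) then
       s ((-1) ^ (\<Sum>j<length ms. \<Sum>k<j. ms ! k * (ms ! j + 1)))
         (f (map2 (\<lambda>\<xi> a. \<xi> a) (rev \<xi>s) (blocks (rev (map Suc ms)) xs)
             @ drop (sum_list (map Suc ms)) xs))
     else 0)"

text \<open>\<open>inv_action s F \<tau>\<close> is \<open>F \<tau>\<^sup>-\<^sup>1\<close>, where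
  \<open>\<tau>\<^sup>-\<^sup>1 (x\<^sub>1, \<dots>, x\<^sub>t) = sgn(\<tau>) (x\<^bsub>\<tau>(1)\<^esub>, \<dots>, x\<^bsub>\<tau>(t)\<^esub>)\<close>.\<close>

definition inv_action ::
  "('k::field \<Rightarrow> 'v::ab_group_add \<Rightarrow> 'v) \<Rightarrow> ('v list \<Rightarrow> 'v) \<Rightarrow> (nat \<Rightarrow> nat) \<Rightarrow> 'v list \<Rightarrow> 'v" where
  "inv_action s F \<tau> = (\<lambda>xs. s (of_int (sign \<tau>)) (F (permute_list \<tau> xs)))"

definition higher_op ::
  "('k::field \<Rightarrow> 'v::ab_group_add \<Rightarrow> 'v) \<Rightarrow> 'k \<Rightarrow> nat \<Rightarrow> ('v list \<Rightarrow> 'v) \<Rightarrow>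
   nat list \<Rightarrow> ('v list \<Rightarrow> 'v) list \<Rightarrow> 'v list \<Rightarrow> 'v" where
  "higher_op s lam n f ms \<xi>s =
     (\<Sum>\<tau>\<in>Sh (rev (map Suc ms) @ [n + 1 - length ms]).
        fun_scale s
          ((-1) ^ (\<Sum>j<length ms. (\<Sum>k<j. ms ! k) * ms ! j) * lam ^ (length ms - 1))
          (inv_action s (comp_tensor s n f ms \<xi>s) \<tau>))"

end

theory Submission
  imports Defs
begin

text \<open>The idea. Regard \<open>f \<in> M\<close> as a vector field on the odd space \<open>\<gg>[1]\<close>. It acts on the space of
  self-maps \<open>\<phi>\<close> of this space by \<open>\<phi> \<mapsto> f \<circ> \<phi> - d\<phi> \<cdot> f\<close>. In the coordinate \<open>\<xi>\<close> with \<open>\<phi> = id + \<lambda> \<xi>\<close> this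
  vector field has the Taylor coefficients \<open>\<lambda>\<^bsup>r-1\<^esup> f{\<xi>\<^sub>1, \<dots>, \<xi>\<^sub>r}\<close>, where \<open>f{\<dots>}\<close> are the symmetric
  braces, together with the linear term \<open>- \<xi>{f}\<close>; these are the operations of the statement. The
  generalized Jacobi identity therefore says that \<open>M\<close> with the Nijenhuis-Richardson bracket is a
  graded Lie algebra and that it acts.

  Algebraically, everything follows from
  \<open>f{\<Xi>}{g} = f{\<Xi>, g} + \<Sum> \<plusminus> f{\<dots>, \<xi>\<^sub>i{g}, \<dots>}\<close>, a consequence of the coassociativity and graded
  cocommutativity of the unshuffle coproduct, and from
  \<open>f{g}{\<Xi>} = \<Sum> \<plusminus> f{g{\<Xi>'}, \<Xi>''}\<close>, which follows from it by induction on the length of \<open>\<Xi>\<close>.\<close>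

section \<open>Signs and unshuffles\<close>

text \<open>The coordinate \<phi> = id + \<lambda> \<xi> degenerates for \<lambda> = 0, so the
  action cannot simply be transported from the self-maps. Instead the Taylor coefficients, with
  their powers of \<lambda>, are taken as the definition (\<open>act\<close>), and the action
  property is verified on them. This works because putting a coefficient on j letters into one on k
  letters gives a word of j + k - 1 letters and the power (j - 1) + (k - 1): on a word of n letters
  everything carries the power n - 1. The other obstacle is the form of the data: sums over
  permutations, arity-dependent signs, and a tensor product that lists the \<xi>'s backwards. Sums
  over shuffles are replaced by a recursion on words, with \<open>sum_Sh\<close> as the bridge.
  Reversing the letters costs exactly the sign that stands in front of the higher operation, so that
  operation is just \<lambda>^(i-2) times the brace of f with \<xi>_1, ..., \<xi>_(i-1) in their
  natural order (\<open>higher_op_brace\<close>).\<close>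

text \<open>Signs are indexed by booleans, \<open>True\<close> standing for \<open>-1\<close>; so parities are added by \<open>\<noteq>\<close>.
  A word is a list of letters; \<open>d x\<close> tells whether the letter \<open>x\<close> is odd, and \<open>wodd d w\<close> whether the
  word \<open>w\<close> is.\<close>

definition signed :: "bool \<Rightarrow> 'b::ab_group_add \<Rightarrow> 'b" where
  "signed c x = (if c then - x else x)"

lemma signed_simps [simp]:
  "signed False x = x" "signed True x = - x" "signed c 0 = 0" "signed c (signed c' x) = signed (c \<noteq> c') x"
  "signed c (- x) = - signed c x"
  by (auto simp: signed_def)

lemma signed_add: "signed c (x + y) = signed c x + signed c y"
  by (simp add: signed_def)

lemma signed_diff: "signed c (x - y) = signed c x - signed c y"
  by (simp add: signed_def)

lemma signed_fun: "signed c f x = signed c (f x)"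
  by (simp add: signed_def)

lemma additive_zero:
  fixes h :: "'a::ab_group_add \<Rightarrow> 'b::ab_group_add"
  assumes "\<And>x y. h (x + y) = h x + h y"
  shows "h 0 = 0"
  using assms[of 0 0] by simp

lemma additive_signed:
  fixes h :: "'a::ab_group_add \<Rightarrow> 'b::ab_group_add"
  assumes "\<And>x y. h (x + y) = h x + h y"
  shows "h (signed c x) = signed c (h x)"
proof -
  have "h x + h (- x) = 0"
    using assms[of x "- x"] additive_zero[of h] assms by simp
  then show ?thesis
    by (simp add: signed_def eq_neg_iff_add_eq_0 add.commute)
qed

lemma signed_cong: "c = c' \<Longrightarrow> signed c x = signed c' x"
  by simp

fun wodd :: "('a \<Rightarrow> bool) \<Rightarrow> 'a list \<Rightarrow> bool" where
  "wodd d [] = False"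
| "wodd d (x # w) = (d x \<noteq> wodd d w)"

lemma wodd_append [simp]: "wodd d (v @ w) = (wodd d v \<noteq> wodd d w)"
  by (induction v) auto

lemma wodd_True [simp]: "wodd (\<lambda>_. True) w = odd (length w)"
  by (induction w) auto

text \<open>The sum of \<open>F a b\<close> over the splittings of the word into complementary subwords \<open>a\<close> and \<open>b\<close>, with
  the Koszul sign of bringing \<open>a\<close> in front of \<open>b\<close>.\<close>

fun unshuffle :: "('a \<Rightarrow> bool) \<Rightarrow> ('a list \<Rightarrow> 'a list \<Rightarrow> 'b::ab_group_add) \<Rightarrow> 'a list \<Rightarrow> 'b" where
  "unshuffle d F [] = F [] []"
| "unshuffle d F (x # w) =
     unshuffle d (\<lambda>a b. F (x # a) b) w + unshuffle d (\<lambda>a b. signed (d x \<and> wodd d a) (F a (x # b))) w"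

lemma unshuffle_cong:
  assumes "\<And>a b. length a + length b = length w \<Longrightarrow> (wodd d a \<noteq> wodd d b) = wodd d w \<Longrightarrow>
      set a \<union> set b = set w \<Longrightarrow> F a b = G a b"
  shows "unshuffle d F w = unshuffle d G w"
  using assms
proof (induction w arbitrary: F G)
  case (Cons x w)
  have "unshuffle d (\<lambda>a b. F (x # a) b) w = unshuffle d (\<lambda>a b. G (x # a) b) w"
    by (rule Cons.IH, rule Cons.prems) auto
  moreover have "unshuffle d (\<lambda>a b. signed (d x \<and> wodd d a) (F a (x # b))) w
      = unshuffle d (\<lambda>a b. signed (d x \<and> wodd d a) (G a (x # b))) w"
    by (rule Cons.IH, rule arg_cong[where f = "signed _"], rule Cons.prems) auto
  ultimately show ?case by simp
qed auto

lemma unshuffle_hom: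
  fixes h :: "'a::ab_group_add \<Rightarrow> 'b::ab_group_add"
  assumes "\<And>x y. h (x + y) = h x + h y"
  shows "h (unshuffle d F w) = unshuffle d (\<lambda>a b. h (F a b)) w"
  by (induction w arbitrary: F) (simp_all add: assms additive_signed[of h, OF assms])

lemma unshuffle_add: "unshuffle d (\<lambda>a b. F a b + G a b) w = unshuffle d F w + unshuffle d G w"
  by (induction w arbitrary: F G) (simp_all add: signed_add algebra_simps)

lemma unshuffle_signed: "unshuffle d (\<lambda>a b. signed c (F a b)) w = signed c (unshuffle d F w)"
  using unshuffle_hom[of "signed c" d F w] by (simp add: signed_add)

lemma unshuffle_minus: "unshuffle d (\<lambda>a b. - F a b) w = - unshuffle d F w"
  using unshuffle_signed[of d True F w] by simp

lemma unshuffle_diff: "unshuffle d (\<lambda>a b. F a b - G a b) w = unshuffle d F w - unshuffle d G w"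
  using unshuffle_add[of d F "\<lambda>a b. - G a b" w] by (simp add: unshuffle_minus)

lemma unshuffle_0 [simp]: "unshuffle d (\<lambda>a b. 0) w = 0"
  by (induction w) auto

lemma unshuffle_zero:
  assumes "\<And>a b. length a + length b = length w \<Longrightarrow> (wodd d a \<noteq> wodd d b) = wodd d w \<Longrightarrow>
      set a \<union> set b = set w \<Longrightarrow> F a b = 0"
  shows "unshuffle d F w = 0"
  using unshuffle_cong[of w d F "\<lambda>a b. 0"] assms by simp

text \<open>Coassociativity of the unshuffle coproduct: either side splits the word into three
  complementary subwords with the same Koszul sign. The induction decides in which of the three the
  first letter lands; 1 to 3 move its sign through the inner splitting.\<close>

lemma unshuffle_assoc:
  "unshuffle d (\<lambda>a b. unshuffle d (\<lambda>a' a''. F a' a'' b) a) w = unshuffle d (\<lambda>a b. unshuffle d (\<lambda>b' b''. F a b' b'') b) w"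
proof (induction w arbitrary: F)
  case (Cons x w)
  have 1: "unshuffle d (\<lambda>a b. signed (d x \<and> wodd d a) (unshuffle d (\<lambda>a' a''. F a' a'' (x # b)) a)) w
      = unshuffle d (\<lambda>a b. unshuffle d (\<lambda>a' a''. signed (d x \<and> (wodd d a' \<noteq> wodd d a'')) (F a' a'' (x # b))) a) w"
    by (intro unshuffle_cong, subst unshuffle_signed[symmetric], intro unshuffle_cong, rule signed_cong) auto
  have 2: "unshuffle d (\<lambda>a b. unshuffle d (\<lambda>b' b''. signed (d x \<and> (wodd d a \<noteq> wodd d b')) (F a b' (x # b''))) b) w
      = unshuffle d (\<lambda>a b. signed (d x \<and> wodd d a) (unshuffle d (\<lambda>b' b''. signed (d x \<and> wodd d b') (F a b' (x # b''))) b)) w"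
    by (intro unshuffle_cong, subst unshuffle_signed[symmetric], intro unshuffle_cong, simp, rule signed_cong) auto
  have 3: "unshuffle d (\<lambda>a b. unshuffle d (\<lambda>b' b''. signed (d x \<and> wodd d a) (F a (x # b') b'')) b) w
      = unshuffle d (\<lambda>a b. signed (d x \<and> wodd d a) (unshuffle d (\<lambda>b' b''. F a (x # b') b'') b)) w"
    by (rule unshuffle_cong) (rule unshuffle_signed)
  show ?case
    unfolding unshuffle.simps signed_add unshuffle_add add.assoc 1 Cons 2 3 by (rule refl)
qed simp

text \<open>Graded cocommutativity: exchanging the two parts costs the sign of moving one past the
  other.\<close>

lemma unshuffle_commute: "unshuffle d F w = unshuffle d (\<lambda>a b. signed (wodd d a \<and> wodd d b) (F b a)) w"
proof (induction w arbitrary: F)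
  case (Cons x w)
  show ?case
    apply (simp only: unshuffle.simps)
    apply (subst add.commute)
    apply (intro arg_cong2[of _ _ _ _ "(+)"])
     apply (subst Cons, rule unshuffle_cong, simp, rule signed_cong, auto)[1]
    apply (subst Cons, rule unshuffle_cong, simp, rule signed_cong, auto)
    done
qed simp

text \<open>The coproduct is multiplicative for concatenation; the sign is that of
  \<open>a'\<close>, taken from \<open>w\<close>, passing \<open>b\<close>, left over from
  \<open>v\<close>.\<close>

lemma unshuffle_append:
  "unshuffle d F (v @ w) = unshuffle d (\<lambda>a b. unshuffle d (\<lambda>a' b'. signed (wodd d b \<and> wodd d a') (F (a @ a') (b @ b'))) w) v"
proof (induction v arbitrary: F)
  case (Cons x v)
  have "unshuffle d (\<lambda>a b. unshuffle d (\<lambda>a' b'. signed ((wodd d b \<and> wodd d a') \<noteq> (d x \<and> (wodd d a \<noteq> wodd d a'))) (F (a @ a') (x # b @ b'))) w) v =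
    unshuffle d (\<lambda>a b. signed (d x \<and> wodd d a) (unshuffle d (\<lambda>a' b'. signed ((d x \<noteq> wodd d b) \<and> wodd d a') (F (a @ a') (x # b @ b'))) w)) v"
    by (intro unshuffle_cong, subst unshuffle_signed[symmetric], intro unshuffle_cong) (auto simp: signed_def)
  then show ?case by (simp add: Cons)
qed simp

text \<open>Coassociativity lets cocommutativity act on the first two of three parts. In this form
  blocks of arguments are interchanged below.\<close>

lemma unshuffle_swap:
  "unshuffle d (\<lambda>a b. unshuffle d (\<lambda>b' b''. F a b' b'') b) w
    = unshuffle d (\<lambda>a b. unshuffle d (\<lambda>b' b''. signed (wodd d a \<and> wodd d b') (F b' a b'')) b) w"
proof -
  have "unshuffle d (\<lambda>a b. unshuffle d (\<lambda>b' b''. F a b' b'') b) w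
    = unshuffle d (\<lambda>a b. unshuffle d (\<lambda>a' a''. signed (wodd d a' \<and> wodd d a'') (F a'' a' b)) a) w"
    unfolding unshuffle_assoc[symmetric]
    by (subst unshuffle_commute) (rule refl)
  then show ?thesis by (simp add: unshuffle_assoc)
qed

text \<open>Only adjacent letters are exchanged, which suits induction on words; arbitrary
  permutations follow in \<open>gsym_permute\<close>.\<close>

definition gsym :: "('a \<Rightarrow> bool) \<Rightarrow> ('a list \<Rightarrow> 'b::ab_group_add) \<Rightarrow> bool" where
  "gsym d F \<longleftrightarrow> (\<forall>u x y v. F (u @ x # y # v) = signed (d x \<and> d y) (F (u @ y # x # v)))"

lemma gsymD: "gsym d F \<Longrightarrow> F (u @ x # y # v) = signed (d x \<and> d y) (F (u @ y # x # v))"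
  unfolding gsym_def by (elim allE)

lemma gsymD0: "gsym d F \<Longrightarrow> F (x # y # v) = signed (d x \<and> d y) (F (y # x # v))"
  using gsymD[of d F "[]"] unfolding append_Nil .

lemma gsym_Cons: "gsym d F \<Longrightarrow> gsym d (\<lambda>w. F (x # w))"
  unfolding gsym_def by (intro allI, subst append_Cons[symmetric], subst append_Cons[symmetric], elim allE)

lemma gsym_front:
  assumes "gsym d F"
  shows "F (u @ x # v) = signed (d x \<and> wodd d u) (F (x # u @ v))"
  using assms
proof (induction u arbitrary: F)
  case (Cons y u)
  have "F (y # u @ x # v) = signed (d x \<and> wodd d u) (F (y # x # u @ v))"
    using Cons.IH[OF gsym_Cons[OF Cons.prems]] .
  also have "\<dots> = signed (d x \<and> wodd d (y # u)) (F (x # y # u @ v))"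
    by (subst gsymD0[OF Cons.prems]) (auto simp: signed_def)
  finally show ?case by simp
qed simp

text \<open>Two adjacent letters either fall into the same part, where the symmetry of
  \<open>F\<close> applies, or into different parts, and then the two mixed terms are exchanged with
  each other.\<close>

lemma unshuffle_gsym:
  assumes "\<And>b. gsym d (\<lambda>a. F a b)" "\<And>a. gsym d (F a)"
  shows "gsym d (unshuffle d F)"
proof -
  have "unshuffle d F (u @ x # y # v) = signed (d x \<and> d y) (unshuffle d F (u @ y # x # v))" for u x y v
    using assms
  proof (induction u arbitrary: F)
    case Nil
    have 1: "F (x # y # a) b = signed (d x \<and> d y) (F (y # x # a) b)" for a b
      using gsymD0[OF Nil(1)] .
    have 2: "F a (x # y # b) = signed (d x \<and> d y) (F a (y # x # b))" for a b
      using gsymD0[OF Nil(2)] .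
    have 3: "unshuffle d (\<lambda>a b. F (x # y # a) b) v = signed (d x \<and> d y) (unshuffle d (\<lambda>a b. F (y # x # a) b) v)"
      by (subst unshuffle_signed[symmetric], rule unshuffle_cong, rule 1)
    have 4: "unshuffle d (\<lambda>a b. signed (d x \<and> wodd d (y # a)) (F (y # a) (x # b))) v
      = signed (d x \<and> d y) (unshuffle d (\<lambda>a b. signed (d x \<and> wodd d a) (F (y # a) (x # b))) v)" for x y
      by (subst unshuffle_signed[symmetric], rule unshuffle_cong, simp, rule signed_cong, auto)
    have 5: "unshuffle d (\<lambda>a b. signed (d y \<and> wodd d a) (signed (d x \<and> wodd d a) (F a (x # y # b)))) v
      = signed (d x \<and> d y) (unshuffle d (\<lambda>a b. signed (d x \<and> wodd d a) (signed (d y \<and> wodd d a) (F a (y # x # b)))) v)"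
      by (subst unshuffle_signed[symmetric], rule unshuffle_cong, subst 2, simp, rule signed_cong, auto)
    have 6: "signed (d x \<and> d y) (unshuffle d (\<lambda>a b. signed (d y \<and> wodd d (x # a)) (F (x # a) (y # b))) v)
      = unshuffle d (\<lambda>a b. signed (d y \<and> wodd d a) (F (x # a) (y # b))) v"
      using 4[of y x] by (simp add: conj_commute)
    show ?case
      unfolding append_Nil unshuffle.simps signed_add 3 4[of x y] 5 6 by (simp only: ac_simps)
  next
    case (Cons z u)
    have "gsym d (\<lambda>a. signed (d z \<and> wodd d a) (F a (z # b)))" for b
      unfolding gsym_def
      by (intro allI, subst gsymD[OF Cons.prems(1)], simp, rule signed_cong, auto)
    moreover have "gsym d (\<lambda>b. signed (d z \<and> wodd d a) (F a (z # b)))" for a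
      unfolding gsym_def
      by (intro allI, subst gsymD[OF gsym_Cons[OF Cons.prems(2)]], simp, rule signed_cong, auto)
    ultimately have "unshuffle d (\<lambda>a b. signed (d z \<and> wodd d a) (F a (z # b))) (u @ x # y # v)
        = signed (d x \<and> d y) (unshuffle d (\<lambda>a b. signed (d z \<and> wodd d a) (F a (z # b))) (u @ y # x # v))"
      by (rule Cons.IH)
    moreover have "unshuffle d (\<lambda>a b. F (z # a) b) (u @ x # y # v)
        = signed (d x \<and> d y) (unshuffle d (\<lambda>a b. F (z # a) b) (u @ y # x # v))"
      by (rule Cons.IH) (auto intro: gsym_Cons Cons.prems)
    ultimately show ?case
      by (simp only: append_Cons unshuffle.simps signed_add)
  qed
  then show ?thesis unfolding gsym_def by blast
qed

section \<open>Symmetric braces\<close>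

locale char0_vector_space = vector_space scale
  for scale :: "'k::field_char_0 \<Rightarrow> 'b::ab_group_add \<Rightarrow> 'b"
begin

definition lin_map :: "('b \<Rightarrow> 'b) \<Rightarrow> bool" where
  "lin_map T \<longleftrightarrow> (\<forall>x y. T (x + y) = T x + T y) \<and> (\<forall>c x. T (scale c x) = scale c (T x))"

text \<open>No arity is fixed, so that a partial evaluation \<open>\<lambda>w. f (x # w)\<close> is
  again of this kind; the recursion of \<open>brace\<close> depends on it. Antisymmetry replaces
  vanishing on repeated arguments; \<open>alternating_maps_iff\<close> reconciles the two.\<close>

definition alt_map :: "('b list \<Rightarrow> 'b) \<Rightarrow> bool" where
  "alt_map f \<longleftrightarrow> (\<forall>u v. lin_map (\<lambda>x. f (u @ x # v))) \<and> gsym (\<lambda>_. True) f"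

lemma lin_map_add: "lin_map T \<Longrightarrow> T (x + y) = T x + T y"
  and lin_map_scale: "lin_map T \<Longrightarrow> T (scale c x) = scale c (T x)"
  unfolding lin_map_def by blast+

lemma lin_map_0: "lin_map T \<Longrightarrow> T 0 = 0"
  using additive_zero[of T] lin_map_add by blast

lemma lin_map_signed: "lin_map T \<Longrightarrow> T (signed c x) = signed c (T x)"
  using additive_signed[of T] lin_map_add by blast

lemma scale_signed: "scale a (signed c x) = signed c (scale a x)"
  by (simp add: signed_def)

lemma lin_map_comp: "lin_map S \<Longrightarrow> lin_map T \<Longrightarrow> lin_map (\<lambda>x. S (T x))"
  unfolding lin_map_def by simp

lemma lin_map_plus: "lin_map S \<Longrightarrow> lin_map T \<Longrightarrow> lin_map (\<lambda>x. S x + T x)"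
  unfolding lin_map_def by (simp add: scale_right_distrib algebra_simps)

lemma lin_map_sgI: "lin_map (signed c)"
  unfolding lin_map_def by (simp add: signed_add scale_signed)

lemma lin_map_scaleI: "lin_map (scale c)"
  unfolding lin_map_def by (simp add: scale_right_distrib scale_left_commute)

lemma alt_mapD_lin_map: "alt_map f \<Longrightarrow> lin_map (\<lambda>x. f (u @ x # v))"
  unfolding alt_map_def by blast

lemma alt_mapD_lin0: "alt_map f \<Longrightarrow> lin_map (\<lambda>x. f (x # v))"
  using alt_mapD_lin_map[of f "[]"] by simp

lemma alt_mapD_gsym: "alt_map f \<Longrightarrow> gsym (\<lambda>_. True) f"
  unfolding alt_map_def by blast

lemma alt_map_Cons: "alt_map f \<Longrightarrow> alt_map (\<lambda>w. f (x # w))"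
  using gsym_Cons[of _ f] alt_mapD_lin_map[of f "x # _"] unfolding alt_map_def by simp

lemma gsym_add: "gsym d f \<Longrightarrow> gsym d g \<Longrightarrow> gsym d (\<lambda>w. f w + g w)"
  unfolding gsym_def[of d "\<lambda>w. f w + g w"] signed_add
  by (intro allI arg_cong2[of _ _ _ _ "(+)"]) (erule gsymD)+

lemma alt_map_comp:
  assumes "lin_map T" "alt_map f"
  shows "alt_map (\<lambda>w. T (f w))"
  unfolding alt_map_def
proof (intro conjI allI)
  show "gsym (\<lambda>_. True) (\<lambda>w. T (f w))"
    unfolding gsym_def
    by (intro allI, subst gsymD[OF alt_mapD_gsym[OF assms(2)]], subst lin_map_signed[OF assms(1)], rule refl)
qed (rule lin_map_comp[OF assms(1) alt_mapD_lin_map[OF assms(2)]])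

lemma alt_map_add: "alt_map f \<Longrightarrow> alt_map g \<Longrightarrow> alt_map (\<lambda>w. f w + g w)"
  unfolding alt_map_def by (simp add: lin_map_plus gsym_add)

lemma alt_map_0: "alt_map (\<lambda>w. 0)" "alt_map 0"
  unfolding alt_map_def lin_map_def gsym_def by simp_all

lemma alt_map_signed: "alt_map f \<Longrightarrow> alt_map (\<lambda>w. signed c (f w))"
  using alt_map_comp lin_map_sgI by blast

lemma unshuffle_lin_map:
  assumes "\<And>u v b. lin_map (\<lambda>x. F (u @ x # v) b)" "\<And>u v a. lin_map (\<lambda>x. F a (u @ x # v))"
  shows "lin_map (\<lambda>x. unshuffle (\<lambda>_. True) F (u @ x # v))"
  using assms
proof (induction u arbitrary: F)
  case Nil
  have 1: "lin_map (\<lambda>x. unshuffle (\<lambda>_. True) (\<lambda>a b. G x a b) v)" if "\<And>a b. lin_map (\<lambda>x. G x a b)" for G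
    using that
  proof (induction v arbitrary: G)
    case (Cons y v)
    show ?case
      by (simp, intro lin_map_plus Cons.IH) (simp_all add: Cons.prems lin_map_comp[OF lin_map_sgI])
  qed simp
  show ?case
    by (simp, intro lin_map_plus 1 lin_map_comp[OF lin_map_sgI])
      (use Nil(1)[of "[]"] Nil(2)[of _ "[]"] in simp_all)
next
  case (Cons z u)
  have "lin_map (\<lambda>x. unshuffle (\<lambda>_. True) (\<lambda>a b. F (z # a) b) (u @ x # v))"
    by (rule Cons.IH) (use Cons.prems(1)[of "z # _"] Cons.prems(2) in simp_all)
  moreover have "lin_map (\<lambda>x. unshuffle (\<lambda>_. True) (\<lambda>a b. signed (True \<and> wodd (\<lambda>_. True) a) (F a (z # b))) (u @ x # v))"
    by (rule Cons.IH)
     (use Cons.prems(1) Cons.prems(2)[of _ "z # _"] in \<open>simp_all add: lin_map_comp[OF lin_map_sgI]\<close>)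
  ultimately show ?case
    unfolding append_Cons unshuffle.simps by (rule lin_map_plus)
qed

lemma unshuffle_alt_map:
  assumes "\<And>b. alt_map (\<lambda>a. F a b)" "\<And>a. alt_map (F a)"
  shows "alt_map (unshuffle (\<lambda>_. True) F)"
  using assms unfolding alt_map_def by (auto intro!: unshuffle_lin_map unshuffle_gsym)

end

text \<open>A letter \<open>(p, \<xi>)\<close> records the parity \<open>p\<close> of the degree of \<open>\<xi>\<close>. Arguments in \<open>\<gg>\<close> are odd, so a block
  \<open>a\<close> with \<open>\<xi> a \<noteq> 0\<close> has parity \<open>\<not> p\<close>; the sign is that of moving \<open>a\<close> leftwards past the letters \<open>\<Xi>\<close>.\<close>

fun brace :: "('v list \<Rightarrow> 'v) \<Rightarrow> (bool \<times> ('v list \<Rightarrow> 'v::ab_group_add)) list \<Rightarrow> 'v list \<Rightarrow> 'v" where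
  "brace f [] X = f X"
| "brace f (x # \<Xi>) X = unshuffle (\<lambda>_. True)
     (\<lambda>a b. signed (\<not> fst x \<and> wodd fst \<Xi>) (brace (\<lambda>ys. f (snd x a # ys)) \<Xi> b)) X"

lemma brace_Nil: "brace f [] = f"
  by (rule ext) simp

lemma brace_hom:
  assumes "\<And>x y. h (x + y) = h x + h y"
  shows "brace (\<lambda>ys. h (f ys)) \<Xi> X = h (brace f \<Xi> X)"
proof (induction \<Xi> arbitrary: f X)
  case (Cons x \<Xi>)
  show ?case
    by (simp add: unshuffle_hom[of h, OF assms] Cons additive_signed[of h, OF assms])
qed simp

lemma brace_add: "brace (\<lambda>ys. f ys + g ys) \<Xi> X = brace f \<Xi> X + brace g \<Xi> X"
  by (induction \<Xi> arbitrary: f g X) (simp_all add: signed_add unshuffle_add)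

lemma brace_0 [simp]: "brace (\<lambda>ys. 0) \<Xi> X = 0"
  by (induction \<Xi> arbitrary: X) (simp_all)

lemma brace_signed: "brace (\<lambda>ys. signed c (f ys)) \<Xi> X = signed c (brace f \<Xi> X)"
  by (rule brace_hom) (simp add: signed_add)

lemma brace_unshuffle: "brace (\<lambda>ys. unshuffle d (\<lambda>a b. F a b ys) w) \<Xi> X = unshuffle d (\<lambda>a b. brace (F a b) \<Xi> X) w"
proof (induction w arbitrary: F)
  case (Cons x w)
  show ?case
    by (simp add: brace_add Cons[of "\<lambda>a. F (x # a)"]
       Cons[of "\<lambda>a b ys. signed (d x \<and> wodd d a) (F a (x # b) ys)"] brace_signed)
qed simp

lemma brace_cong: "(\<And>ys. f ys = g ys) \<Longrightarrow> brace f \<Xi> X = brace g \<Xi> X"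
  by (rule arg_cong[where f = "\<lambda>f. brace f \<Xi> X"]) (rule ext)

text \<open>The degree of a map is its number of arguments minus one.\<close>

definition has_parity :: "bool \<Rightarrow> ('v list \<Rightarrow> 'v::ab_group_add) \<Rightarrow> bool" where
  "has_parity p f \<longleftrightarrow> (\<forall>X. odd (length X) = p \<longrightarrow> f X = 0)"

lemma has_parityD: "has_parity p f \<Longrightarrow> odd (length X) = p \<Longrightarrow> f X = 0"
  unfolding has_parity_def by blast

lemma has_parity_Cons: "has_parity p f \<Longrightarrow> has_parity (\<not> p) (\<lambda>w. f (x # w))"
  unfolding has_parity_def by auto

definition has_degree :: "int \<Rightarrow> ('v list \<Rightarrow> 'v::ab_group_add) \<Rightarrow> bool" where
  "has_degree n f \<longleftrightarrow> (\<forall>X. int (length X) \<noteq> n + 1 \<longrightarrow> f X = 0)"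

lemma has_degreeD: "has_degree n f \<Longrightarrow> int (length X) \<noteq> n + 1 \<Longrightarrow> f X = 0"
  unfolding has_degree_def by blast

lemma has_degree_Cons: "has_degree n f \<Longrightarrow> has_degree (n - 1) (\<lambda>w. f (x # w))"
  unfolding has_degree_def by auto

lemma has_degree_has_parity: "has_degree n f \<Longrightarrow> has_parity (odd n) f"
  unfolding has_parity_def
proof (intro allI impI has_degreeD)
  fix X :: "'a list"
  assume "odd (length X) = odd n"
  then have "odd (int (length X)) = odd n" by simp
  then show "int (length X) \<noteq> n + 1" by presburger
qed

context char0_vector_space
begin

definition alt_word :: "(bool \<times> ('b list \<Rightarrow> 'b)) list \<Rightarrow> bool" where
  "alt_word \<Xi> \<longleftrightarrow> (\<forall>x\<in>set \<Xi>. alt_map (snd x) \<and> has_parity (fst x) (snd x))"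

lemma alt_word_simps [simp]:
  "alt_word []" "alt_word (x # \<Xi>) \<longleftrightarrow> alt_map (snd x) \<and> has_parity (fst x) (snd x) \<and> alt_word \<Xi>"
  "alt_word (\<Xi> @ \<Xi>') \<longleftrightarrow> alt_word \<Xi> \<and> alt_word \<Xi>'"
  by (auto simp: alt_word_def)

lemma alt_word_Un: "set a \<union> set b = set w \<Longrightarrow> alt_word w \<Longrightarrow> alt_word a"
   "set a \<union> set b = set w \<Longrightarrow> alt_word w \<Longrightarrow> alt_word b"
  by (auto simp: alt_word_def)

lemma lin_map_brace: "(\<And>ys. lin_map (\<lambda>x. F x ys)) \<Longrightarrow> lin_map (\<lambda>x. brace (F x) \<Xi> X)"
proof -
  assume F: "\<And>ys. lin_map (\<lambda>x. F x ys)"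
  have "F (x + y) = (\<lambda>ys. F x ys + F y ys)" "F (scale c x) = (\<lambda>ys. scale c (F x ys))" for x y c
    using lin_map_add[OF F] lin_map_scale[OF F] by auto
  then show ?thesis
    unfolding lin_map_def by (simp add: brace_add brace_hom[of "scale _"] scale_right_distrib)
qed

lemma alt_map_brace:
  assumes "alt_map f" "\<And>x. x \<in> set \<Xi> \<Longrightarrow> alt_map (snd x)"
  shows "alt_map (brace f \<Xi>)"
  using assms
proof (induction \<Xi> arbitrary: f)
  case (Cons x \<Xi>)
  have "alt_map (\<lambda>a. brace (\<lambda>ys. f (snd x a # ys)) \<Xi> b)" for b
    by (rule alt_map_comp[of "\<lambda>v. brace (\<lambda>ys. f (v # ys)) \<Xi> b"])
      (use Cons.prems in \<open>auto intro!: lin_map_brace alt_mapD_lin0\<close>)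
  moreover have "alt_map (\<lambda>b. brace (\<lambda>ys. f (snd x a # ys)) \<Xi> b)" for a
    by (rule Cons.IH[OF alt_map_Cons[OF Cons.prems(1)]]) (use Cons.prems in auto)
  ultimately have "alt_map (unshuffle (\<lambda>_. True)
     (\<lambda>a b. signed (\<not> fst x \<and> wodd fst \<Xi>) (brace (\<lambda>ys. f (snd x a # ys)) \<Xi> b)))"
    by (intro unshuffle_alt_map alt_map_signed)
  then show ?case by (simp add: brace.simps[abs_def])
qed (simp add: brace_Nil)

lemma alt_word_imp_alt_map: "alt_word \<Xi> \<Longrightarrow> x \<in> set \<Xi> \<Longrightarrow> alt_map (snd x)"
  by (auto simp: alt_word_def)

text \<open>A block on which the letter vanishes kills the term, because \<open>f\<close> is linear
  in that slot. For the other blocks the parity of the block is known, and fixing one argument of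
  \<open>f\<close> flips the parity of \<open>f\<close>.\<close>

lemma has_parity_brace:
  assumes "has_parity p f" "alt_map f" "alt_word \<Xi>"
  shows "has_parity (p \<noteq> wodd fst \<Xi>) (brace f \<Xi>)"
  using assms
proof (induction \<Xi> arbitrary: f p)
  case (Cons x \<Xi>)
  show ?case
    unfolding has_parity_def brace.simps
  proof (intro allI impI unshuffle_zero)
    fix X a b :: "'b list"
    assume X: "odd (length X) = (p \<noteq> wodd fst (x # \<Xi>))" "length a + length b = length X"
    show "signed (\<not> fst x \<and> wodd fst \<Xi>) (brace (\<lambda>ys. f (snd x a # ys)) \<Xi> b) = 0"
    proof (cases "odd (length a) = fst x")
      case True
      then have "snd x a = 0" using has_parityD Cons.prems(3) by auto
      then have "(\<lambda>ys. f (snd x a # ys)) = (\<lambda>ys. 0)"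
        using lin_map_0[OF alt_mapD_lin0[OF Cons.prems(2)]] by auto
      then show ?thesis by simp
    next
      case False
      have "has_parity ((\<not> p) \<noteq> wodd fst \<Xi>) (brace (\<lambda>ys. f (snd x a # ys)) \<Xi>)"
        by (rule Cons.IH[OF has_parity_Cons[OF Cons.prems(1)] alt_map_Cons[OF Cons.prems(2)]])
          (use Cons.prems in simp)
      moreover have "odd (length X) = (odd (length a) \<noteq> odd (length b))"
        unfolding X(2)[symmetric] by simp
      then have "odd (length b) = ((\<not> p) \<noteq> wodd fst \<Xi>)"
        using X(1) False unfolding wodd.simps by argo
      ultimately have "brace (\<lambda>ys. f (snd x a # ys)) \<Xi> b = 0"
        by (rule has_parityD)
      then show ?thesis by simp
    qed
  qed
qed (simp add: brace_Nil)

lemma has_degree_brace: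
  assumes "has_degree n f" "alt_map f" "list_all2 (\<lambda>m x. has_degree m (snd x)) ms \<Xi>"
  shows "has_degree (n + sum_list ms) (brace f \<Xi>)"
  using assms(3,1,2)
proof (induction ms \<Xi> arbitrary: f n)
  case (Cons m ms x \<Xi>)
  show ?case
    unfolding has_degree_def brace.simps
  proof (intro allI impI unshuffle_zero)
    fix X a b :: "'b list"
    assume X: "int (length X) \<noteq> n + sum_list (m # ms) + 1" "length a + length b = length X"
    show "signed (\<not> fst x \<and> wodd fst \<Xi>) (brace (\<lambda>ys. f (snd x a # ys)) \<Xi> b) = 0"
    proof (cases "int (length a) = m + 1")
      case False
      then have "snd x a = 0" using has_degreeD Cons by auto
      then have "(\<lambda>ys. f (snd x a # ys)) = (\<lambda>ys. 0)"
        using lin_map_0[OF alt_mapD_lin0[OF Cons.prems(2)]] by auto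
      then show ?thesis by simp
    next
      case True
      have "has_degree (n - 1 + sum_list ms) (brace (\<lambda>ys. f (snd x a # ys)) \<Xi>)"
        by (rule Cons.IH[OF has_degree_Cons[OF Cons.prems(1)] alt_map_Cons[OF Cons.prems(2)]])
      then have "brace (\<lambda>ys. f (snd x a # ys)) \<Xi> b = 0"
        by (rule has_degreeD) (use X True in auto)
      then show ?thesis by simp
    qed
  qed
qed (simp add: brace_Nil)

lemma brace_too_many:
  assumes "has_degree n f" "int (length \<Xi>) > n + 1"
  shows "brace f \<Xi> X = 0"
  using assms
proof (induction \<Xi> arbitrary: f n X)
  case (Cons x \<Xi>)
  then show ?case using Cons.IH[OF has_degree_Cons] by simp
qed (auto simp: has_degree_def)

lemma brace_nil:
  assumes "f [] = 0" "alt_map f" "\<And>x. x \<in> set \<Xi> \<Longrightarrow> snd x [] = 0"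
  shows "brace f \<Xi> [] = 0"
  using assms(1,3)
  by (cases \<Xi>) (simp_all add: lin_map_0[OF alt_mapD_lin0[OF assms(2)]])

lemma brace_slot_add:
  assumes "alt_map f"
  shows "brace f (u @ (p, \<lambda>a. g a + h a) # v) X = brace f (u @ (p, g) # v) X + brace f (u @ (p, h) # v) X"
  using assms
  by (induction u arbitrary: f X)
    (simp_all add: alt_map_Cons lin_map_add[OF alt_mapD_lin0] brace_add signed_add unshuffle_add)

lemma brace_slot_scale:
  assumes "alt_map f"
  shows "brace f (u @ (p, \<lambda>a. scale c (g a)) # v) X = scale c (brace f (u @ (p, g) # v) X)"
  using assms
  by (induction u arbitrary: f X)
    (simp_all add: alt_map_Cons lin_map_scale[OF alt_mapD_lin0] brace_hom[of "scale _"] scale_right_distrib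
       unshuffle_hom[of "scale _"] scale_signed)

lemma brace_slot_0:
  assumes "alt_map f"
  shows "brace f (u @ (p, \<lambda>a. 0) # v) X = 0"
  using brace_slot_scale[OF assms, of u p 0 "\<lambda>a. 0" v X] by simp

lemma brace_slot_signed:
  assumes "alt_map f"
  shows "brace f (u @ (p, \<lambda>a. signed c (g a)) # v) X = signed c (brace f (u @ (p, g) # v) X)"
  using brace_slot_scale[OF assms, of u p "-1" g v X] by (cases c) simp_all

text \<open>Graded symmetry of the brace in its letters. Interchanging the two blocks gives
  (-1)^((p+1)(q+1)) for letters of parities p and q, interchanging their values in \<open>f\<close>
  gives -1, and the signs in the definition of \<open>brace\<close> differ by (-1)^(p+q); the
  product is (-1)^(pq). Blocks whose lengths have the other parity contribute 0 by
  \<open>z\<close>.\<close>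

lemma brace_swap0:
  assumes "alt_map f" "alt_map (snd x)" "has_parity (fst x) (snd x)" "alt_map (snd y)" "has_parity (fst y) (snd y)"
  shows "brace f (x # y # \<Xi>) X = signed (fst x \<and> fst y) (brace f (y # x # \<Xi>) X)"
proof -
  let ?B = "\<lambda>a b. brace (\<lambda>ys. f (snd x a # snd y b # ys)) \<Xi>"
  let ?B' = "\<lambda>b a. brace (\<lambda>ys. f (snd y b # snd x a # ys)) \<Xi>"
  have sw: "f (u # v # ys) = - f (v # u # ys)" for u v ys
    by (subst gsymD0[OF alt_mapD_gsym[OF assms(1)]]) simp
  have B: "?B a b X = - ?B' b a X" for a b X
  proof -
    have "?B a b X = brace (\<lambda>ys. signed True (f (snd y b # snd x a # ys))) \<Xi> X"
      by (rule brace_cong, subst sw) simp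
    then show ?thesis unfolding brace_signed by simp
  qed
  have z: "?B a b X = 0" if "odd (length a) = fst x \<or> odd (length b) = fst y" for a b X
  proof -
    have "(\<lambda>ys. f (snd x a # snd y b # ys)) = (\<lambda>ys. 0)"
      using that lin_map_0[OF alt_mapD_lin0[OF assms(1)]]
        lin_map_0[OF alt_mapD_lin0[OF alt_map_Cons[OF assms(1)]]] has_parityD assms(3,5) by fastforce
    then show ?thesis by simp
  qed
  have "brace f (x # y # \<Xi>) X = unshuffle (\<lambda>_. True) (\<lambda>a b. unshuffle (\<lambda>_. True) (\<lambda>b' b''.
     signed ((\<not> fst x \<and> (fst y \<noteq> wodd fst \<Xi>)) \<noteq> (\<not> fst y \<and> wodd fst \<Xi>)) (?B a b' b'')) b) X"
    by (simp add: unshuffle_signed)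
  also have "\<dots> = unshuffle (\<lambda>_. True) (\<lambda>a b. unshuffle (\<lambda>_. True) (\<lambda>b' b''.
     signed (fst x \<and> fst y) (signed (\<not> fst y \<and> (fst x \<noteq> wodd fst \<Xi>)) (signed (\<not> fst x \<and> wodd fst \<Xi>) (?B' a b' b'')))) b) X"
    apply (subst unshuffle_swap)
    apply (intro unshuffle_cong)
    subgoal for a b b' b''
      apply (cases "odd (length b') = fst x \<or> odd (length a) = fst y")
      using z[of b' a b''] B[of b' a b''] 
       apply simp
       using B[of b' a b'']
      apply (auto simp: signed_def)
      done
    done
  also have "\<dots> = signed (fst x \<and> fst y) (brace f (y # x # \<Xi>) X)"
    by (simp add: unshuffle_signed)
  finally show ?thesis .
qed

lemma brace_swap:
  assumes "alt_map f" "alt_word (u @ x # y # v)"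
  shows "brace f (u @ x # y # v) X = signed (fst x \<and> fst y) (brace f (u @ y # x # v) X)"
  using assms
proof (induction u arbitrary: f X)
  case Nil
  then show ?case
    unfolding append_Nil by (intro brace_swap0) simp_all
next
  case (Cons z u)
  have IH: "brace (\<lambda>ys. f (snd z a # ys)) (u @ x # y # v) b
      = signed (fst x \<and> fst y) (brace (\<lambda>ys. f (snd z a # ys)) (u @ y # x # v) b)" for a b
    by (rule Cons.IH[OF alt_map_Cons[OF Cons.prems(1)]]) (use Cons.prems(2) in simp)
  show ?case
    unfolding append_Cons brace.simps(2)[of f z]
    unfolding IH by (subst unshuffle_signed[symmetric], rule unshuffle_cong, unfold signed_simps, rule signed_cong, auto)
qed

lemma brace_front:
  assumes "alt_map f" "alt_word (u @ x # v)"
  shows "brace f (u @ x # v) X = signed (fst x \<and> wodd fst u) (brace f (x # u @ v) X)"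
  using assms
proof (induction u arbitrary: f X)
  case (Cons z u)
  have IH: "brace (\<lambda>ys. f (snd z a # ys)) (u @ x # v) b
      = signed (fst x \<and> wodd fst u) (brace (\<lambda>ys. f (snd z a # ys)) (x # u @ v) b)" for a b
    by (rule Cons.IH[OF alt_map_Cons[OF Cons.prems(1)]]) (use Cons.prems(2) in simp)
  have "brace f (z # u @ x # v) X = signed (fst x \<and> wodd fst u) (brace f (z # x # u @ v) X)"
    unfolding append_Cons brace.simps(2)[of f z]
    unfolding IH by (subst unshuffle_signed[symmetric], rule unshuffle_cong, unfold signed_simps, rule signed_cong, auto)
  also have "\<dots> = signed (fst x \<and> wodd fst (z # u)) (brace f (x # z # u @ v) X)"
    using Cons.prems by (subst brace_swap0[of f z x]) (simp_all, rule signed_cong, auto)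
  finally show ?case by simp
qed simp

end

section \<open>The two brace identities\<close>

text \<open>f{g}, the composition behind the Nijenhuis-Richardson bracket
  (\<open>nr_comp_plug\<close>), with the arity condition left to the vanishing of \<open>g\<close>
  on blocks of the wrong length.\<close>

definition plug :: "('v list \<Rightarrow> 'v) \<Rightarrow> ('v list \<Rightarrow> 'v) \<Rightarrow> 'v list \<Rightarrow> 'v::ab_group_add" where
  "plug f g = unshuffle (\<lambda>_. True) (\<lambda>a b. f (g a # b))"

lemma brace_single: "brace f [y] = plug f (snd y)"
  by (rule ext) (simp add: plug_def)

text \<open>The sum over the letters \<open>\<xi>\<close> of the word, with \<open>\<xi>\<close> replaced by \<open>\<xi>{g}\<close> and the sign of moving
  \<open>g\<close> to \<open>\<xi>\<close> from the right end of the word.\<close>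

fun bderiv :: "((bool \<times> ('v list \<Rightarrow> 'v::ab_group_add)) list \<Rightarrow> 'c::ab_group_add) \<Rightarrow>
    bool \<times> ('v list \<Rightarrow> 'v) \<Rightarrow> (bool \<times> ('v list \<Rightarrow> 'v)) list \<Rightarrow> 'c" where
  "bderiv K g [] = 0"
| "bderiv K g (x # \<Xi>) = signed (fst g \<and> wodd fst \<Xi>) (K ((fst x \<noteq> fst g, plug (snd x) (snd g)) # \<Xi>))
     + bderiv (\<lambda>W. K (x # W)) g \<Xi>"

lemma bderiv_hom:
  assumes "\<And>x y. h (x + y) = h x + h y"
  shows "bderiv (\<lambda>W. h (K W)) g \<Xi> = h (bderiv K g \<Xi>)"
  by (induction \<Xi> arbitrary: K) (simp_all add: assms additive_signed[of h, OF assms] additive_zero[of h, OF assms])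

lemma bderiv_signed: "bderiv (\<lambda>W. signed c (K W)) g \<Xi> = signed c (bderiv K g \<Xi>)"
  by (rule bderiv_hom) (rule signed_add)

lemma bderiv_add: "bderiv (\<lambda>W. K W + K' W) g \<Xi> = bderiv K g \<Xi> + bderiv K' g \<Xi>"
  by (induction \<Xi> arbitrary: K K') (simp_all add: signed_add algebra_simps)

lemma bderiv_unshuffle: "bderiv (\<lambda>W. unshuffle d (\<lambda>a b. F a b W) w) g \<Xi> = unshuffle d (\<lambda>a b. bderiv (F a b) g \<Xi>) w"
  by (induction \<Xi> arbitrary: F) (simp_all add: unshuffle_add unshuffle_signed)

text \<open>The counit of the unshuffle coproduct: a splitting with a prescribed empty part occurs
  exactly once, with sign +.\<close>

lemma unshuffle_nil:
  "unshuffle d (\<lambda>a b. if a = [] then H b else 0) w = H w"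
  "unshuffle d (\<lambda>a b. if b = [] then H a else 0) w = H w"
proof -
  show "unshuffle d (\<lambda>a b. if a = [] then H b else 0) w = H w"
  proof (induction w arbitrary: H)
    case (Cons x w)
    have "unshuffle d (\<lambda>a b. signed (d x \<and> wodd d a) (if a = [] then H (x # b) else 0)) w
        = unshuffle d (\<lambda>a b. if a = [] then H (x # b) else 0) w"
      by (rule unshuffle_cong) auto
    then show ?case by (simp add: Cons)
  qed simp
  show "unshuffle d (\<lambda>a b. if b = [] then H a else 0) w = H w"
    by (induction w arbitrary: H) simp_all
qed

text \<open>The sum over all ways of moving one letter to the front, with Koszul sign.\<close>

fun pull :: "('a \<Rightarrow> bool) \<Rightarrow> ('a \<Rightarrow> 'a list \<Rightarrow> 'b::ab_group_add) \<Rightarrow> 'a list \<Rightarrow> 'b" where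
  "pull d G [] = 0"
| "pull d G (x # w) = G x w + pull d (\<lambda>y w'. signed (d x \<and> d y) (G y (x # w'))) w"

text \<open>Pulling a letter is splitting off a one-letter first part; in this way the laws of
  \<open>unshuffle\<close> become available for \<open>pull\<close>.\<close>

lemma pull_unshuffle: "unshuffle d (\<lambda>a b. if length a = 1 then G (hd a) b else 0) w = pull d G w"
proof (induction w arbitrary: G)
  case (Cons x w)
  have "unshuffle d (\<lambda>a b. if length (x # a) = 1 then G (hd (x # a)) b else 0) w = G x w"
    using unshuffle_nil(1)[of d "G x" w] by (simp cong: if_cong)
  moreover have "unshuffle d (\<lambda>a b. signed (d x \<and> wodd d a) (if length a = 1 then G (hd a) (x # b) else 0)) w
      = unshuffle d (\<lambda>a b. if length a = 1 then signed (d x \<and> d (hd a)) (G (hd a) (x # b)) else 0) w"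
    by (rule unshuffle_cong) (auto simp: length_Suc_conv)
  ultimately show ?case
    by (simp only: unshuffle.simps pull.simps Cons.IH[of "\<lambda>y w'. signed (d x \<and> d y) (G y (x # w'))"])
qed simp

lemma pull_signed: "pull d (\<lambda>y W. signed c (G y W)) w = signed c (pull d G w)"
  unfolding pull_unshuffle[symmetric] by (subst unshuffle_signed[symmetric], rule unshuffle_cong) simp

lemma pull_cong:
  assumes "\<And>y b. y \<in> set w \<Longrightarrow> set b \<subseteq> set w \<Longrightarrow> length w = Suc (length b) \<Longrightarrow>
    (d y \<noteq> wodd d b) = wodd d w \<Longrightarrow> G y b = G' y b"
  shows "pull d G w = pull d G' w"
  unfolding pull_unshuffle[symmetric]
proof (rule unshuffle_cong)
  fix a b assume *: "length a + length b = length w" "(wodd d a \<noteq> wodd d b) = wodd d w" "set a \<union> set b = set w"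
  show "(if length a = 1 then G (hd a) b else 0) = (if length a = 1 then G' (hd a) b else 0)"
  proof (cases "length a = 1")
    case True
    then obtain x where "a = [x]" by (auto simp: length_Suc_conv)
    with * assms[of x b] show ?thesis by auto
  qed auto
qed

context char0_vector_space
begin

lemma alt_map_plug: "alt_map f \<Longrightarrow> alt_map g \<Longrightarrow> alt_map (plug f g)"
  using alt_map_brace[of f "[(True, g)]"] by (simp add: brace_single)

lemma has_parity_plug: "alt_map f \<Longrightarrow> has_parity p f \<Longrightarrow> alt_map g \<Longrightarrow> has_parity q g \<Longrightarrow> has_parity (p \<noteq> q) (plug f g)"
  using has_parity_brace[of p f "[(q, g)]"] by (simp add: brace_single)

lemma bderiv_cong:
  assumes "\<And>W. wodd fst W = (wodd fst \<Xi> \<noteq> fst g) \<Longrightarrow> length W = length \<Xi> \<Longrightarrow> alt_word W \<Longrightarrow> K W = K' W"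
    and "alt_word \<Xi>" "alt_word [g]"
  shows "bderiv K g \<Xi> = bderiv K' g \<Xi>"
  using assms(1,2)
proof (induction \<Xi> arbitrary: K K')
  case (Cons x \<Xi>)
  have "K ((fst x \<noteq> fst g, plug (snd x) (snd g)) # \<Xi>) = K' ((fst x \<noteq> fst g, plug (snd x) (snd g)) # \<Xi>)"
    by (rule Cons.prems) (use Cons.prems(2) assms(3) alt_map_plug has_parity_plug in auto)
  moreover have "bderiv (\<lambda>W. K (x # W)) g \<Xi> = bderiv (\<lambda>W. K' (x # W)) g \<Xi>"
    by (rule Cons.IH, rule Cons.prems) (use Cons.prems(2) in auto)
  ultimately show ?case by simp
qed simp

text \<open>When \<open>K\<close> is graded symmetric, the changed letter can be brought to the
  front, and the derivation runs over the same terms as the one-letter splittings in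
  \<open>act_act\<close>. In the sign, \<open>g\<close> passes every letter except the changed one:
  those behind it on the way in, those before it on the way to the front.\<close>

lemma bderiv_pull:
  assumes "\<And>u x y v. alt_word (u @ x # y # v) \<Longrightarrow> K (u @ x # y # v) = signed (fst x \<and> fst y) (K (u @ y # x # v))"
    and "alt_word \<Xi>" "alt_word [g]"
  shows "bderiv K g \<Xi> = signed (fst g \<and> wodd fst \<Xi>)
     (pull fst (\<lambda>x W. signed (fst g \<and> fst x) (K ((fst x \<noteq> fst g, plug (snd x) (snd g)) # W))) \<Xi>)"
  using assms(1,2)
proof (induction \<Xi> arbitrary: K)
  case (Cons x \<Xi>)
  have 1: "bderiv (\<lambda>W. K (x # W)) g \<Xi> = signed (fst g \<and> wodd fst \<Xi>)
     (pull fst (\<lambda>y W. signed (fst g \<and> fst y) (K (x # (fst y \<noteq> fst g, plug (snd y) (snd g)) # W))) \<Xi>)"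
  proof (rule Cons.IH)
    fix u y z v assume "alt_word (u @ y # z # v)"
    then have "alt_word ((x # u) @ y # z # v)" using Cons.prems(2) by simp
    from Cons.prems(1)[OF this]
    show "K (x # u @ y # z # v) = signed (fst y \<and> fst z) (K (x # u @ z # y # v))"
      unfolding append_Cons .
  qed (use Cons.prems(2) in simp)
  have 2: "pull fst (\<lambda>y W. signed (fst g \<and> fst y) (K (x # (fst y \<noteq> fst g, plug (snd y) (snd g)) # W))) \<Xi>
    = pull fst (\<lambda>y W. signed (fst x \<and> fst g) (signed (fst x \<and> fst y) (signed (fst g \<and> fst y) (K ((fst y \<noteq> fst g, plug (snd y) (snd g)) # x # W))))) \<Xi>"
  proof (rule pull_cong)
    fix y W assume "y \<in> set \<Xi>" "set W \<subseteq> set \<Xi>"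
    then have "alt_word ([] @ x # (fst y \<noteq> fst g, plug (snd y) (snd g)) # W)"
      using Cons.prems(2) assms(3) alt_map_plug has_parity_plug by (auto simp: alt_word_def)
    from Cons.prems(1)[OF this]
    show "signed (fst g \<and> fst y) (K (x # (fst y \<noteq> fst g, plug (snd y) (snd g)) # W)) =
      signed (fst x \<and> fst g) (signed (fst x \<and> fst y) (signed (fst g \<and> fst y) (K ((fst y \<noteq> fst g, plug (snd y) (snd g)) # x # W))))"
      by (simp, intro signed_cong) auto
  qed
  show ?case
    unfolding bderiv.simps 1 2 pull.simps signed_add
    unfolding pull_signed
    unfolding signed_simps wodd.simps
    by (intro arg_cong2[of _ _ _ _ "(+)"] signed_cong) auto
qed simp

text \<open>Replacing \<xi> by \<xi>{h} is a coderivation of the unshuffle coproduct: the changed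
  letter lies in \<open>a\<close> or in \<open>b\<close>, and in the first case \<open>h\<close>,
  coming from the right, passes \<open>b\<close>.\<close>

lemma bderiv_coderivation:
  assumes "alt_word \<Xi>" "alt_word [h]"
  shows "bderiv (\<lambda>W. unshuffle fst K W) h \<Xi>
    = unshuffle fst (\<lambda>a b. signed (fst h \<and> wodd fst b) (bderiv (\<lambda>W. K W b) h a) + bderiv (K a) h b) \<Xi>"
  using assms(1)
proof (induction \<Xi> arbitrary: K)
  case (Cons x \<Xi>)
  let ?x = "(fst x \<noteq> fst h, plug (snd x) (snd h))"
  note IH = Cons.IH[of "\<lambda>a. K (x # a)"] Cons.IH[of "\<lambda>a b. signed (fst x \<and> wodd fst a) (K a (x # b))"]
  have g: "alt_word \<Xi>" using Cons.prems by simp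
  have 1: "signed (fst h \<and> wodd fst \<Xi>) (unshuffle fst (\<lambda>a b. K (?x # a) b) \<Xi>)
     = unshuffle fst (\<lambda>a b. signed (fst h \<and> wodd fst b) (signed (fst h \<and> wodd fst a) (K (?x # a) b))) \<Xi>"
    by (subst unshuffle_signed[symmetric], rule unshuffle_cong, simp, rule signed_cong) auto
  have 2: "signed (fst h \<and> wodd fst \<Xi>) (unshuffle fst (\<lambda>a b. signed (fst ?x \<and> wodd fst a) (K a (?x # b))) \<Xi>)
     = unshuffle fst (\<lambda>a b. signed (fst x \<and> wodd fst a) (signed (fst h \<and> wodd fst b) (K a (?x # b)))) \<Xi>"
    by (subst unshuffle_signed[symmetric], rule unshuffle_cong, simp, rule signed_cong) auto
  have 3: "unshuffle fst (\<lambda>a b. signed (fst h \<and> wodd fst b) (bderiv (\<lambda>W. signed (fst x \<and> wodd fst W) (K W (x # b))) h a)) \<Xi>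
     = unshuffle fst (\<lambda>a b. signed (fst x \<and> wodd fst a) (signed (fst h \<and> (fst x \<noteq> wodd fst b)) (bderiv (\<lambda>W. K W (x # b)) h a))) \<Xi>"
  proof (rule unshuffle_cong)
    fix a b :: "(bool \<times> ('b list \<Rightarrow> 'b)) list"
    assume "set a \<union> set b = set \<Xi>"
    then have a: "alt_word a" using g alt_word_Un by blast
    have "bderiv (\<lambda>W. signed (fst x \<and> wodd fst W) (K W (x # b))) h a = bderiv (\<lambda>W. signed (fst x \<and> (wodd fst a \<noteq> fst h)) (K W (x # b))) h a"
      by (rule bderiv_cong[OF _ a assms(2)]) simp
    then show "signed (fst h \<and> wodd fst b) (bderiv (\<lambda>W. signed (fst x \<and> wodd fst W) (K W (x # b))) h a)
      = signed (fst x \<and> wodd fst a) (signed (fst h \<and> (fst x \<noteq> wodd fst b)) (bderiv (\<lambda>W. K W (x # b)) h a))"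
      by (simp add: bderiv_signed, intro signed_cong) auto
  qed
  show ?case
    unfolding bderiv.simps unshuffle.simps signed_add bderiv_add IH[OF g] unshuffle_add 1 2 3 bderiv_signed wodd.simps
    by (simp only: ac_simps)
qed simp

text \<open>In \<open>f{\<xi>, \<Xi>}(g(a), b)\<close> the value \<open>g(a)\<close> is absorbed either by \<open>\<xi>\<close> or later; the first case gives
  the term with \<open>\<xi>{g}\<close>, the second one is the induction hypothesis for \<open>f(\<xi>(c), \<dots>)\<close>.\<close>

theorem plug_brace:
  assumes "alt_map f" "alt_word \<Xi>" "alt_word [g]"
  shows "plug (brace f \<Xi>) (snd g) X = brace f (\<Xi> @ [g]) X + bderiv (\<lambda>W. brace f W X) g \<Xi>"
  using assms(1,2)
proof (induction \<Xi> arbitrary: f X)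
  case Nil
  then show ?case by (simp add: plug_def brace_Nil)
next
  case (Cons x \<Xi>)
  let ?S = "\<not> fst x \<and> wodd fst \<Xi>"
  let ?f = "\<lambda>v ys. f (v # ys)"
  have gf: "alt_map (?f v)" for v
    using Cons.prems(1) by (rule alt_map_Cons)
  have gB: "alt_map (brace (?f v) \<Xi>)" for v
    using gf Cons.prems(2) by (intro alt_map_brace) (auto simp: alt_word_def)
  have lT: "lin_map (\<lambda>v. brace (?f v) \<Xi> e)" for e
    by (rule lin_map_brace, rule alt_mapD_lin0[OF Cons.prems(1)])
  have px: "has_parity (fst x) (snd x)" and pg: "has_parity (fst g) (snd g)"
    using Cons.prems(2) assms(3) by auto
  \<comment> \<open>The value \<open>snd g a\<close> is the first argument, so the unshuffle puts it
    either at the front of the block of \<open>x\<close> or into the rest, past the block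
    \<open>c\<close>.\<close>
  have "plug (brace f (x # \<Xi>)) (snd g) X
      = unshuffle (\<lambda>_. True) (\<lambda>a b. unshuffle (\<lambda>_. True) (\<lambda>c e. signed ?S (brace (?f (snd x (snd g a # c))) \<Xi> e)) b) X
      + unshuffle (\<lambda>_. True) (\<lambda>a b. unshuffle (\<lambda>_. True) (\<lambda>c e. signed (odd (length c)) (signed ?S (brace (?f (snd x c)) \<Xi> (snd g a # e)))) b) X"
    by (simp add: plug_def unshuffle_add)
  also have "unshuffle (\<lambda>_. True) (\<lambda>a b. unshuffle (\<lambda>_. True) (\<lambda>c e. signed ?S (brace (?f (snd x (snd g a # c))) \<Xi> e)) b) X
     = unshuffle (\<lambda>_. True) (\<lambda>h e. signed ?S (brace (?f (plug (snd x) (snd g) h)) \<Xi> e)) X"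
    unfolding unshuffle_assoc[symmetric] plug_def
    apply (rule unshuffle_cong)
    apply (subst unshuffle_signed)
    apply (subst unshuffle_hom[of "\<lambda>v. brace (?f v) \<Xi> _"])
     apply (rule lin_map_add[OF lT])
    apply (rule refl)
    done
  also have "\<dots> = signed (fst g \<and> wodd fst \<Xi>) (brace f ((fst x \<noteq> fst g, plug (snd x) (snd g)) # \<Xi>) X)"
    by (simp, subst unshuffle_signed[symmetric], rule unshuffle_cong, simp, rule signed_cong) auto
  \<comment> \<open>The block \<open>c\<close> of \<open>x\<close> is now split off before the block
    of \<open>g\<close>; what remains is a \<open>plug\<close> into a brace with the shorter word,
    as the induction hypothesis requires.\<close>
  also have "unshuffle (\<lambda>_. True) (\<lambda>a b. unshuffle (\<lambda>_. True) (\<lambda>c e. signed (odd (length c)) (signed ?S (brace (?f (snd x c)) \<Xi> (snd g a # e)))) b) X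
     = unshuffle (\<lambda>_. True) (\<lambda>c b. signed (\<not> fst x \<and> (wodd fst \<Xi> \<noteq> fst g)) (plug (brace (?f (snd x c)) \<Xi>) (snd g) b)) X"
  proof (subst unshuffle_swap, rule unshuffle_cong)
    fix c b :: "'b list"
    show "unshuffle (\<lambda>_. True) (\<lambda>a e. signed (wodd (\<lambda>_. True) c \<and> wodd (\<lambda>_. True) a)
             (signed (odd (length c)) (signed ?S (brace (?f (snd x c)) \<Xi> (snd g a # e))))) b
      = signed (\<not> fst x \<and> (wodd fst \<Xi> \<noteq> fst g)) (plug (brace (?f (snd x c)) \<Xi>) (snd g) b)"
      unfolding plug_def
    proof (subst unshuffle_signed[symmetric], rule unshuffle_cong)
      fix a e :: "'b list"
      show "signed (wodd (\<lambda>_. True) c \<and> wodd (\<lambda>_. True) a)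
           (signed (odd (length c)) (signed ?S (brace (?f (snd x c)) \<Xi> (snd g a # e))))
         = signed (\<not> fst x \<and> (wodd fst \<Xi> \<noteq> fst g)) (brace (?f (snd x c)) \<Xi> (snd g a # e))"
      proof (cases "odd (length c) = fst x \<or> odd (length a) = fst g")
        case True
        have "brace (?f (snd x c)) \<Xi> (snd g a # e) = 0"
          using True
        proof
          assume "odd (length c) = fst x"
          then show ?thesis using lin_map_0[OF lT] has_parityD[OF px] by simp
        next
          assume "odd (length a) = fst g"
          then show ?thesis using lin_map_0[OF alt_mapD_lin0[OF gB]] has_parityD[OF pg] by simp
        qed
        then show ?thesis by simp
      next
        case False
        then have "odd (length c) = (\<not> fst x)" "odd (length a) = (\<not> fst g)" by auto
        then show ?thesis
          unfolding signed_simps wodd_True by (intro signed_cong) auto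
      qed
    qed
  qed
  also have "\<dots> = unshuffle (\<lambda>_. True) (\<lambda>c b. signed (\<not> fst x \<and> (wodd fst \<Xi> \<noteq> fst g)) (brace (?f (snd x c)) (\<Xi> @ [g]) b)) X
     + unshuffle (\<lambda>_. True) (\<lambda>c b. signed (\<not> fst x \<and> (wodd fst \<Xi> \<noteq> fst g)) (bderiv (\<lambda>W. brace (?f (snd x c)) W b) g \<Xi>)) X"
    using Cons.IH[OF gf] Cons.prems(2) by (simp add: signed_add unshuffle_add)
  also have "unshuffle (\<lambda>_. True) (\<lambda>c b. signed (\<not> fst x \<and> (wodd fst \<Xi> \<noteq> fst g)) (brace (?f (snd x c)) (\<Xi> @ [g]) b)) X
     = brace f (x # \<Xi> @ [g]) X"
    by simp
  also have "unshuffle (\<lambda>_. True) (\<lambda>c b. signed (\<not> fst x \<and> (wodd fst \<Xi> \<noteq> fst g)) (bderiv (\<lambda>W. brace (?f (snd x c)) W b) g \<Xi>)) X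
     = bderiv (\<lambda>W. brace f (x # W) X) g \<Xi>"
    unfolding bderiv_signed[symmetric] bderiv_unshuffle[symmetric]
    by (rule bderiv_cong) (use Cons.prems assms(3) in simp_all)
  finally show ?case
    by (simp only: append_Cons bderiv.simps ac_simps)
qed

text \<open>By linearity of the first slot a derivation inside it can be carried out on the whole
  brace.\<close>

lemma bderiv_slot:
  assumes "alt_map f"
  shows "brace f ((p, \<lambda>Y. bderiv (\<lambda>W. G W Y) h a) # b) X = bderiv (\<lambda>W. brace f ((p, G W) # b) X) h a"
  using brace_slot_0[OF assms, of "[]"] brace_slot_add[OF assms, of "[]"] brace_slot_signed[OF assms, of "[]"]
  by (induction a arbitrary: G) (simp_all del: brace.simps)

text \<open>The last letter of \<open>\<Xi>\<close> is eliminated with the previous theorem on both sides.\<close>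

theorem brace_plug:
  assumes "alt_map f" "alt_map g" "has_parity q g" "alt_word \<Xi>"
  shows "brace (plug f g) \<Xi> X = unshuffle fst (\<lambda>a b. brace f ((q \<noteq> wodd fst a, brace g a) # b) X) \<Xi>"
  using assms(4)
\<comment> \<open>Induction on the length, since the hypothesis is needed not only for
  \<open>\<Psi>\<close> but for all words of the same length that \<open>bderiv\<close> makes of
  it.\<close>
proof (induction "length \<Xi>" arbitrary: \<Xi> X)
  case 0
  then show ?case by (simp add: brace_Nil plug_def)
next
  case (Suc n)
  let ?K = "\<lambda>a b. brace f ((q \<noteq> wodd fst a, brace g a) # b) X"
  obtain \<Psi> h where \<Xi>: "\<Xi> = \<Psi> @ [h]"
    using Suc.hyps(2) by (metis length_Suc_conv_rev)
  have len: "n = length \<Psi>" and gP: "alt_word \<Psi>" and gh: "alt_word [h]"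
    using Suc.hyps(2) Suc.prems \<Xi> by auto
  have gcp: "alt_map (plug f g)" using assms alt_map_plug by blast
  have IH: "brace (plug f g) \<Psi> = (\<lambda>Y. unshuffle fst (\<lambda>a b. brace f ((q \<noteq> wodd fst a, brace g a) # b) Y) \<Psi>)"
    by (rule ext) (rule Suc.hyps(1)[OF len gP])
  have "plug (brace (plug f g) \<Psi>) (snd h) X = unshuffle fst (\<lambda>a b. plug (brace f ((q \<noteq> wodd fst a, brace g a) # b)) (snd h) X) \<Psi>"
    unfolding IH using brace_unshuffle[of fst _ \<Psi> "[h]" X] by (simp add: brace_single del: brace.simps)
  \<comment> \<open>The letter \<open>h\<close> joins \<open>b\<close>, joins \<open>a\<close>, or
    enters a letter of \<open>a\<close> or of \<open>b\<close>. \<open>plug_brace\<close> is used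
    twice: for the outer brace, and for \<open>brace g a\<close> when \<open>h\<close> enters the
    first letter.\<close>
  also have "\<dots> = unshuffle fst (\<lambda>a b. ?K a (b @ [h]) + signed (fst h \<and> wodd fst b) (?K (a @ [h]) b)
      + (signed (fst h \<and> wodd fst b) (bderiv (\<lambda>W. ?K W b) h a) + bderiv (?K a) h b)) \<Psi>"
  proof (rule unshuffle_cong)
    fix a b assume ab: "set a \<union> set b = set \<Psi>"
    have ga: "alt_word a" and gb: "alt_word b" using alt_word_Un[OF ab gP] by auto
    have gg: "alt_map (brace g a)" using assms(2) ga alt_word_imp_alt_map by (intro alt_map_brace)
    have gab: "alt_word ((q \<noteq> wodd fst a, brace g a) # b)"
      using gb gg has_parity_brace[OF assms(3,2) ga] by simp
    have 1: "plug (brace g a) (snd h) = (\<lambda>Y. brace g (a @ [h]) Y + bderiv (\<lambda>W. brace g W Y) h a)"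
      by (rule ext) (rule plug_brace[OF assms(2) ga gh])
    have 2: "bderiv (\<lambda>W. brace f (((q \<noteq> wodd fst a) \<noteq> fst h, brace g W) # b) X) h a = bderiv (\<lambda>W. ?K W b) h a"
      by (rule bderiv_cong[OF _ ga gh], rule arg_cong[where f = "\<lambda>p. brace f ((p, _) # b) X"]) auto
    have 3: "brace f (((q \<noteq> wodd fst a) \<noteq> fst h, brace g (a @ [h])) # b) X = ?K (a @ [h]) b"
      by (rule arg_cong[where f = "\<lambda>p. brace f ((p, _) # b) X"]) auto
    have "plug (brace f ((q \<noteq> wodd fst a, brace g a) # b)) (snd h) X =
      brace f ((q \<noteq> wodd fst a, brace g a) # b @ [h]) X +
      (signed (fst h \<and> wodd fst b) (brace f (((q \<noteq> wodd fst a) \<noteq> fst h, plug (brace g a) (snd h)) # b) X)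
       + bderiv (?K a) h b)"
      unfolding plug_brace[OF assms(1) gab gh] by (simp del: brace.simps)
    also have "brace f (((q \<noteq> wodd fst a) \<noteq> fst h, plug (brace g a) (snd h)) # b) X = ?K (a @ [h]) b + bderiv (\<lambda>W. ?K W b) h a"
      unfolding 1 brace_slot_add[OF assms(1), of "[]", unfolded append_Nil] bderiv_slot[OF assms(1)] 2 3 ..
    finally show "plug (brace f ((q \<noteq> wodd fst a, brace g a) # b)) (snd h) X =
      ?K a (b @ [h]) + signed (fst h \<and> wodd fst b) (?K (a @ [h]) b)
      + (signed (fst h \<and> wodd fst b) (bderiv (\<lambda>W. ?K W b) h a) + bderiv (?K a) h b)"
      by (simp only: signed_add ac_simps)
  qed
  \<comment> \<open>The terms in which \<open>h\<close> joins a part make up the coproduct of the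
    longer word, the other two make up the coderivation.\<close>
  also have "\<dots> = unshuffle fst ?K (\<Psi> @ [h]) + bderiv (\<lambda>W. unshuffle fst ?K W) h \<Psi>"
    unfolding bderiv_coderivation[OF gP gh] unshuffle_append unshuffle_add
    by (simp del: brace.simps add: unshuffle_add conj_commute)
  also have "bderiv (\<lambda>W. unshuffle fst ?K W) h \<Psi> = bderiv (\<lambda>W. brace (plug f g) W X) h \<Psi>"
    by (rule bderiv_cong[OF _ gP gh], rule Suc.hyps(1)[symmetric]) (simp_all add: len)
  finally show ?case
    unfolding \<Xi> plug_brace[OF gcp gP gh] by simp
qed

end

section \<open>Relabelling of words and additivity of braces and insertions\<close>

lemma pull_0 [simp]: "pull d (\<lambda>x w. 0) w = 0"
  by (induction w) simp_all

lemma unshuffle_map: "(\<And>x. d' (h x) = d x) \<Longrightarrow> unshuffle d' F (map h w) = unshuffle d (\<lambda>a b. F (map h a) (map h b)) w"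
proof (induction w arbitrary: F)
  case (Cons x w)
  have "wodd d' (map h a) = wodd d a" for a
    by (induction a) (simp_all add: Cons.prems)
  then show ?case using Cons by simp
qed simp

lemma wodd_map: "(\<And>x. d' (h x) = d x) \<Longrightarrow> wodd d' (map h a) = wodd d a"
  by (induction a) simp_all

lemma brace_diff: "brace (\<lambda>ys. f ys - g ys) \<Xi> X = brace f \<Xi> X - brace g \<Xi> X"
  using brace_add[of "\<lambda>ys. f ys - g ys" g \<Xi> X] by (simp add: eq_diff_eq)

lemma plug_add_left: "plug (\<lambda>Y. F Y + G Y) f X = plug F f X + plug G f X"
  and plug_signed_left: "plug (\<lambda>Y. signed c (F Y)) f X = signed c (plug F f X)"
  and plug_diff_left: "plug (\<lambda>Y. F Y - G Y) f X = plug F f X - plug G f X"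
  and plug_zero_left: "plug (\<lambda>Y. 0) f X = 0"
  by (simp_all add: plug_def unshuffle_add unshuffle_signed unshuffle_diff)

context char0_vector_space
begin

lemma lin_map_diff: "lin_map T \<Longrightarrow> T (x - y) = T x - T y"
  using lin_map_add[of T x "- y"] lin_map_signed[of T True y] by simp

lemma plug_scale_left: "plug (\<lambda>Y. scale c (F Y)) f X = scale c (plug F f X)"
  by (simp add: plug_def unshuffle_hom[of "scale c"] scale_right_distrib)

lemma plug_add_right: "alt_map f \<Longrightarrow> plug f (\<lambda>Y. F Y + G Y) X = plug f F X + plug f G X"
  and plug_signed_right: "alt_map f \<Longrightarrow> plug f (\<lambda>Y. signed c (F Y)) X = signed c (plug f F X)"
  and plug_diff_right: "alt_map f \<Longrightarrow> plug f (\<lambda>Y. F Y - G Y) X = plug f F X - plug f G X"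
  and plug_zero_right: "alt_map f \<Longrightarrow> plug f (\<lambda>Y. 0) X = 0"
  and plug_scale_right: "alt_map f \<Longrightarrow> plug f (\<lambda>Y. scale k (F Y)) X = scale k (plug f F X)"
  by (simp_all add: plug_def lin_map_add[OF alt_mapD_lin0] lin_map_signed[OF alt_mapD_lin0] lin_map_diff[OF alt_mapD_lin0]
      lin_map_scale[OF alt_mapD_lin0] unshuffle_hom[of "scale k"] scale_right_distrib
      lin_map_0[OF alt_mapD_lin0] unshuffle_add unshuffle_signed unshuffle_diff)

lemma brace_slot_diff:
  assumes "alt_map f"
  shows "brace f (u @ (p, \<lambda>a. g a - h a) # v) X = brace f (u @ (p, g) # v) X - brace f (u @ (p, h) # v) X"
  using brace_slot_add[OF assms, of u p "\<lambda>a. g a - h a" h v X] by (simp add: eq_diff_eq)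

section \<open>The action of the Nijenhuis-Richardson algebra\<close>

definition bracket :: "bool \<Rightarrow> ('b list \<Rightarrow> 'b) \<Rightarrow> bool \<Rightarrow> ('b list \<Rightarrow> 'b) \<Rightarrow> 'b list \<Rightarrow> 'b" where
  "bracket p f q g = (\<lambda>X. plug f g X - signed (p \<and> q) (plug g f X))"

text \<open>The coefficient on the word \<open>\<Xi>\<close> of the vector field of \<open>f\<close>
  in the coordinate \<xi>. The constant term of f \<circ> \<phi> cancels against the part of d\<phi>
  coming from id, hence 0 on the empty word; the second summand is the linear term -
  \<xi>{f}.\<close>

definition act :: "'k \<Rightarrow> bool \<Rightarrow> ('b list \<Rightarrow> 'b) \<Rightarrow> (bool \<times> ('b list \<Rightarrow> 'b)) list \<Rightarrow> 'b list \<Rightarrow> 'b" where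
  "act lam p f \<Xi> = (\<lambda>X. (if \<Xi> = [] then 0 else scale (lam ^ (length \<Xi> - 1)) (brace f \<Xi> X))
     - (if length \<Xi> = 1 then signed (p \<and> fst (hd \<Xi>)) (plug (snd (hd \<Xi>)) f X) else 0))"

text \<open>The full sum of f{g{a}, b} is (f{g}){\<Xi>} by \<open>brace_plug\<close>. Compared with
  it, \<open>act lam q g\<close> lacks the summand \<open>a = []\<close> and has an extra linear
  term; the latter produces the derivation of \<open>plug_brace\<close>, and the last letter of the
  outer word, when alone, contributes the linear term of \<open>f\<close>.\<close>

lemma act_act:
  assumes "alt_map f" "alt_map g" "has_parity q g" "alt_word \<Xi>" "\<Xi> \<noteq> []"
  shows "unshuffle fst (\<lambda>a b. act lam p f ((q \<noteq> wodd fst a, act lam q g a) # b) X) \<Xi>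
    = scale (lam ^ (length \<Xi> - 1)) (brace (plug f g) \<Xi> X - signed (q \<and> wodd fst \<Xi>) (plug (brace f \<Xi>) g X)
        - signed (p \<and> (q \<noteq> wodd fst \<Xi>)) (plug (brace g \<Xi>) f X))
     + (if length \<Xi> = 1 then signed ((p \<and> (q \<noteq> wodd fst \<Xi>)) \<noteq> (q \<and> wodd fst \<Xi>)) (plug (plug (snd (hd \<Xi>)) g) f X) else 0)"
proof -
  let ?L = "lam ^ (length \<Xi> - 1)"
  let ?K = "\<lambda>a b. brace f ((q \<noteq> wodd fst a, brace g a) # b) X"
  let ?E = "\<lambda>x b. signed (q \<and> fst x) (brace f ((fst x \<noteq> q, plug (snd x) g) # b) X)"
  have gg: "alt_word [(q, g)]" using assms by simp
  \<comment> \<open>The outer word has one letter more than \<open>b\<close>, so the outer power of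
    \<open>lam\<close> is \<open>length b\<close>; with the inner \<open>length a - 1\<close> it
    gives \<open>?L\<close> whenever \<open>a\<close> is nonempty.\<close>
  have s: "scale (lam ^ length b) (brace f ((q \<noteq> wodd fst a, act lam q g a) # b) X) =
     scale ?L (?K a b - (if a = [] then brace f ((q, g) # b) X else 0) - (if length a = 1 then ?E (hd a) b else 0))"
    if len: "length a + length b = length \<Xi>" for a b
  proof -
    have 1: "brace f ((q \<noteq> wodd fst a, act lam q g a) # b) X
      = brace f ((q \<noteq> wodd fst a, \<lambda>Y. if a = [] then 0 else scale (lam ^ (length a - 1)) (brace g a Y)) # b) X
       - brace f ((q \<noteq> wodd fst a, \<lambda>Y. if length a = 1 then signed (q \<and> fst (hd a)) (plug (snd (hd a)) g Y) else 0) # b) X"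
      unfolding act_def by (rule brace_slot_diff[OF assms(1), of "[]", unfolded append_Nil])
    show ?thesis
    proof (cases a)
      case Nil
      then show ?thesis
        unfolding 1 by (simp add: brace_Nil)
    next
      case (Cons x a')
      have e: "lam ^ length b * lam ^ (length a - 1) = ?L"
        using len[symmetric] Cons by (simp add: power_add[symmetric] add.commute)
      have 2: "brace f ((q \<noteq> wodd fst a, \<lambda>Y. if a = [] then 0 else scale (lam ^ (length a - 1)) (brace g a Y)) # b) X
         = scale (lam ^ (length a - 1)) (?K a b)"
        using Cons brace_slot_scale[OF assms(1), of "[]" _ _ "brace g a" b X] by (simp del: brace.simps)
      show ?thesis
      proof (cases a')
        case Nil
        have "brace f ((q \<noteq> wodd fst a, \<lambda>Y. if length a = 1 then signed (q \<and> fst (hd a)) (plug (snd (hd a)) g Y) else 0) # b) X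
          = ?E x b"
          using Nil Cons brace_slot_signed[OF assms(1), of "[]"]
          by (auto simp: simp del: brace.simps intro!: arg_cong[where f = "\<lambda>p. signed _ (brace f ((p, _) # b) X)"])
        then show ?thesis
          unfolding 1 2 using e Nil Cons by (simp add: scale_right_diff_distrib del: brace.simps)
      next
        case (Cons x' a'')
        then show ?thesis
          unfolding 1 2 using e \<open>a = x # a'\<close> brace_slot_0[OF assms(1), of "[]"] by (simp del: brace.simps)
      qed
    qed
  qed
  have "unshuffle fst (\<lambda>a b. act lam p f ((q \<noteq> wodd fst a, act lam q g a) # b) X) \<Xi>
    = unshuffle fst (\<lambda>a b. scale ?L (?K a b - (if a = [] then brace f ((q, g) # b) X else 0) - (if length a = 1 then ?E (hd a) b else 0))
       - (if b = [] then signed (p \<and> (q \<noteq> wodd fst a)) (plug (act lam q g a) f X) else 0)) \<Xi>"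
  proof (rule unshuffle_cong)
    fix a b :: "(bool \<times> ('b list \<Rightarrow> 'b)) list"
    assume "length a + length b = length \<Xi>"
    from s[OF this] show "act lam p f ((q \<noteq> wodd fst a, act lam q g a) # b) X =
      scale ?L (?K a b - (if a = [] then brace f ((q, g) # b) X else 0) - (if length a = 1 then ?E (hd a) b else 0))
       - (if b = [] then signed (p \<and> (q \<noteq> wodd fst a)) (plug (act lam q g a) f X) else 0)"
      unfolding act_def[of lam p f] by (simp del: brace.simps)
  qed
  also have "\<dots> = scale ?L (unshuffle fst ?K \<Xi> - brace f ((q, g) # \<Xi>) X - pull fst ?E \<Xi>)
     - signed (p \<and> (q \<noteq> wodd fst \<Xi>)) (plug (act lam q g \<Xi>) f X)"
    unfolding unshuffle_diff unshuffle_nil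
    by (subst unshuffle_hom[of "scale ?L", symmetric], simp add: scale_right_distrib)
      (simp only: unshuffle_diff unshuffle_nil pull_unshuffle[of fst ?E])
  also have "unshuffle fst ?K \<Xi> = brace (plug f g) \<Xi> X"
    by (rule brace_plug[symmetric, OF assms(1-4)])
  \<comment> \<open>The terms f{x{g}, ...} are the derivation part of f{\<Xi>}{g}. The remaining
    part f{\<Xi>, g}, with \<open>g\<close> moved to the front, cancels the correction for the
    missing \<open>a = []\<close>.\<close>
  also have "pull fst ?E \<Xi> = signed (q \<and> wodd fst \<Xi>) (bderiv (\<lambda>W. brace f W X) (q, g) \<Xi>)"
    by (subst bderiv_pull[OF _ assms(4) gg], rule brace_swap[OF assms(1)], assumption, simp del: brace.simps)
  also have "bderiv (\<lambda>W. brace f W X) (q, g) \<Xi> = plug (brace f \<Xi>) g X - brace f (\<Xi> @ [(q, g)]) X"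
    using plug_brace[OF assms(1,4) gg, of X] by simp
  also have "brace f (\<Xi> @ [(q, g)]) X = signed (q \<and> wodd fst \<Xi>) (brace f ((q, g) # \<Xi>) X)"
    using brace_front[OF assms(1), of \<Xi> "(q, g)" "[]" X] assms(4) gg by (simp del: brace.simps)
  also have "plug (act lam q g \<Xi>) f X = scale ?L (plug (brace g \<Xi>) f X)
     - (if length \<Xi> = 1 then signed (q \<and> fst (hd \<Xi>)) (plug (plug (snd (hd \<Xi>)) g) f X) else 0)"
    unfolding act_def plug_diff_left
    using assms(5) by (simp add: plug_scale_left plug_signed_left plug_zero_left)
  also have "fst (hd \<Xi>) = wodd fst \<Xi>" if "length \<Xi> = 1"
    using that by (cases \<Xi>) auto
  ultimately show ?thesis
    by (cases "length \<Xi> = 1") (simp_all add: signed_diff scale_right_diff_distrib scale_signed del: brace.simps)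
qed

text \<open>The associator of \<open>plug\<close> is the two-letter brace f{g, h}, which is graded
  symmetric in its letters.\<close>

lemma plug_pre_Lie:
  assumes "alt_map f" "alt_map g" "has_parity q g" "alt_map h" "has_parity r h"
  shows "plug (plug f g) h X - plug f (plug g h) X = signed (q \<and> r) (plug (plug f h) g X - plug f (plug h g) X)"
proof -
  have 1: "plug (plug f g) h X = brace f [(q, g), (r, h)] X + plug f (plug g h) X"
    if "alt_map g" "has_parity q g" "alt_map h" "has_parity r h" for g q h r
    using plug_brace[OF assms(1), of "[(q, g)]" "(r, h)" X] that
    by (simp add: brace_single del: brace.simps)
  show ?thesis
    unfolding 1[OF assms(2-5)] 1[OF assms(4,5,2,3)]
    using brace_swap0[OF assms(1), of "(q, g)" "(r, h)" "[]" X] assms by (simp del: brace.simps)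
qed

text \<open>In the commutator of two instances of \<open>act_act\<close> the terms f{\<Xi>}{g} and
  g{\<Xi>}{f} cancel, which leaves the braces of f{g} and g{f}. A one-letter word also contributes
  x{f}{g} and x{g}{f}; the pre-Lie identity with root \<open>snd x\<close> turns them into the
  linear term for the bracket.\<close>

theorem act_bracket:
  assumes "alt_map f" "has_parity p f" "alt_map g" "has_parity q g" "alt_word \<Xi>"
  shows "act lam (p \<noteq> q) (bracket p f q g) \<Xi> X
    = unshuffle fst (\<lambda>a b. act lam p f ((q \<noteq> wodd fst a, act lam q g a) # b) X) \<Xi>
     - signed (p \<and> q) (unshuffle fst (\<lambda>a b. act lam q g ((p \<noteq> wodd fst a, act lam p f a) # b) X) \<Xi>)"
proof (cases "\<Xi> = []")
  case True
  have "plug f (\<lambda>X. 0) X = 0" "plug g (\<lambda>X. 0) X = 0" "plug (\<lambda>X. 0) f X = 0" "plug (\<lambda>X. 0) g X = 0"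
    using assms by (simp_all add: plug_zero_right plug_zero_left)
  then show ?thesis
    using True by (simp add: act_def brace_single del: brace.simps)
next
  case False
  have 1: "brace (bracket p f q g) \<Xi> X = brace (plug f g) \<Xi> X - signed (p \<and> q) (brace (plug g f) \<Xi> X)"
    unfolding bracket_def brace_diff brace_signed ..
  show ?thesis
  proof (cases "length \<Xi> = 1")
    case True
    then obtain x where \<Xi>: "\<Xi> = [x]" by (auto simp: length_Suc_conv)
    have x: "alt_map (snd x)" using assms(5) \<Xi> by simp
    have 2: "plug (snd x) (bracket p f q g) X = plug (snd x) (plug f g) X - signed (p \<and> q) (plug (snd x) (plug g f) X)"
      unfolding bracket_def using x by (simp add: plug_diff_right plug_signed_right)
    have 3: "plug (plug (snd x) f) g X = plug (snd x) (plug f g) X + signed (p \<and> q) (plug (plug (snd x) g) f X - plug (snd x) (plug g f) X)"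
      using plug_pre_Lie[OF x assms(1-4), of X] by (simp add: algebra_simps)
    show ?thesis
      unfolding act_act[OF assms(1,3,4,5) False] act_act[OF assms(3,1,2,5) False] act_def[of lam "p \<noteq> q"] 1
      unfolding \<Xi> using 2 3
      by (cases p; cases q; cases "fst x") (simp_all add: brace_single del: brace.simps)
  next
    case f: False
    show ?thesis
      unfolding act_act[OF assms(1,3,4,5) False] act_act[OF assms(3,1,2,5) False] act_def[of lam "p \<noteq> q"] 1
      using f False
      by (cases p; cases q; cases "wodd fst \<Xi>") (simp_all add: scale_right_diff_distrib scale_right_distrib del: brace.simps)
  qed
qed

text \<open>The commutator of a graded pre-Lie product is a graded Lie bracket; the pre-Lie identity
  is used once with each of the three maps as root.\<close>

lemma NR_Jacobi:
  assumes "alt_map f" "has_parity p f" "alt_map g" "has_parity q g" "alt_map h" "has_parity r h"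
  shows "bracket (p \<noteq> q) (bracket p f q g) r h X - signed (q \<and> r) (bracket (p \<noteq> r) (bracket p f r h) q g X)
     + signed (p \<and> (q \<noteq> r)) (bracket (q \<noteq> r) (bracket q g r h) p f X) = 0"
proof -
  have "plug (plug f g) h X = plug f (plug g h) X + signed (q \<and> r) (plug (plug f h) g X - plug f (plug h g) X)"
    "plug (plug g f) h X = plug g (plug f h) X + signed (p \<and> r) (plug (plug g h) f X - plug g (plug h f) X)"
    "plug (plug h f) g X = plug h (plug f g) X + signed (p \<and> q) (plug (plug h g) f X - plug h (plug g f) X)"
    using plug_pre_Lie[of f g q h r X] plug_pre_Lie[of g f p h r X] plug_pre_Lie[of h f p g q X] assms
    by (simp_all add: algebra_simps)
  then show ?thesis
    unfolding bracket_def using assms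
    by (cases p; cases q; cases r)
      (simp_all add: plug_diff_left plug_diff_right plug_add_left plug_add_right)
qed

lemma alt_map_diff: "alt_map f \<Longrightarrow> alt_map g \<Longrightarrow> alt_map (\<lambda>X. f X - g X)"
  using alt_map_add[of f "\<lambda>X. signed True (g X)"] alt_map_signed[of g True] by simp

lemma alt_map_scale: "alt_map f \<Longrightarrow> alt_map (\<lambda>X. scale c (f X))"
  by (rule alt_map_comp[OF lin_map_scaleI])

end

definition A_letter :: "bool \<times> 'f \<times> 'x \<Rightarrow> bool \<times> 'x" where
  "A_letter x = (fst x, snd (snd x))"

lemma A_letter_simps [simp]: "fst (A_letter x) = fst x" "snd (A_letter x) = snd (snd x)" "A_letter (d, f, z) = (d, z)"
  by (simp_all add: A_letter_def)

lemma wodd_A_letter [simp]: "wodd fst (map A_letter w) = wodd fst w"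
  by (rule wodd_map) simp

lemma pull_hom:
  assumes "\<And>x y. h (x + y) = h x + h y"
  shows "h (pull d G w) = pull d (\<lambda>x b. h (G x b)) w"
  by (induction w arbitrary: G)
    (simp_all add: assms additive_signed[of h, OF assms] additive_zero[of h, OF assms])

lemma unshuffle_interchange:
  "unshuffle d (\<lambda>a b. unshuffle d' (\<lambda>a' b'. F a b a' b') v) w = unshuffle d' (\<lambda>a' b'. unshuffle d (\<lambda>a b. F a b a' b') w) v"
  by (induction w arbitrary: F) (simp_all add: unshuffle_add unshuffle_signed[symmetric])

text \<open>Iterated pulls are written as unshuffles with one-letter first parts, so that
  \<open>unshuffle_rearrange\<close> applies to them.\<close>

lemma pull_pull:
  "pull d (\<lambda>y b'. pull d (\<lambda>x a'. H x a' y b') a) b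
    = unshuffle d (\<lambda>x a'. unshuffle d (\<lambda>y b'. if length x = 1 \<and> length y = 1 then H (hd x) a' (hd y) b' else 0) b) a"
proof -
  have "unshuffle d (\<lambda>x a'. unshuffle d (\<lambda>y b'. if length x = 1 \<and> length y = 1 then H (hd x) a' (hd y) b' else 0) b) a
    = unshuffle d (\<lambda>y b'. if length y = 1 then unshuffle d (\<lambda>x a'. if length x = 1 then H (hd x) a' (hd y) b' else 0) a else 0) b"
  proof (subst unshuffle_interchange, rule unshuffle_cong)
    fix y b'
    show "unshuffle d (\<lambda>x a'. if length x = 1 \<and> length y = 1 then H (hd x) a' (hd y) b' else 0) a
      = (if length y = 1 then unshuffle d (\<lambda>x a'. if length x = 1 then H (hd x) a' (hd y) b' else 0) a else 0)"
      by (cases "length y = 1") simp_all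
  qed
  then show ?thesis
    by (simp only: pull_unshuffle[of d "\<lambda>x a'. H x a' _ _"] pull_unshuffle[of d "\<lambda>y b'. pull d (\<lambda>x a'. H x a' y b') a" b])
qed

section \<open>The operations and their Jacobi identity\<close>

text \<open>A letter \<open>(d, f, \<xi>)\<close> stands for \<open>sf + \<xi>\<close> of degree of parity \<open>d\<close>; because of the shift, \<open>f\<close> has
  parity \<open>\<not> d\<close>.\<close>

type_synonym 'v letter = "bool \<times> ('v list \<Rightarrow> 'v) \<times> ('v list \<Rightarrow> 'v)"

locale weighted_NR_structure = char0_vector_space scale
  for scale :: "'k::field_char_0 \<Rightarrow> 'b::ab_group_add \<Rightarrow> 'b" +
  fixes lam :: 'k
begin

abbreviation M_part where "M_part x \<equiv> fst (snd x)"

text \<open>The shift is built in: \<open>\<not> fst x\<close> is the parity of the map f underlying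
  sf, and the leading sign is the (-1)^|f| of the binary operation.\<close>

definition op_M :: "'b letter list \<Rightarrow> 'b list \<Rightarrow> 'b" where
  "op_M w X = (case w of [x, y] \<Rightarrow> signed (\<not> fst x) (bracket (\<not> fst x) (M_part x) (\<not> fst y) (M_part y) X) | _ \<Rightarrow> 0)"

text \<open>Every letter may act by its M-part on the A-parts of the others, and pulling it to the
  front supplies the Koszul sign. Thus mixed letters sf + \<xi> and all positions of the acting
  letter are treated at once.\<close>

definition op_A :: "'b letter list \<Rightarrow> 'b list \<Rightarrow> 'b" where
  "op_A w X = pull fst (\<lambda>x w'. act lam (\<not> fst x) (M_part x) (map A_letter w') X) w"

definition op :: "'b letter list \<Rightarrow> ('b list \<Rightarrow> 'b) \<times> ('b list \<Rightarrow> 'b)" where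
  "op w = (op_M w, op_A w)"

definition proper :: "'b letter \<Rightarrow> bool" where
  "proper x \<longleftrightarrow> alt_map (M_part x) \<and> has_parity (\<not> fst x) (M_part x) \<and> alt_map (snd (snd x)) \<and> has_parity (fst x) (snd (snd x))"

lemma alt_word_A_letter: "\<forall>x\<in>set w. proper x \<Longrightarrow> alt_word (map A_letter w)"
  by (auto simp: alt_word_def proper_def)

lemma act_signed: "alt_word \<Xi> \<Longrightarrow> act lam p (\<lambda>X. signed c (f X)) \<Xi> X = signed c (act lam p f \<Xi> X)"
  unfolding act_def brace_signed
  by (cases \<Xi>) (auto simp: signed_diff scale_signed plug_signed_right signed_simps(4)[abs_def] ac_simps intro: signed_cong)

lemma act_f_0: "alt_word \<Xi> \<Longrightarrow> act lam p (\<lambda>X. 0) \<Xi> X = 0"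
  unfolding act_def by (cases \<Xi>) (auto simp: plug_zero_right)

lemma act_front_add: "alt_map f \<Longrightarrow> act lam p f ((q, \<lambda>Y. F Y + G Y) # b) X
   = act lam p f ((q, F) # b) X + act lam p f ((q, G) # b) X"
  unfolding act_def using brace_slot_add[of f "[]"]
  by (simp add: plug_add_left signed_add scale_right_distrib del: brace.simps)

lemma act_front_signed: "alt_map f \<Longrightarrow> act lam p f ((q, \<lambda>Y. signed c (F Y)) # b) X
   = signed c (act lam p f ((q, F) # b) X)"
  unfolding act_def using brace_slot_signed[of f "[]"]
  by (auto simp add: plug_signed_left signed_diff scale_signed simp del: brace.simps intro: signed_cong)

lemma act_front_pull:
  assumes "alt_map f"
  shows "act lam p f ((q, \<lambda>Y. pull d (\<lambda>x a. G x a Y) w) # b) X = pull d (\<lambda>x a. act lam p f ((q, G x a) # b) X) w"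
proof (induction w arbitrary: G)
  case Nil
  then show ?case using act_front_add[OF assms, of p q "\<lambda>Y. 0" "\<lambda>Y. 0" b X] by simp
next
  case (Cons x w)
  show ?case
    by (simp add: act_front_add[OF assms] act_front_signed[OF assms]
      Cons[of "\<lambda>y w' Y. signed (d x \<and> d y) (G y (x # w') Y)"])
qed

text \<open>Four complementary subwords, grouped as (x a')(y b') or as (x y)(a' b'); the sign is
  that of \<open>y\<close> passing \<open>a'\<close>. With one-letter \<open>x\<close> and
  \<open>y\<close> this collects the two acting letters of a composite operation in one
  subword.\<close>

lemma unshuffle_rearrange:
  "unshuffle d (\<lambda>a b. unshuffle d (\<lambda>x a'. unshuffle d (\<lambda>y b'. H x a' y b') b) a) w
   = unshuffle d (\<lambda>c r. unshuffle d (\<lambda>x y. unshuffle d (\<lambda>a' b'. signed (wodd d y \<and> wodd d a') (H x a' y b')) r) c) w"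
proof -
  have "unshuffle d (\<lambda>a b. unshuffle d (\<lambda>x a'. unshuffle d (\<lambda>y b'. H x a' y b') b) a) w
    = unshuffle d (\<lambda>x r. unshuffle d (\<lambda>a' b. unshuffle d (\<lambda>y b'. H x a' y b') b) r) w"
    by (rule unshuffle_assoc)
  also have "\<dots> = unshuffle d (\<lambda>x r. unshuffle d (\<lambda>y r'. unshuffle d (\<lambda>a' b'. signed (wodd d y \<and> wodd d a') (H x a' y b')) r') r) w"
    by (rule unshuffle_cong, subst unshuffle_swap) (simp only: conj_commute)
  finally show ?thesis
    by (simp only: unshuffle_assoc)
qed

text \<open>As \<open>op_M\<close> lives on two letters, only words of three letters contribute; for
  them it is \<open>NR_Jacobi\<close> up to the signs of the shift.\<close>

lemma M_Jacobi:
  assumes "\<forall>x\<in>set w. proper x"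
  shows "unshuffle fst (\<lambda>a b. op_M (((\<not> wodd fst a), op a) # b) X) w = 0"
proof (cases "length w = 3")
  case False
  show ?thesis
  proof (rule unshuffle_zero)
    fix a b :: "'b letter list"
    assume *: "length a + length b = length w" "set a \<union> set b = set w"
    show "op_M ((\<not> wodd fst a, op a) # b) X = 0"
    proof (cases "length b = 1")
      case True
      then obtain y where b: "b = [y]" by (auto simp: length_Suc_conv)
      then have gy: "alt_map (M_part y)" using * assms by (auto simp: proper_def)
      have "length a \<noteq> 2" using * True False by simp
      then have "op_M a = (\<lambda>X. 0)"
        by (auto simp: op_M_def fun_eq_iff split: list.splits)
      then show ?thesis
        using gy by (simp add: op_M_def[of "_ # _"] b op_def bracket_def plug_zero_left plug_zero_right)
    qed (auto simp: op_M_def split: list.splits)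
  qed
next
  case True
  then obtain x y z where w: "w = [x, y, z]"
    by (auto simp: numeral_3_eq_3 length_Suc_conv)
  have g: "proper x" "proper y" "proper z" using assms w by auto
  have 0: "op_M [] = (\<lambda>X. 0)" "op_M [x] = (\<lambda>X. 0)" for x
    by (auto simp: op_M_def)
  have 1: "bracket p (\<lambda>X. signed c (f X)) q g X = signed c (bracket p f q g X)" if "alt_map g" for p f q g c X
    using that by (simp add: bracket_def plug_signed_left plug_signed_right signed_diff) (rule signed_cong, auto)
  have 2: "op_M [x, y] = (\<lambda>X. signed (\<not> fst x) (bracket (\<not> fst x) (M_part x) (\<not> fst y) (M_part y) X))" for x y
    by (simp add: op_M_def fun_eq_iff)
  have J: "bracket ((\<not> fst x) \<noteq> (\<not> fst y)) (bracket (\<not> fst x) (M_part x) (\<not> fst y) (M_part y)) (\<not> fst z) (M_part z) X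
    = signed (\<not> fst y \<and> \<not> fst z) (bracket ((\<not> fst x) \<noteq> (\<not> fst z)) (bracket (\<not> fst x) (M_part x) (\<not> fst z) (M_part z)) (\<not> fst y) (M_part y) X)
    - signed (\<not> fst x \<and> ((\<not> fst y) \<noteq> (\<not> fst z))) (bracket ((\<not> fst y) \<noteq> (\<not> fst z)) (bracket (\<not> fst y) (M_part y) (\<not> fst z) (M_part z)) (\<not> fst x) (M_part x) X)"
    using NR_Jacobi[of "M_part x" "\<not> fst x" "M_part y" "\<not> fst y" "M_part z" "\<not> fst z" X] g
    unfolding proper_def by (simp add: algebra_simps)
  have 3: "op_M (u # v # t # r) X = 0" for u v t r X
    by (simp add: op_M_def)
  have 4: "bracket p (\<lambda>X. 0) q g X = 0" if "alt_map g" for p q g X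
    using that by (simp add: bracket_def plug_zero_left plug_zero_right)
  show ?thesis
    unfolding w using g J
    by (cases "fst x"; cases "fst y"; cases "fst z")
      (simp_all add: 0 2 3 4 op_def proper_def 1 1[of _ _ True, simplified])
qed

text \<open>The inner value enters the outer operation either by its M-part, which acts on the other
  letters, or by its A-part, as a letter on which \<open>y\<close> acts after \<open>x\<close> has
  acted inside. For a fixed pair of acting letters and a fixed rest these two kinds of terms are the
  two sides of \<open>act_bracket\<close>.\<close>

lemma A_Jacobi:
  assumes "\<forall>x\<in>set w. proper x"
  shows "unshuffle fst (\<lambda>a b. op_A (((\<not> wodd fst a), op a) # b) X) w = 0"
proof -
  let ?G = "\<lambda>x a' y b'. signed (\<not> (fst x \<noteq> wodd fst a') \<and> fst y) (act lam (\<not> fst y) (M_part y)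
        ((\<not> (fst x \<noteq> wodd fst a'), act lam (\<not> fst x) (M_part x) (map A_letter a')) # map A_letter b') X)"
  let ?H = "\<lambda>x a' y b'. if length x = 1 \<and> length y = 1 then ?G (hd x) a' (hd y) b' else 0"
  let ?T = "\<lambda>x y r. unshuffle fst (\<lambda>a' b'. signed (fst y \<and> \<not> fst x) (act lam (\<not> fst y) (M_part y)
        (((\<not> fst x) \<noteq> wodd fst a', act lam (\<not> fst x) (M_part x) a') # b') X)) (map A_letter r)"
  have T: "unshuffle fst (\<lambda>a' b'. signed (fst y \<and> wodd fst a') (?G x a' y b')) r = ?T x y r" for x y :: "'b letter" and r :: "'b letter list"
    unfolding unshuffle_map[of fst A_letter fst, OF A_letter_simps(1)]
  proof (rule unshuffle_cong)
    fix a' b' :: "'b letter list"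
    have e: "(\<not> (fst x \<noteq> wodd fst a')) = ((\<not> fst x) \<noteq> wodd fst (map A_letter a'))" by auto
    show "signed (fst y \<and> wodd fst a') (?G x a' y b') = signed (fst y \<and> \<not> fst x) (act lam (\<not> fst y) (M_part y)
        (((\<not> fst x) \<noteq> wodd fst (map A_letter a'), act lam (\<not> fst x) (M_part x) (map A_letter a')) # map A_letter b') X)"
      unfolding e[symmetric] by (cases "fst x"; cases "fst y"; cases "wodd fst a'") simp_all
  qed
  have "unshuffle fst (\<lambda>a b. op_A (((\<not> wodd fst a), op a) # b) X) w
     = unshuffle fst (\<lambda>a b. act lam (wodd fst a) (op_M a) (map A_letter b) X + unshuffle fst (\<lambda>x a'. unshuffle fst (\<lambda>y b'. ?H x a' y b') b) a) w"
  proof (rule unshuffle_cong)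
    fix a b :: "'b letter list"
    assume *: "set a \<union> set b = set w"
    have "op_A ((\<not> wodd fst a, op a) # b) X = act lam (wodd fst a) (op_M a) (map A_letter b) X +
      pull fst (\<lambda>y b'. signed (\<not> wodd fst a \<and> fst y) (act lam (\<not> fst y) (M_part y) ((\<not> wodd fst a, op_A a) # map A_letter b') X)) b"
      unfolding op_A_def[of "_ # _"] by (simp add: op_def)
    also have "pull fst (\<lambda>y b'. signed (\<not> wodd fst a \<and> fst y) (act lam (\<not> fst y) (M_part y) ((\<not> wodd fst a, op_A a) # map A_letter b') X)) b
      = pull fst (\<lambda>y b'. pull fst (\<lambda>x a'. ?G x a' y b') a) b"
    proof (rule pull_cong)
      fix y b' assume "y \<in> set b"
      then have gy: "alt_map (M_part y)" using * assms by (auto simp: proper_def)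
      have "signed (\<not> wodd fst a \<and> fst y) (act lam (\<not> fst y) (M_part y) ((\<not> wodd fst a, op_A a) # map A_letter b') X)
        = pull fst (\<lambda>x a'. signed (\<not> wodd fst a \<and> fst y) (act lam (\<not> fst y) (M_part y)
            ((\<not> wodd fst a, act lam (\<not> fst x) (M_part x) (map A_letter a')) # map A_letter b') X)) a"
        unfolding op_A_def[abs_def] act_front_pull[OF gy] pull_signed ..
      also have "\<dots> = pull fst (\<lambda>x a'. ?G x a' y b') a"
        by (rule pull_cong) simp
      finally show "signed (\<not> wodd fst a \<and> fst y) (act lam (\<not> fst y) (M_part y) ((\<not> wodd fst a, op_A a) # map A_letter b') X)
        = pull fst (\<lambda>x a'. ?G x a' y b') a" .
    qed
    also have "\<dots> = unshuffle fst (\<lambda>x a'. unshuffle fst (\<lambda>y b'. ?H x a' y b') b) a"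
      by (rule pull_pull)
    finally show "op_A ((\<not> wodd fst a, op a) # b) X = act lam (wodd fst a) (op_M a) (map A_letter b) X
       + unshuffle fst (\<lambda>x a'. unshuffle fst (\<lambda>y b'. ?H x a' y b') b) a" .
  qed
  \<comment> \<open>The acting letters are now collected in \<open>c\<close>, where they match the
    two letters whose bracket forms the first summand.\<close>
  also have "\<dots> = unshuffle fst (\<lambda>c r. act lam (wodd fst c) (op_M c) (map A_letter r) X
     + unshuffle fst (\<lambda>x y. unshuffle fst (\<lambda>a' b'. signed (wodd fst y \<and> wodd fst a') (?H x a' y b')) r) c) w"
    unfolding unshuffle_add by (rule arg_cong2[of _ _ _ _ "(+)"], rule refl, rule unshuffle_rearrange)
  also have "\<dots> = 0"
  proof (rule unshuffle_zero)
    fix c r :: "'b letter list"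
    assume *: "set c \<union> set r = set w"
    have gr: "alt_word (map A_letter r)" using * assms by (intro alt_word_A_letter) auto
    show "act lam (wodd fst c) (op_M c) (map A_letter r) X
     + unshuffle fst (\<lambda>x y. unshuffle fst (\<lambda>a' b'. signed (wodd fst y \<and> wodd fst a') (?H x a' y b')) r) c = 0"
    proof (cases "length c = 2")
      case False
      then have "op_M c = (\<lambda>X. 0)"
        by (auto simp: op_M_def fun_eq_iff split: list.splits)
      moreover have "unshuffle fst (\<lambda>x y. unshuffle fst (\<lambda>a' b'. signed (wodd fst y \<and> wodd fst a') (?H x a' y b')) r) c = 0"
        using False by (intro unshuffle_zero) auto
      ultimately show ?thesis by (simp add: act_f_0[OF gr])
    next
      case True
      then obtain x y where c: "c = [x, y]"
        by (auto simp: numeral_2_eq_2 length_Suc_conv)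
      have g: "proper x" "proper y" using c * assms by auto
      let ?p = "\<not> fst x" and ?q = "\<not> fst y" and ?f = "M_part x" and ?g = "M_part y"
      let ?N = "\<lambda>p f q g. unshuffle fst (\<lambda>a b. act lam p f ((q \<noteq> wodd fst a, act lam q g a) # b) X) (map A_letter r)"
      have "op_M c = (\<lambda>X. signed ?p (bracket ?p ?f ?q ?g X))"
        by (simp add: op_M_def c fun_eq_iff)
      moreover have "wodd fst c = (?p \<noteq> ?q)" by (simp add: c)
      ultimately have 1: "act lam (wodd fst c) (op_M c) (map A_letter r) X = signed ?p (?N ?p ?f ?q ?g - signed (?p \<and> ?q) (?N ?q ?g ?p ?f))"
        using g by (simp only: act_signed[OF gr] act_bracket[OF _ _ _ _ gr] proper_def)
      have "unshuffle fst (\<lambda>x y. unshuffle fst (\<lambda>a' b'. signed (wodd fst y \<and> wodd fst a') (?H x a' y b')) r) c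
        = unshuffle fst (\<lambda>a' b'. signed (fst y \<and> wodd fst a') (?G x a' y b')) r
         + signed (fst x \<and> fst y) (unshuffle fst (\<lambda>a' b'. signed (fst x \<and> wodd fst a') (?G y a' x b')) r)"
        unfolding c by (simp add: conj_commute)
      also have "\<dots> = signed (fst y \<and> \<not> fst x) (?N ?q ?g ?p ?f) + signed (fst x \<and> fst y) (signed (fst x \<and> \<not> fst y) (?N ?p ?f ?q ?g))"
        unfolding T unshuffle_signed ..
      finally show ?thesis
        unfolding 1 by (cases "fst x"; cases "fst y") simp_all
    qed
  qed
  finally show ?thesis .
qed

end

section \<open>Shuffle permutations as unshuffles\<close>

text \<open>A permutation is replaced by the word of its values; \<open>e i\<close> tells whether position \<open>i\<close> carries an
  odd element, and only inversions between odd elements count.\<close>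

fun inv_odd :: "(nat \<Rightarrow> bool) \<Rightarrow> nat list \<Rightarrow> bool" where
  "inv_odd e [] = False"
| "inv_odd e (x # L) = (wodd (\<lambda>y. y < x \<and> e x \<and> e y) L \<noteq> inv_odd e L)"

lemma wodd_card: "distinct L \<Longrightarrow> wodd d L = odd (card {i \<in> set L. d i})"
proof (induction L)
  case (Cons x L)
  have "{i \<in> set (x # L). d i} = (if d x then insert x {i \<in> set L. d i} else {i \<in> set L. d i})"
    by auto
  then show ?case using Cons by auto
qed simp

lemma wodd_cong_set: "distinct L \<Longrightarrow> distinct L' \<Longrightarrow> set L = set L' \<Longrightarrow> wodd d L = wodd d L'"
  by (simp add: wodd_card)

lemma wodd_filter: "wodd (\<lambda>y. P y \<and> d y) L = wodd d (filter P L)"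
  by (induction L) auto

lemma wodd_False: "(\<And>y. y \<in> set L \<Longrightarrow> \<not> d y) \<Longrightarrow> \<not> wodd d L"
  by (induction L) auto

lemma inv_odd_sorted: "sorted L \<Longrightarrow> \<not> inv_odd e L"
proof (induction L)
  case (Cons x L)
  have "\<not> wodd (\<lambda>y. y < x \<and> e x \<and> e y) L"
    by (rule wodd_False) (use Cons.prems in fastforce)
  then show ?case using Cons by simp
qed simp

text \<open>The inversions between \<open>a\<close> and a tail depend only on the set of letters of
  the tail, so replacing the tail changes just its own inversions.\<close>

lemma inv_odd_perm_right:
  assumes "distinct L" "distinct c" "set L = set c"
  shows "inv_odd e (a @ L) = ((inv_odd e (a @ c) \<noteq> inv_odd e c) \<noteq> inv_odd e L)"
proof (induction a)
  case (Cons x a)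
  show ?case
    using Cons wodd_cong_set[OF assms] by auto
qed auto

lemma inv_odd_insert:
  "(\<And>z. z \<in> set (a @ b) \<Longrightarrow> x < z) \<Longrightarrow> inv_odd e (a @ x # b) = ((e x \<and> wodd e a) \<noteq> inv_odd e (a @ b))"
proof (induction a)
  case Nil
  then show ?case by (simp add: wodd_False order_less_not_sym)
next
  case (Cons z a)
  then have "x < z" by simp
  then show ?case using Cons by (auto simp: conj_commute)
qed

lemma insort_filter:
  fixes x :: "'a::linorder"
  assumes "sorted S" "x \<notin> set S"
  shows "insort x S = filter (\<lambda>y. y < x) S @ x # filter (\<lambda>y. \<not> y < x) S"
    and "S = filter (\<lambda>y. y < x) S @ filter (\<lambda>y. \<not> y < x) S"
  using assms
proof (induction S)
  case (Cons z S)
  {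
    case 1
    have "filter (\<lambda>y. y < x) S = [] \<and> filter (\<lambda>y. \<not> y < x) S = S" if "\<not> z < x"
      using 1 that by (auto simp: filter_empty_conv filter_id_conv)
    then show ?case using Cons 1 by auto
  next
    case 2
    have "filter (\<lambda>y. y < x) S = [] \<and> filter (\<lambda>y. \<not> y < x) S = S" if "\<not> z < x"
      using 2 that by (auto simp: filter_empty_conv filter_id_conv)
    then show ?case using Cons 2 by auto
  }
qed simp_all

text \<open>Insertion sort: each step moves \<open>x\<close> past the smaller letters to its right,
  and the sign of that move is the contribution of \<open>x\<close> to
  \<open>inv_odd\<close>.\<close>

lemma gsym_sort:
  assumes "gsym d F" "distinct L"
  shows "F (map g (sort L)) = signed (inv_odd (\<lambda>i. d (g i)) L) (F (map g L))"
  using assms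
proof (induction L arbitrary: F)
  case (Cons x L)
  let ?u = "filter (\<lambda>y. y < x) (sort L)" and ?v = "filter (\<lambda>y. \<not> y < x) (sort L)"
  have s: "sort (x # L) = ?u @ x # ?v" "sort L = ?u @ ?v"
    using insort_filter[of "sort L" x] Cons.prems(2) by simp_all
  have "F (map g (sort (x # L))) = F (map g ?u @ g x # map g ?v)"
    unfolding s(1) by simp
  also have "\<dots> = signed (d (g x) \<and> wodd d (map g ?u)) (F (g x # map g ?u @ map g ?v))"
    by (rule gsym_front[OF Cons.prems(1)])
  also have "F (g x # map g ?u @ map g ?v) = F (g x # map g (sort L))"
    using s(2) by (metis map_append)
  also have "\<dots> = signed (inv_odd (\<lambda>i. d (g i)) L) (F (g x # map g L))"
    using Cons.prems by (intro Cons.IH) (simp_all add: gsym_Cons)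
  also have "wodd d (map g ?u) = wodd (\<lambda>i. d (g i)) ?u"
    by (rule wodd_map) (rule refl)
  also have "\<dots> = wodd (\<lambda>y. y < x \<and> d (g y)) L"
    unfolding wodd_filter[symmetric] using Cons.prems(2) by (intro wodd_cong_set) simp_all
  also have "(d (g x) \<and> wodd (\<lambda>y. y < x \<and> d (g y)) L) = wodd (\<lambda>y. y < x \<and> d (g x) \<and> d (g y)) L"
    by (cases "d (g x)") (simp_all add: wodd_False)
  finally show ?case by simp
qed simp

definition perm_word :: "(nat \<Rightarrow> nat) \<Rightarrow> nat \<Rightarrow> nat list" where
  "perm_word \<sigma> n = map \<sigma> [0..<n]"

lemma permute_list_perm_word: "permute_list \<sigma> w = map ((!) w) (perm_word \<sigma> (length w))"
  by (simp add: permute_list_def perm_word_def)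

lemma perm_word_props:
  assumes "\<sigma> permutes {..<n}"
  shows "distinct (perm_word \<sigma> n)" "set (perm_word \<sigma> n) = {..<n}" "length (perm_word \<sigma> n) = n" "sort (perm_word \<sigma> n) = [0..<n]"
proof -
  show 1: "distinct (perm_word \<sigma> n)"
    using permutes_inj_on[OF assms] by (simp add: perm_word_def distinct_map)
  show 2: "set (perm_word \<sigma> n) = {..<n}"
    using permutes_image[OF assms] by (simp add: perm_word_def atLeast0LessThan)
  show "length (perm_word \<sigma> n) = n" by (simp add: perm_word_def)
  show "sort (perm_word \<sigma> n) = [0..<n]"
    by (intro sorted_distinct_set_unique) (simp_all add: 1 2 atLeast0LessThan)
qed

lemma gsym_permute:
  assumes "gsym d F" "\<sigma> permutes {..<length w}"
  shows "F w = signed (inv_odd (\<lambda>i. d (w ! i)) (perm_word \<sigma> (length w))) (F (permute_list \<sigma> w))"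
  using gsym_sort[OF assms(1) perm_word_props(1)[OF assms(2)], of "(!) w"]
  by (simp add: perm_word_props(4)[OF assms(2)] map_nth permute_list_perm_word)

definition sign_unit :: "bool \<Rightarrow> 'k::ring_1" where
  "sign_unit c = (if c then - 1 else 1)"

lemma sign_unit_simps [simp]: "sign_unit False = 1" "sign_unit True = - 1"
  by (simp_all add: sign_unit_def)

lemma sign_unit_mult: "sign_unit a * sign_unit b = sign_unit (a \<noteq> b)"
  by (simp add: sign_unit_def)

lemma sign_unit_power: "sign_unit (odd n) = (- 1) ^ n"
  by (simp add: sign_unit_def)

text \<open>Viewed as a function of the word of values, the sign changes under adjacent exchanges,
  so \<open>gsym_sort\<close> with all letters odd computes it from the value 1 at the
  identity.\<close>

lemma sign_inv_odd:
  assumes "\<sigma> permutes {..<n}"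
  shows "sign \<sigma> = sign_unit (inv_odd (\<lambda>_. True) (perm_word \<sigma> n))"
proof -
  define p where "p w = (\<lambda>i. if i < n then w ! i else (i::nat))" for w :: "nat list"
  \<comment> \<open>Graded symmetry speaks of all words; those that are no permutation of
    \<open>{..<n}\<close> get the value 0.\<close>
  define F where "F w = (if distinct w \<and> set w = {..<n} then sign (p w) else 0)" for w
  have pp: "p w permutes {..<n}" if "distinct w" "set w = {..<n}" for w
  proof -
    have l: "length w = n" using that by (metis card_lessThan distinct_card)
    have "bij_betw (\<lambda>i. w ! i) {..<n} {..<n}"
      using bij_betw_nth[OF that(1)] l that(2) by auto
    then have "bij_betw (p w) {..<n} {..<n}"
      by (rule bij_betw_cong[THEN iffD1, rotated]) (simp add: p_def)
    then show ?thesis by (rule bij_imp_permutes) (simp add: p_def)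
  qed
  have "gsym (\<lambda>_. True) F"
    unfolding gsym_def
  proof (intro allI)
    fix u v :: "nat list" and x y
    let ?w = "u @ x # y # v" and ?w' = "u @ y # x # v" and ?i = "length u"
    have c: "distinct ?w \<and> set ?w = {..<n} \<longleftrightarrow> distinct ?w' \<and> set ?w' = {..<n}" by auto
    show "F ?w = signed (True \<and> True) (F ?w')"
    proof (cases "distinct ?w \<and> set ?w = {..<n}")
      case True
      have l: "length ?w = n" using True by (metis card_lessThan distinct_card)
      \<comment> \<open>Exchanging adjacent letters is composing with a transposition of
        positions.\<close>
      have "p ?w = p ?w' \<circ> Transposition.transpose ?i (Suc ?i)"
        using l by (auto simp: p_def fun_eq_iff nth_append Transposition.transpose_def nth_Cons split: nat.splits)
      moreover have "permutation (p ?w')"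
        using pp True c by (meson finite_lessThan permutation_permutes)
      ultimately have "sign (p ?w) = - sign (p ?w')"
        by (simp add: sign_compose permutation_swap_id sign_swap_id)
      moreover have "F ?w = sign (p ?w)"
        unfolding F_def using True by (rule if_P)
      moreover have "F ?w' = sign (p ?w')"
        unfolding F_def using True[unfolded c] by (rule if_P)
      ultimately show ?thesis by simp
    next
      case False
      have "F ?w = 0" unfolding F_def using False by (rule if_not_P)
      moreover have "F ?w' = 0" unfolding F_def using False[unfolded c] by (rule if_not_P)
      ultimately show ?thesis by simp
    qed
  qed
  from gsym_sort[OF this perm_word_props(1)[OF assms], of id]
  have "F [0..<n] = signed (inv_odd (\<lambda>_. True) (perm_word \<sigma> n)) (F (perm_word \<sigma> n))"
    by (simp add: perm_word_props(4)[OF assms])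
  moreover have "p [0..<n] = id" by (auto simp: p_def)
  then have "F [0..<n] = 1" by (auto simp: F_def sign_id)
  moreover have "p (perm_word \<sigma> n) = \<sigma>"
    using permutes_not_in[OF assms] by (auto simp: p_def perm_word_def fun_eq_iff)
  then have "F (perm_word \<sigma> n) = sign \<sigma>"
    using perm_word_props[OF assms] by (simp add: F_def)
  ultimately show ?thesis by (auto simp: signed_def sign_unit_def split: if_splits)
qed

text \<open>Induction on the word of values: the inversions involving position 0 are counted by the
  \<open>wodd\<close> in \<open>inv_odd\<close>, the others are those of the tail.\<close>

lemma koszul_sign_inv_odd:
  assumes "\<sigma> permutes {..<length ds}"
  shows "koszul_sign ds \<sigma> = sign_unit (inv_odd (\<lambda>i. odd (ds ! i)) (perm_word \<sigma> (length ds)))"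
proof -
  let ?e = "\<lambda>i. odd (ds ! i)"
  let ?P = "\<lambda>L. {(i, j). i < j \<and> j < length L \<and> L ! j < L ! i}"
  have fin: "finite (?P L)" for L :: "nat list"
    by (rule finite_subset[of _ "{..<length L} \<times> {..<length L}"]) auto
  have "(\<Prod>(i, j)\<in>?P L. sign_unit (?e (L ! i) \<and> ?e (L ! j)) :: 'a) = sign_unit (inv_odd ?e L)" for L :: "nat list"
  proof (induction L)
    case (Cons x L)
    let ?f = "\<lambda>L (i, j). sign_unit (?e (L ! i) \<and> ?e (L ! j)) :: 'a"
    have "?P (x # L) = (\<lambda>j. (0, Suc j)) ` {j. j < length L \<and> L ! j < x} \<union> map_prod Suc Suc ` ?P L"
    proof (intro equalityI subsetI; clarify)
      fix i j assume ij: "i < j" "j < length (x # L)" "(x # L) ! j < (x # L) ! i"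
      then obtain j' where j: "j = Suc j'" by (cases j) auto
      assume "(i, j) \<notin> map_prod Suc Suc ` ?P L"
      then have "i = 0" using ij j by (cases i) (auto simp: image_iff)
      then show "(i, j) \<in> (\<lambda>j. (0, Suc j)) ` {j. j < length L \<and> L ! j < x}" using ij j by auto
    qed auto
    then have "prod (?f (x # L)) (?P (x # L)) =
      prod (?f (x # L)) ((\<lambda>j. (0, Suc j)) ` {j. j < length L \<and> L ! j < x}) * prod (?f (x # L)) (map_prod Suc Suc ` ?P L)"
      using fin[of L] by (simp only:) (rule prod.union_disjoint, auto)
    also have "prod (?f (x # L)) (map_prod Suc Suc ` ?P L) = prod (?f L) (?P L)"
      by (subst prod.reindex) (auto simp: inj_on_def intro!: prod.cong)
    also have "prod (?f (x # L)) ((\<lambda>j. (0, Suc j)) ` {j. j < length L \<and> L ! j < x})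
      = (\<Prod>j | j < length L \<and> L ! j < x. sign_unit (?e x \<and> ?e (L ! j)))"
      by (subst prod.reindex) (auto simp: inj_on_def)
    also have "\<dots> = (\<Prod>j<length L. sign_unit (L ! j < x \<and> ?e x \<and> ?e (L ! j)))"
      by (rule prod.mono_neutral_cong_left) auto
    also have "\<dots> = sign_unit (wodd (\<lambda>y. y < x \<and> ?e x \<and> ?e y) L)"
      by (induction L) (simp_all add: prod.lessThan_Suc_shift sign_unit_mult del: prod.lessThan_Suc)
    finally show ?case
      using Cons by (simp add: sign_unit_mult)
  qed simp
  from this[of "perm_word \<sigma> (length ds)"]
  have "sign_unit (inv_odd ?e (perm_word \<sigma> (length ds))) =
     (\<Prod>(i, j)\<in>?P (perm_word \<sigma> (length ds)). sign_unit (?e (perm_word \<sigma> (length ds) ! i) \<and> ?e (perm_word \<sigma> (length ds) ! j)) :: 'a)"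
    by simp
  also have "\<dots> = koszul_sign ds \<sigma>"
    unfolding koszul_sign_def
  proof (rule prod.cong)
    show "?P (perm_word \<sigma> (length ds)) = {(i, j). i < j \<and> j < length ds \<and> \<sigma> j < \<sigma> i}"
      by (auto simp: perm_word_def)
    fix z assume "z \<in> {(i, j). i < j \<and> j < length ds \<and> \<sigma> j < \<sigma> i}"
    then show "(case z of (i, j) \<Rightarrow> sign_unit (?e (perm_word \<sigma> (length ds) ! i) \<and> ?e (perm_word \<sigma> (length ds) ! j)))
      = (case z of (i, j) \<Rightarrow> ((- 1) powi (ds ! \<sigma> i * ds ! \<sigma> j) :: 'a))"
      by (auto simp: perm_word_def sign_unit_def power_int_minus_left)
  qed
  finally show ?thesis by simp
qed

section \<open>Shuffles with several blocks\<close>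

definition shuffle_words :: "nat set \<Rightarrow> nat list \<Rightarrow> nat list set" where
  "shuffle_words S bs = {L. distinct L \<and> set L = S \<and> length L = sum_list bs \<and> (\<forall>B\<in>set (blocks bs L). sorted B)}"

lemma length_blocks [simp]: "length (blocks bs L) = length bs"
  by (induction bs arbitrary: L) auto

lemma blocks_nth: "b < length bs \<Longrightarrow> blocks bs L ! b = take (bs ! b) (drop (sum_list (take b bs)) L)"
  by (induction bs arbitrary: L b) (auto simp: nth_Cons drop_drop add.commute split: nat.splits)

lemma map_blocks: "blocks bs (map g L) = map (map g) (blocks bs L)"
  by (induction bs arbitrary: L) (auto simp: take_map drop_map)

text \<open>The values of a permutation are distinct, so strict monotonicity on a block amounts to
  the block of values being sorted.\<close>

lemma bij_Sh: "bij_betw (\<lambda>\<sigma>. perm_word \<sigma> (sum_list bs)) (Sh bs) (shuffle_words {..<sum_list bs} bs)"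
proof -
  let ?n = "sum_list bs"
  have block: "(\<forall>b<length bs. strict_mono_on {sum_list (take b bs)..<sum_list (take (Suc b) bs)} \<sigma>)
     \<longleftrightarrow> (\<forall>B\<in>set (blocks bs (perm_word \<sigma> ?n)). sorted B)" if \<sigma>: "\<sigma> permutes {..<?n}" for \<sigma>
  proof -
    have "strict_mono_on {sum_list (take b bs)..<sum_list (take (Suc b) bs)} \<sigma> \<longleftrightarrow> sorted (blocks bs (perm_word \<sigma> ?n) ! b)"
      if b: "b < length bs" for b
    proof -
      let ?s = "sum_list (take b bs)" and ?k = "bs ! b"
      have t: "sum_list (take (Suc b) bs) = ?s + ?k"
        using b by (simp add: take_Suc_conv_app_nth)
      have "sum_list bs = sum_list (take (Suc b) bs) + sum_list (drop (Suc b) bs)"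
        by (metis append_take_drop_id sum_list_append)
      then have le: "?s + ?k \<le> ?n" using t by simp
      have "blocks bs (perm_word \<sigma> ?n) ! b = map \<sigma> [?s..<?s + ?k]"
        using b le by (simp add: blocks_nth perm_word_def drop_map take_map take_upt)
      also have "sorted \<dots> \<longleftrightarrow> (\<forall>i j. i < j \<longrightarrow> j < ?k \<longrightarrow> \<sigma> (?s + i) \<le> \<sigma> (?s + j))"
        by (auto simp: sorted_iff_nth_mono_less)
      also have "\<dots> \<longleftrightarrow> strict_mono_on {?s..<?s + ?k} \<sigma>"
      proof
        assume *: "\<forall>i j. i < j \<longrightarrow> j < ?k \<longrightarrow> \<sigma> (?s + i) \<le> \<sigma> (?s + j)"
        show "strict_mono_on {?s..<?s + ?k} \<sigma>"
        proof (rule strict_mono_onI)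
          fix r r' assume r: "r \<in> {?s..<?s + ?k}" "r' \<in> {?s..<?s + ?k}" "r < r'"
          then have "\<sigma> r \<le> \<sigma> r'" using *[rule_format, of "r - ?s" "r' - ?s"] by auto
          moreover have "\<sigma> r \<noteq> \<sigma> r'" using permutes_inj[OF \<sigma>] r by (auto dest: injD)
          ultimately show "\<sigma> r < \<sigma> r'" by simp
        qed
      next
        assume *: "strict_mono_on {?s..<?s + ?k} \<sigma>"
        show "\<forall>i j. i < j \<longrightarrow> j < ?k \<longrightarrow> \<sigma> (?s + i) \<le> \<sigma> (?s + j)"
          using strict_mono_onD[OF *] by (intro allI impI less_imp_le) auto
      qed
      finally show ?thesis unfolding t by simp
    qed
    then show ?thesis by (simp add: all_set_conv_all_nth)
  qed
  show ?thesis
  proof (rule bij_betw_imageI)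
    show "inj_on (\<lambda>\<sigma>. perm_word \<sigma> ?n) (Sh bs)"
    proof (rule inj_onI)
      fix \<sigma> \<tau> assume *: "\<sigma> \<in> Sh bs" "\<tau> \<in> Sh bs" "perm_word \<sigma> ?n = perm_word \<tau> ?n"
      show "\<sigma> = \<tau>"
      proof
        fix i
        show "\<sigma> i = \<tau> i"
          using * by (cases "i < ?n") (auto simp: Sh_def perm_word_def permutes_not_in)
      qed
    qed
    show "(\<lambda>\<sigma>. perm_word \<sigma> ?n) ` Sh bs = shuffle_words {..<?n} bs"
    proof (intro equalityI subsetI)
      fix L assume "L \<in> (\<lambda>\<sigma>. perm_word \<sigma> ?n) ` Sh bs"
      then show "L \<in> shuffle_words {..<?n} bs"
        using perm_word_props block by (auto simp: shuffle_words_def Sh_def)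
    next
      fix L assume L: "L \<in> shuffle_words {..<?n} bs"
      define \<sigma> where "\<sigma> i = (if i < ?n then L ! i else i)" for i
      have p: "perm_word \<sigma> ?n = L"
        using L by (auto simp: shuffle_words_def perm_word_def \<sigma>_def intro: nth_equalityI)
      have "bij_betw (\<lambda>i. L ! i) {..<?n} {..<?n}"
        using L bij_betw_nth[of L] by (auto simp: shuffle_words_def)
      then have "bij_betw \<sigma> {..<?n} {..<?n}"
        by (rule bij_betw_cong[THEN iffD1, rotated]) (simp add: \<sigma>_def)
      then have s: "\<sigma> permutes {..<?n}" by (rule bij_imp_permutes) (simp add: \<sigma>_def)
      then have "\<sigma> \<in> Sh bs" using block[OF s] L p by (simp add: Sh_def shuffle_words_def)
      then show "L \<in> (\<lambda>\<sigma>. perm_word \<sigma> ?n) ` Sh bs" using p by blast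
    qed
  qed
qed

text \<open>A splitting of a sorted word without repetitions is a subset of its letters, and its
  Koszul sign counts the odd inversions of the first part followed by the second.\<close>

lemma unshuffle_subsets:
  assumes "sorted l" "distinct l"
  shows "unshuffle e F l = (\<Sum>A\<in>Pow (set l). signed (inv_odd e (filter (\<lambda>i. i \<in> A) l @ filter (\<lambda>i. i \<notin> A) l))
     (F (filter (\<lambda>i. i \<in> A) l) (filter (\<lambda>i. i \<notin> A) l)))"
  using assms
proof (induction l arbitrary: F)
  case (Cons x w)
  let ?i = "\<lambda>A. filter (\<lambda>i. i \<in> A)" and ?o = "\<lambda>A. filter (\<lambda>i. i \<notin> A)"
  let ?t = "\<lambda>F l A. signed (inv_odd e (?i A l @ ?o A l)) (F (?i A l) (?o A l))"
  have x: "x \<notin> set w" "\<And>z. z \<in> set w \<Longrightarrow> x < z" using Cons.prems by (auto simp: order_less_le)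
  have 1: "?t F (x # w) A = ?t (\<lambda>a b. signed (e x \<and> wodd e a) (F a (x # b))) w A" if "A \<in> Pow (set w)" for A
  proof -
    have "x \<notin> A" using that x by auto
    moreover have "inv_odd e (?i A w @ x # ?o A w) = ((e x \<and> wodd e (?i A w)) \<noteq> inv_odd e (?i A w @ ?o A w))"
      using x(2) by (intro inv_odd_insert) auto
    ultimately show ?thesis by (simp, intro signed_cong) auto
  qed
  have 2: "?t F (x # w) (insert x A) = ?t (\<lambda>a b. F (x # a) b) w A" if "A \<in> Pow (set w)" for A
  proof -
    have "?i (insert x A) w = ?i A w" "?o (insert x A) w = ?o A w"
      using x by (auto intro: filter_cong)
    moreover have "inv_odd e ((x # ?i A w) @ ?o A w) = inv_odd e (?i A w @ ?o A w)"
    proof -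
      have "\<not> wodd (\<lambda>y. y < x \<and> e x \<and> e y) (?i A w @ ?o A w)"
        by (rule wodd_False) (auto dest: x(2))
      then show ?thesis by (simp del: wodd_append)
    qed
    ultimately show ?thesis by simp
  qed
  have "(\<Sum>A\<in>Pow (set (x # w)). ?t F (x # w) A) =
     (\<Sum>A\<in>Pow (set w). ?t F (x # w) A) + (\<Sum>A\<in>insert x ` Pow (set w). ?t F (x # w) A)"
    using x unfolding list.set Pow_insert by (intro sum.union_disjoint) auto
  also have "(\<Sum>A\<in>insert x ` Pow (set w). ?t F (x # w) A) = (\<Sum>A\<in>Pow (set w). ?t F (x # w) (insert x A))"
  proof (subst sum.reindex)
    show "inj_on (insert x) (Pow (set w))"
      using x by (intro inj_onI) (metis Pow_iff insert_ident subsetD)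
  qed simp
  finally show ?case
    using Cons by (simp only: 1 2 unshuffle.simps sorted_wrt.simps distinct.simps ac_simps cong: sum.cong)
qed simp

text \<open>The iterated coproduct with prescribed block lengths; the base case demands that no
  letter is left over.\<close>

fun unshuffles :: "('a \<Rightarrow> bool) \<Rightarrow> nat list \<Rightarrow> ('a list list \<Rightarrow> 'b::ab_group_add) \<Rightarrow> 'a list \<Rightarrow> 'b" where
  "unshuffles d [] H w = (if w = [] then H [] else 0)"
| "unshuffles d (b # bs) H w = unshuffle d (\<lambda>a c. if length a = b then unshuffles d bs (\<lambda>B. H (a # B)) c else 0) w"

text \<open>A sorted first block is determined by its set of letters.\<close>

lemma shuffle_words_Cons:
  assumes "finite S"
  shows "(\<Sum>L\<in>shuffle_words S (b # bs). G L) = (\<Sum>A | A \<subseteq> S \<and> card A = b. \<Sum>L\<in>shuffle_words (S - A) bs. G (sorted_list_of_set A @ L))"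
proof -
  have finPL: "finite (shuffle_words T cs)" if "finite T" for T cs
    by (rule finite_subset[of _ "{L. set L \<subseteq> T \<and> length L = sum_list cs}"])
      (auto simp: shuffle_words_def intro: finite_lists_length_eq that)
  have finS: "A \<subseteq> S \<Longrightarrow> finite A" for A using assms finite_subset by blast
  have "(\<Sum>A | A \<subseteq> S \<and> card A = b. \<Sum>L\<in>shuffle_words (S - A) bs. G (sorted_list_of_set A @ L))
    = (\<Sum>(A, L)\<in>Sigma {A. A \<subseteq> S \<and> card A = b} (\<lambda>A. shuffle_words (S - A) bs). G (sorted_list_of_set A @ L))"
    using assms by (intro sum.Sigma) (auto simp: finPL)
  also have "\<dots> = (\<Sum>L\<in>shuffle_words S (b # bs). G L)"
  proof (rule sum.reindex_bij_witness[where i = "\<lambda>L. (set (take b L), drop b L)" and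
        j = "\<lambda>(A, L). sorted_list_of_set A @ L"], goal_cases)
    case (1 z)
    then obtain A L where z: "z = (A, L)" "A \<subseteq> S" "card A = b" by auto
    then show ?case using finS[OF z(2)] by simp
  next
    case (2 z)
    then obtain A L where z: "z = (A, L)" "A \<subseteq> S" "card A = b" "L \<in> shuffle_words (S - A) bs" by auto
    then show ?case using finS[OF z(2)] by (auto simp: shuffle_words_def)
  next
    case (3 L)
    then have L: "distinct L" "set L = S" "length L = b + sum_list bs" "sorted (take b L)"
      "\<forall>B\<in>set (blocks bs (drop b L)). sorted B"
      by (auto simp: shuffle_words_def)
    have "sorted_list_of_set (set (take b L)) = take b L"
      using L by (simp add: sorted_list_of_set.idem_if_sorted_distinct)
    then show ?case by simp
  next
    case (4 L)
    then have L: "distinct L" "set L = S" "length L = b + sum_list bs" "sorted (take b L)"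
      "\<forall>B\<in>set (blocks bs (drop b L)). sorted B"
      by (auto simp: shuffle_words_def)
    have "set (take b L) \<subseteq> S" using L(2) set_take_subset by fastforce
    moreover have "card (set (take b L)) = b" using L by (simp add: distinct_card)
    moreover have "set (drop b L) = S - set (take b L)"
      using set_take_disj_set_drop_if_distinct[OF L(1) order_refl, of b] L(2)
        set_append[of "take b L" "drop b L"] unfolding append_take_drop_id by auto
    ultimately show ?case using L by (auto simp: shuffle_words_def)
  next
    case (5 z)
    then show ?case by auto
  qed
  finally show ?thesis ..
qed

text \<open>Splitting off the first block, \<open>inv_odd_perm_right\<close> separates the
  inversions between it and the rest from those inside the rest; the former give the sign of
  \<open>unshuffle\<close>, the latter the induction hypothesis.\<close>

lemma unshuffles_shuffle_words:
  assumes "sorted l" "distinct l"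
  shows "(\<Sum>L\<in>shuffle_words (set l) bs. signed (inv_odd e L) (H (blocks bs L))) = unshuffles e bs H l"
  using assms
proof (induction bs arbitrary: H l)
  case Nil
  have "shuffle_words (set l) [] = (if l = [] then {[]} else {})" by (auto simp: shuffle_words_def)
  then show ?case by auto
next
  case (Cons b bs)
  let ?i = "\<lambda>A. filter (\<lambda>i. i \<in> A) l" and ?o = "\<lambda>A. filter (\<lambda>i. i \<notin> A) l"
  have "unshuffles e (b # bs) H l = (\<Sum>A\<in>Pow (set l). signed (inv_odd e (?i A @ ?o A))
     (if length (?i A) = b then unshuffles e bs (\<lambda>B. H (?i A # B)) (?o A) else 0))"
    by (simp add: unshuffle_subsets[OF Cons.prems])
  also have "\<dots> = (\<Sum>A | A \<subseteq> set l \<and> card A = b. signed (inv_odd e (?i A @ ?o A)) (unshuffles e bs (\<lambda>B. H (?i A # B)) (?o A)))"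
  proof (rule sum.mono_neutral_cong_right)
    have "length (?i A) = card A" if "A \<subseteq> set l" for A
    proof -
      have "length (?i A) = card (set (?i A))"
        using Cons.prems(2) by (intro distinct_card[symmetric] distinct_filter)
      also have "set (?i A) = A" using that by auto
      finally show ?thesis .
    qed
    then show "\<forall>A\<in>Pow (set l) - {A. A \<subseteq> set l \<and> card A = b}. signed (inv_odd e (?i A @ ?o A))
     (if length (?i A) = b then unshuffles e bs (\<lambda>B. H (?i A # B)) (?o A) else 0) = 0"
     "\<And>A. A \<in> {A. A \<subseteq> set l \<and> card A = b} \<Longrightarrow> signed (inv_odd e (?i A @ ?o A))
     (if length (?i A) = b then unshuffles e bs (\<lambda>B. H (?i A # B)) (?o A) else 0) = signed (inv_odd e (?i A @ ?o A)) (unshuffles e bs (\<lambda>B. H (?i A # B)) (?o A))"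
      by auto
  qed auto
  also have "\<dots> = (\<Sum>A | A \<subseteq> set l \<and> card A = b. \<Sum>L\<in>shuffle_words (set l - A) bs.
     signed (inv_odd e (sorted_list_of_set A @ L)) (H (blocks (b # bs) (sorted_list_of_set A @ L))))"
  proof (rule sum.cong[OF refl])
    fix A assume "A \<in> {A. A \<subseteq> set l \<and> card A = b}"
    then have A: "A \<subseteq> set l" "card A = b" "finite A" by (auto intro: finite_subset)
    have i: "?i A = sorted_list_of_set A"
      using A Cons.prems by (intro sorted_distinct_set_unique) (auto intro: sorted_filter[of id, simplified])
    have o: "set (?o A) = set l - A" "sorted (?o A)" "distinct (?o A)"
      using Cons.prems sorted_filter[of id, simplified] by auto
    have "signed (inv_odd e (?i A @ ?o A)) (unshuffles e bs (\<lambda>B. H (?i A # B)) (?o A))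
      = signed (inv_odd e (?i A @ ?o A)) (\<Sum>L\<in>shuffle_words (set l - A) bs. signed (inv_odd e L) (H (?i A # blocks bs L)))"
      using Cons.IH[OF o(2,3), of "\<lambda>B. H (?i A # B)"] o(1) by simp
    also have "\<dots> = (\<Sum>L\<in>shuffle_words (set l - A) bs. signed (inv_odd e (?i A @ ?o A)) (signed (inv_odd e L) (H (?i A # blocks bs L))))"
      by (simp add: signed_def sum_negf)
    also have "\<dots> = (\<Sum>L\<in>shuffle_words (set l - A) bs. signed (inv_odd e (?i A @ L)) (H (blocks (b # bs) (?i A @ L))))"
    proof (rule sum.cong[OF refl])
      fix L assume L: "L \<in> shuffle_words (set l - A) bs"
      then have "inv_odd e (?i A @ L) = ((inv_odd e (?i A @ ?o A) \<noteq> inv_odd e (?o A)) \<noteq> inv_odd e L)"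
        using o by (intro inv_odd_perm_right) (auto simp: shuffle_words_def)
      moreover have "\<not> inv_odd e (?o A)" using o by (intro inv_odd_sorted)
      moreover have "length (?i A) = b" using A by (simp add: i)
      ultimately show "signed (inv_odd e (?i A @ ?o A)) (signed (inv_odd e L) (H (?i A # blocks bs L)))
        = signed (inv_odd e (?i A @ L)) (H (blocks (b # bs) (?i A @ L)))"
        by (auto intro: signed_cong)
    qed
    finally show "signed (inv_odd e (?i A @ ?o A)) (unshuffles e bs (\<lambda>B. H (?i A # B)) (?o A))
      = (\<Sum>L\<in>shuffle_words (set l - A) bs. signed (inv_odd e (sorted_list_of_set A @ L)) (H (blocks (b # bs) (sorted_list_of_set A @ L))))"
      unfolding i .
  qed
  also have "\<dots> = (\<Sum>L\<in>shuffle_words (set l) (b # bs). signed (inv_odd e L) (H (blocks (b # bs) L)))"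
    by (rule shuffle_words_Cons[symmetric]) simp
  finally show ?case ..
qed

lemma unshuffles_map: "(\<And>x. d' (h x) = d x) \<Longrightarrow> unshuffles d' bs H (map h w) = unshuffles d bs (\<lambda>B. H (map (map h) B)) w"
  by (induction bs arbitrary: H w) (simp_all add: unshuffle_map[of d' h d] cong: if_cong)

text \<open>The identity is proved for the positions \<open>[0..<n]\<close>, which are sorted and
  distinct, and then relabelled by \<open>(!) w\<close>; in this way \<open>w\<close> may have
  repeated entries.\<close>

theorem sum_Sh:
  assumes "length w = sum_list bs"
  shows "(\<Sum>\<sigma>\<in>Sh bs. signed (inv_odd (\<lambda>i. d (w ! i)) (perm_word \<sigma> (length w))) (H (blocks bs (permute_list \<sigma> w))))
    = unshuffles d bs H w"
proof -
  have "(\<Sum>\<sigma>\<in>Sh bs. signed (inv_odd (\<lambda>i. d (w ! i)) (perm_word \<sigma> (length w))) (H (blocks bs (permute_list \<sigma> w))))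
    = (\<Sum>L\<in>shuffle_words {..<sum_list bs} bs. signed (inv_odd (\<lambda>i. d (w ! i)) L) (H (map (map ((!) w)) (blocks bs L))))"
    using sum.reindex_bij_betw[OF bij_Sh, of "\<lambda>L. signed (inv_odd (\<lambda>i. d (w ! i)) L) (H (map (map ((!) w)) (blocks bs L)))" bs]
    by (simp add: assms permute_list_perm_word map_blocks)
  also have "\<dots> = unshuffles (\<lambda>i. d (w ! i)) bs (\<lambda>B. H (map (map ((!) w)) B)) [0..<sum_list bs]"
    using unshuffles_shuffle_words[of "[0..<sum_list bs]" "\<lambda>i. d (w ! i)" "\<lambda>B. H (map (map ((!) w)) B)" bs]
    by (simp add: atLeast0LessThan)
  also have "\<dots> = unshuffles d bs H (map ((!) w) [0..<sum_list bs])"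
    by (rule unshuffles_map[symmetric]) simp
  also have "map ((!) w) [0..<sum_list bs] = w"
    using map_nth[of w] assms by simp
  finally show ?thesis .
qed

text \<open>The second block takes everything left by the first, so its unshuffle collapses by the
  counit.\<close>

lemma sum_Sh2:
  fixes w :: "'a list"
  assumes "length w = i + j"
  shows "(\<Sum>\<sigma>\<in>Sh [i, j]. signed (inv_odd (\<lambda>i. d (w ! i)) (perm_word \<sigma> (length w)))
      (G (take i (permute_list \<sigma> w)) (drop i (permute_list \<sigma> w))))
    = unshuffle d (\<lambda>a c. if length a = i then G a c else 0) w"
proof -
  have "(\<Sum>\<sigma>\<in>Sh [i, j]. signed (inv_odd (\<lambda>i. d (w ! i)) (perm_word \<sigma> (length w)))
      (G (take i (permute_list \<sigma> w)) (drop i (permute_list \<sigma> w))))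
    = unshuffles d [i, j] (\<lambda>B. G (B ! 0) (B ! 1)) w"
    using assms by (subst sum_Sh[symmetric]) simp_all
  also have "\<dots> = unshuffle d (\<lambda>a c. if length a = i then unshuffle d (\<lambda>a' c'. if c' = [] then G a a' else 0) c else 0) w"
    unfolding unshuffles.simps
  proof (rule unshuffle_cong)
    fix a c :: "'a list" assume *: "length a + length c = length w"
    show "(if length a = i then unshuffle d (\<lambda>aa ca. if length aa = j
              then if ca = [] then G ([a, aa] ! 0) ([a, aa] ! 1) else 0 else 0) c else 0)
      = (if length a = i then unshuffle d (\<lambda>a' c'. if c' = [] then G a a' else 0) c else 0)"
    proof (rule if_cong[OF refl _ refl], rule unshuffle_cong)
      fix aa ca :: "'a list"
      assume "length a = i" "length aa + length ca = length c"
      then show "(if length aa = j then if ca = [] then G ([a, aa] ! 0) ([a, aa] ! 1) else 0 else 0)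
        = (if ca = [] then G a aa else 0)"
        using * assms by (cases "ca = []") simp_all
    qed
  qed
  also have "\<dots> = unshuffle d (\<lambda>a c. if length a = i then G a c else 0) w"
    unfolding unshuffle_nil ..
  finally show ?thesis .
qed

text \<open>The total sign collected by the recursion of \<open>brace\<close> when the block of each
  letter, of length m + 1, passes the letters behind it.\<close>

fun koszul_parity :: "nat list \<Rightarrow> bool" where
  "koszul_parity [] = False"
| "koszul_parity (m # ms) = ((even m \<and> odd (sum_list ms)) \<noteq> koszul_parity ms)"

lemma wodd_zip: "length ps = length xs \<Longrightarrow> wodd fst (zip ps xs) = wodd id ps"
  by (induction ps xs rule: list_induct2) auto

lemma wodd_map_odd: "wodd id (map odd ms) = odd (sum_list (ms :: nat list))"
  by (induction ms) auto

section \<open>The maps and the bracket of the statement in terms of braces\<close>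

context char0_vector_space
begin

lemma scale_sign_unit: "scale (sign_unit c) x = signed c x"
  by (simp add: sign_unit_def signed_def)

lemma scale_sign:
  assumes "\<sigma> permutes {..<n}"
  shows "scale (of_int (sign \<sigma>)) x = signed (inv_odd (\<lambda>_. True) (perm_word \<sigma> n)) x"
  unfolding sign_inv_odd[OF assms] by (simp add: sign_unit_def)

lemma self_neg_0:
  assumes "x = - (x :: 'b)"
  shows "x = 0"
proof -
  have "scale 2 x = x + x"
    using scale_left_distrib[of 1 1 x] by simp
  also have "\<dots> = 0" using assms by (metis neg_eq_iff_add_eq_0)
  finally show ?thesis by (simp add: scale_eq_0_iff)
qed

text \<open>Characteristic \<open>0\<close> enters here: a graded symmetric map vanishes on repeated arguments because
  \<open>2\<close> is invertible.\<close>

lemma alternating_maps_iff: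
  "f \<in> alternating_maps scale (Suc n) \<longleftrightarrow> alt_map f \<and> has_degree (int n) f"
proof
  assume "f \<in> alternating_maps scale (Suc n)"
  then have ml: "multilinear_on scale scale UNIV (Suc n) f"
    and alt: "\<And>xs i j. length xs = Suc n \<Longrightarrow> i < j \<Longrightarrow> j < Suc n \<Longrightarrow> xs ! i = xs ! j \<Longrightarrow> f xs = 0"
    and d: "\<And>xs. length xs \<noteq> Suc n \<Longrightarrow> f xs = 0"
    unfolding alternating_maps_def by auto
  have lin_map: "lin_map (\<lambda>x. f (u @ x # v))" for u v
  proof (cases "length (u @ 0 # v) = Suc n")
    case True
    then show ?thesis
      using ml[unfolded multilinear_on_def, rule_format, of "u @ 0 # v" "length u"] unfolding lin_map_def by simp
  next
    case False
    then show ?thesis unfolding lin_map_def by (simp add: d)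
  qed
  have anti: "f (u @ x # y # v) = - f (u @ y # x # v)" for u x y v
  proof (cases "length (u @ x # y # v) = Suc n")
    case True
    have 0: "f (u @ z # z # v) = 0" for z
      using True by (intro alt[of _ "length u" "Suc (length u)"]) (simp_all add: nth_append)
    have "0 = f (u @ (x + y) # (x + y) # v)" by (simp add: 0)
    also have "\<dots> = f (u @ x # y # v) + f (u @ y # x # v)"
      using lin_map_add[OF lin_map[of u "(x + y) # v"], of x y] lin_map_add[OF lin_map[of "u @ [x]" v], of x y]
        lin_map_add[OF lin_map[of "u @ [y]" v], of x y] 0 by simp
    finally show ?thesis by (simp add: eq_neg_iff_add_eq_0)
  next
    case False
    then show ?thesis by (simp add: d)
  qed
  have "gsym (\<lambda>_. True) f"
    unfolding gsym_def by (intro allI, subst anti) simp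
  then show "alt_map f \<and> has_degree (int n) f" unfolding alt_map_def has_degree_def using lin_map d by auto
next
  assume "alt_map f \<and> has_degree (int n) f"
  then have g: "alt_map f" and d: "has_degree (int n) f" by auto
  have "multilinear_on scale scale UNIV (Suc n) f"
    unfolding multilinear_on_def
    using lin_map_add[OF alt_mapD_lin_map[OF g]] lin_map_scale[OF alt_mapD_lin_map[OF g]] by (auto simp: upd_conv_take_nth_drop)
  moreover have "f xs = 0" if "i < j" "j < length xs" "xs ! i = xs ! j" for xs i j
  proof -
    let ?t = "Transposition.transpose i j"
    have p: "?t permutes {..<length xs}" using that by (intro permutes_swap_id) auto
    have "sign ?t = -1" using that by (simp add: sign_swap_id)
    then have "inv_odd (\<lambda>_. True) (perm_word ?t (length xs))"
      using sign_inv_odd[OF p] by (auto simp: sign_unit_def split: if_splits)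
    moreover have "permute_list ?t xs = xs"
      using that by (intro nth_equalityI) (auto simp: permute_list_nth[OF p] Transposition.transpose_def)
    ultimately have "f xs = - f xs"
      using gsym_permute[OF alt_mapD_gsym[OF g] p] by simp
    then show ?thesis by (rule self_neg_0)
  qed
  moreover have "\<forall>xs. length xs \<noteq> Suc n \<longrightarrow> f xs = 0"
    using has_degreeD[OF d] by auto
  ultimately show "f \<in> alternating_maps scale (Suc n)"
    unfolding alternating_maps_def by auto
qed

text \<open>The condition at \<open>[]\<close> excludes elements of \<gg> as maps of degree -1. With
  it the description of \<open>Hom_ext\<close> is uniform in all integers, the negative degrees
  giving 0.\<close>

definition hmap :: "int \<Rightarrow> ('b list \<Rightarrow> 'b) \<Rightarrow> bool" where
  "hmap d f \<longleftrightarrow> alt_map f \<and> has_degree d f \<and> f [] = 0"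

lemma alternating_maps_hmap: "f \<in> alternating_maps scale (n + 1) \<longleftrightarrow> hmap (int n) f"
  using alternating_maps_iff[of f n] has_degreeD[of "int n" f "[]"] by (auto simp: hmap_def)

lemma Hom_ext_hmap: "f \<in> Hom_ext scale d \<longleftrightarrow> hmap d f"
proof (cases "d \<ge> 0")
  case True
  then show ?thesis using alternating_maps_hmap[of f "nat d"] by (simp add: Hom_ext_def)
next
  case False
  have "f = 0" if "hmap d f"
  proof
    fix X show "f X = 0 X"
      using that False by (cases X) (auto simp: hmap_def intro: has_degreeD)
  qed
  moreover have "hmap d 0"
    using alt_map_0 by (simp add: hmap_def has_degree_def)
  ultimately show ?thesis using False by (auto simp: Hom_ext_def)
qed

lemma hmap_0: "hmap d (\<lambda>X. 0)" "hmap d 0"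
  using alt_map_0 by (simp_all add: hmap_def has_degree_def)

lemma hmap_add: "hmap d f \<Longrightarrow> hmap d g \<Longrightarrow> hmap d (\<lambda>X. f X + g X)"
  by (simp add: hmap_def has_degree_def alt_map_add)

lemma hmap_scale: "hmap d f \<Longrightarrow> hmap d (\<lambda>X. scale c (f X))"
  by (simp add: hmap_def has_degree_def alt_map_scale)

lemma hmap_signed: "hmap d f \<Longrightarrow> hmap d (\<lambda>X. signed c (f X))"
  by (simp add: hmap_def has_degree_def alt_map_signed)

lemma hmap_diff: "hmap d f \<Longrightarrow> hmap d g \<Longrightarrow> hmap d (\<lambda>X. f X - g X)"
  by (simp add: hmap_def has_degree_def alt_map_diff)

lemma hmap_has_parity: "hmap d f \<Longrightarrow> has_parity (odd d) f"
  unfolding hmap_def by (auto intro: has_degree_has_parity)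

lemma hmap_alt_map: "hmap d f \<Longrightarrow> alt_map f"
  unfolding hmap_def by auto

lemma hmap_brace:
  assumes "hmap n f" "list_all2 (\<lambda>m x. hmap m (snd x)) ms \<Xi>"
  shows "hmap (n + sum_list ms) (brace f \<Xi>)"
proof -
  have g: "\<And>x. x \<in> set \<Xi> \<Longrightarrow> alt_map (snd x) \<and> snd x [] = 0"
    using assms(2) by (auto simp: list_all2_conv_all_nth in_set_conv_nth hmap_def)
  have "list_all2 (\<lambda>m x. has_degree m (snd x)) ms \<Xi>"
    using assms(2) by (rule list_all2_mono) (simp add: hmap_def)
  then show ?thesis
    using assms(1) g unfolding hmap_def by (auto intro: alt_map_brace has_degree_brace brace_nil)
qed

lemma hmap_plug: "hmap n f \<Longrightarrow> hmap m g \<Longrightarrow> hmap (n + m) (plug f g)"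
  using hmap_brace[of n f "[m]" "[(True, g)]"] by (simp add: brace_single)

lemma hmap_if: "(c \<Longrightarrow> hmap d f) \<Longrightarrow> (\<not> c \<Longrightarrow> hmap d g) \<Longrightarrow> hmap d (\<lambda>X. if c then f X else g X)"
  by (cases c) simp_all

lemma hmap_act:
  assumes "hmap n f" "list_all2 (\<lambda>m x. hmap m (snd x)) ms \<Xi>"
  shows "hmap (n + sum_list ms) (act lam p f \<Xi>)"
  unfolding act_def
proof (intro hmap_diff hmap_if hmap_0 hmap_scale hmap_signed)
  show "hmap (n + sum_list ms) (brace f \<Xi>)" by (rule hmap_brace[OF assms])
next
  assume "length \<Xi> = 1"
  then obtain x where \<Xi>: "\<Xi> = [x]" by (auto simp: length_Suc_conv)
  then obtain m where "ms = [m]" "hmap m (snd x)"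
    using assms(2) by (auto simp: list_all2_Cons2)
  then show "hmap (n + sum_list ms) (plug (snd (hd \<Xi>)) f)"
    using hmap_plug[of m "snd x" n f] assms(1) \<Xi> by (simp add: add.commute)
qed

text \<open>The restriction to blocks of length q + 1 is automatic: on other blocks \<open>g\<close>
  vanishes, and \<open>f\<close> is linear in its first slot.\<close>

lemma nr_comp_plug:
  assumes "hmap (int p) f" "hmap (int q) g"
  shows "nr_comp scale p q f g = plug f g"
proof
  fix X
  show "nr_comp scale p q f g X = plug f g X"
  proof (cases "length X = p + q + 1")
    case True
    then have l: "length X = (q + 1) + p" by simp
    have "nr_comp scale p q f g X = (\<Sum>\<sigma>\<in>Sh [q + 1, p]. signed (inv_odd (\<lambda>i. True) (perm_word \<sigma> (length X)))
        (f (g (take (q + 1) (permute_list \<sigma> X)) # drop (q + 1) (permute_list \<sigma> X))))"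
      unfolding nr_comp_def using True
      by (auto intro!: sum.cong scale_sign simp: Sh_def add.commute)
    also have "\<dots> = unshuffle (\<lambda>_. True) (\<lambda>a c. if length a = q + 1 then f (g a # c) else 0) X"
      by (rule sum_Sh2[OF l, of "\<lambda>_. True" "\<lambda>a c. f (g a # c)"])
    also have "\<dots> = plug f g X"
      unfolding plug_def
    proof (rule unshuffle_cong)
      fix a c :: "'b list"
      have "f (g a # c) = 0" if "length a \<noteq> q + 1"
      proof -
        have "g a = 0" using assms(2) that has_degreeD[of "int q" g a] by (auto simp: hmap_def)
        then show ?thesis using lin_map_0[OF alt_mapD_lin0[OF hmap_alt_map[OF assms(1)]]] by simp
      qed
      then show "(if length a = q + 1 then f (g a # c) else 0) = f (g a # c)" by auto
    qed
    finally show ?thesis .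
  next
    case False
    have "plug f g X = 0"
      using hmap_plug[OF assms] False has_degreeD[of "int p + int q" "plug f g" X] by (auto simp: hmap_def)
    then show ?thesis using False by (simp add: nr_comp_def)
  qed
qed

lemma nr_bracket_bracket:
  assumes "hmap (int p) f" "hmap (int q) g"
  shows "nr_bracket scale p q f g = bracket (odd p) f (odd q) g"
proof
  fix X
  have "scale ((-1) ^ (p * q)) x = signed (odd p \<and> odd q) x" for x
    using scale_sign_unit[of "odd (p * q)" x] unfolding sign_unit_power by simp
  then show "nr_bracket scale p q f g X = bracket (odd p) f (odd q) g X"
    using nr_comp_plug[OF assms] nr_comp_plug[OF assms(2,1)]
    by (simp add: nr_bracket_def bracket_def fun_scale_def)
qed

text \<open>Unfolded, the brace is one unshuffle into a block for each letter and a last block of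
  bare arguments, with all signs of the recursion collected in \<open>koszul_parity\<close>.\<close>

lemma brace_unshuffles:
  assumes "hmap (int n) f" "list_all2 (\<lambda>m \<xi>. hmap (int m) \<xi>) ms \<xi>s" "length ms \<le> n + 1"
    "length X = sum_list (map Suc ms) + (n + 1 - length ms)"
  shows "brace f (zip (map odd ms) \<xi>s) X = signed (koszul_parity ms) (unshuffles (\<lambda>_. True) (map Suc ms @ [n + 1 - length ms])
      (\<lambda>B. f (map2 (\<lambda>\<xi> a. \<xi> a) \<xi>s (butlast B) @ last B)) X)"
proof -
  \<comment> \<open>The number \<open>k\<close> of bare arguments stays fixed while letters are
    consumed; a formula in \<open>n\<close> would not survive the partial evaluation of
    \<open>f\<close>.\<close>
  have "brace f (zip (map odd ms) \<xi>s) X = signed (koszul_parity ms) (unshuffles (\<lambda>_. True) (map Suc ms @ [k])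
      (\<lambda>B. f (map2 (\<lambda>\<xi> a. \<xi> a) \<xi>s (butlast B) @ last B)) X)"
    if "alt_map f" "length X = sum_list (map Suc ms) + k" for k f X
    using assms(2) that
  proof (induction ms \<xi>s arbitrary: f X)
    case Nil
    then have "unshuffles (\<lambda>_. True) [k] (\<lambda>B. f (last B)) X = unshuffle (\<lambda>_. True) (\<lambda>a c. if c = [] then f a else 0) X"
      unfolding unshuffles.simps by (intro unshuffle_cong) auto
    then show ?case by (simp add: unshuffle_nil)
  next
    case (Cons m ms \<xi> \<xi>s)
    let ?H = "\<lambda>f B. f (map2 (\<lambda>\<xi> a. \<xi> a) \<xi>s (butlast B) @ last B)"
    have len: "length ms = length \<xi>s" using Cons.hyps by (simp add: list_all2_lengthD)
    have "brace f (zip (map odd (m # ms)) (\<xi> # \<xi>s)) X = unshuffle (\<lambda>_. True) (\<lambda>a b. signed (even m \<and> odd (sum_list ms))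
       (brace (\<lambda>ys. f (\<xi> a # ys)) (zip (map odd ms) \<xi>s) b)) X"
      using len by (simp add: wodd_zip wodd_map_odd)
    also have "\<dots> = unshuffle (\<lambda>_. True) (\<lambda>a b. signed (koszul_parity (m # ms)) (if length a = Suc m then
       unshuffles (\<lambda>_. True) (map Suc ms @ [k]) (\<lambda>B. f (\<xi> a # map2 (\<lambda>\<xi> a. \<xi> a) \<xi>s (butlast B) @ last B)) b else 0)) X"
    proof (rule unshuffle_cong)
      fix a b :: "'b list" assume l: "length a + length b = length X"
      show "signed (even m \<and> odd (sum_list ms)) (brace (\<lambda>ys. f (\<xi> a # ys)) (zip (map odd ms) \<xi>s) b)
        = signed (koszul_parity (m # ms)) (if length a = Suc m then
       unshuffles (\<lambda>_. True) (map Suc ms @ [k]) (\<lambda>B. f (\<xi> a # map2 (\<lambda>\<xi> a. \<xi> a) \<xi>s (butlast B) @ last B)) b else 0)"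
      proof (cases "length a = Suc m")
        case True
        have "brace (\<lambda>ys. f (\<xi> a # ys)) (zip (map odd ms) \<xi>s) b = signed (koszul_parity ms)
           (unshuffles (\<lambda>_. True) (map Suc ms @ [k]) (\<lambda>B. f (\<xi> a # map2 (\<lambda>\<xi> a. \<xi> a) \<xi>s (butlast B) @ last B)) b)"
          by (rule Cons.IH[OF alt_map_Cons[OF Cons.prems(1)]]) (use Cons.prems(2) True l in simp)
        then show ?thesis using True by simp
      next
        case False
        have "\<xi> a = 0" using Cons.hyps(1) False has_degreeD[of "int m" \<xi> a] by (auto simp: hmap_def)
        then have "(\<lambda>ys. f (\<xi> a # ys)) = (\<lambda>ys. 0)"
          using lin_map_0[OF alt_mapD_lin0[OF Cons.prems(1)]] by simp
        then show ?thesis using False by simp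
      qed
    qed
    also have "\<dots> = signed (koszul_parity (m # ms)) (unshuffle (\<lambda>_. True) (\<lambda>a b. if length a = Suc m then
       unshuffles (\<lambda>_. True) (map Suc ms @ [k]) (\<lambda>B. f (\<xi> a # map2 (\<lambda>\<xi> a. \<xi> a) \<xi>s (butlast B) @ last B)) b else 0) X)"
      by (rule unshuffle_signed)
    also have "unshuffle (\<lambda>_. True) (\<lambda>a b. if length a = Suc m then
       unshuffles (\<lambda>_. True) (map Suc ms @ [k]) (\<lambda>B. f (\<xi> a # map2 (\<lambda>\<xi> a. \<xi> a) \<xi>s (butlast B) @ last B)) b else 0) X
      = unshuffles (\<lambda>_. True) (map Suc (m # ms) @ [k])
          (\<lambda>B. f (map2 (\<lambda>\<xi> a. \<xi> a) (\<xi> # \<xi>s) (butlast B) @ last B)) X"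
    proof -
      \<comment> \<open>\<open>butlast (a # B)\<close> begins with \<open>a\<close> only for
        nonempty \<open>B\<close>; the block of bare arguments, even if it is the empty list,
        guarantees this.\<close>
      have ne: "unshuffles (\<lambda>_. True) (map Suc ms @ [k]) G b = unshuffles (\<lambda>_. True) (map Suc ms @ [k]) G' b"
        if "\<And>B. B \<noteq> [] \<Longrightarrow> G B = G' B" for G G' :: "'b list list \<Rightarrow> 'b" and b
        using that
      proof (induction ms arbitrary: G G' b)
        case Nil
        show ?case
          unfolding list.map append_Nil unshuffles.simps by (rule unshuffle_cong) (simp add: Nil)
      next
        case (Cons m ms)
        show ?case
          unfolding list.map append_Cons unshuffles.simps
          by (rule unshuffle_cong, rule if_cong[OF refl _ refl], rule Cons.IH, rule Cons.prems) simp
      qed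
      show ?thesis
        unfolding list.map append_Cons unshuffles.simps
        by (rule unshuffle_cong, rule if_cong[OF refl _ refl], rule ne) simp
    qed
    finally show ?case .
  qed
  from this[OF hmap_alt_map[OF assms(1)] assms(4)] show ?thesis .
qed

end

lemma blocks_snoc: "blocks (bs @ [k]) xs = blocks bs xs @ [take k (drop (sum_list bs) xs)]"
  by (induction bs arbitrary: xs) (simp_all add: add.commute)

lemma sum_apply: "sum g A x = (\<Sum>i\<in>A. g i x)"
  by (induction A rule: infinite_finite_induct) simp_all

text \<open>In the reversed word the letters behind \<xi>_j are the \<xi>_k with k < j, which yields
  the Koszul exponent of \<open>comp_tensor\<close>.\<close>

lemma koszul_parity_rev:
  "koszul_parity (rev ms) = odd (\<Sum>j<length ms. \<Sum>k<j. ms ! k * (ms ! j + 1))"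
proof (induction ms rule: rev_induct)
  case (snoc m ms)
  have "(\<Sum>j<length ms. \<Sum>k<j. (ms @ [m]) ! k * ((ms @ [m]) ! j + 1))
     = (\<Sum>j<length ms. \<Sum>k<j. ms ! k * (ms ! j + 1))"
    by (intro sum.cong refl) (simp add: nth_append)
  moreover have "(\<Sum>k<length ms. (ms @ [m]) ! k * (m + 1)) = sum_list ms * (m + 1)"
    unfolding sum_distrib_right[symmetric] sum_list_sum_nth atLeast0LessThan[symmetric]
    by (simp add: nth_append)
  ultimately show ?case
    using snoc by (auto simp: lessThan_Suc)
qed simp

lemma wodd_zip_odd: "length ms = length \<xi>s \<Longrightarrow> wodd fst (zip (map odd ms) \<xi>s) = odd (sum_list (ms :: nat list))"
  by (simp add: wodd_zip wodd_map_odd)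

context char0_vector_space
begin

text \<open>Reversal exchanges every pair of letters once, so the exponent is the sum of m_k m_j
  over k < j, the one in the definition of \<open>higher_op\<close>.\<close>

lemma brace_rev:
  fixes ms :: "nat list"
  assumes "alt_map f" "length ms = length \<xi>s" "alt_word (zip (map odd ms) \<xi>s)"
  shows "brace f (rev (zip (map odd ms) \<xi>s)) X = signed (odd (\<Sum>j<length ms. (\<Sum>k<j. ms ! k) * ms ! j))
     (brace f (zip (map odd ms) \<xi>s) X)"
  using assms
proof (induction ms arbitrary: f \<xi>s X rule: rev_induct)
  case Nil
  then show ?case by simp
next
  case (snoc m ms)
  obtain \<xi>s' \<xi> where \<xi>s: "\<xi>s = \<xi>s' @ [\<xi>]" using snoc.prems(2) by (cases \<xi>s rule: rev_cases) auto
  have len: "length ms = length \<xi>s'" using snoc.prems(2) \<xi>s by simp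
  let ?z = "zip (map odd ms) \<xi>s'"
  have z: "zip (map odd (ms @ [m])) \<xi>s = ?z @ [(odd m, \<xi>)]" using len \<xi>s by simp
  have g: "alt_word (?z @ [(odd m, \<xi>)])" using snoc.prems(3) unfolding z .
  have "brace f ((odd m, \<xi>) # rev ?z) X = signed (odd (\<Sum>j<length ms. (\<Sum>k<j. ms ! k) * ms ! j)) (brace f ((odd m, \<xi>) # ?z) X)"
  proof -
    have "wodd fst (rev z) = wodd fst z" for z :: "(bool \<times> ('b list \<Rightarrow> 'b)) list"
      by (induction z) auto
    moreover have "brace (\<lambda>ys. f (\<xi> a # ys)) (rev ?z) b = signed (odd (\<Sum>j<length ms. (\<Sum>k<j. ms ! k) * ms ! j)) (brace (\<lambda>ys. f (\<xi> a # ys)) ?z b)" for a b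
      by (rule snoc.IH[OF alt_map_Cons[OF snoc.prems(1)] len]) (use g in simp)
    ultimately show ?thesis
      by (simp add: unshuffle_signed[symmetric]) (rule unshuffle_cong, rule signed_cong, auto)
  qed
  also have "brace f ((odd m, \<xi>) # ?z) X = signed (odd m \<and> odd (sum_list ms)) (brace f (?z @ [(odd m, \<xi>)]) X)"
    using brace_front[OF snoc.prems(1), of ?z "(odd m, \<xi>)" "[]" X] g
    unfolding wodd_zip_odd[OF len] by (simp del: brace.simps)
  finally have 1: "brace f ((odd m, \<xi>) # rev ?z) X = signed (odd ((\<Sum>j<length ms. (\<Sum>k<j. ms ! k) * ms ! j) + sum_list ms * m))
      (brace f (?z @ [(odd m, \<xi>)]) X)"
    by (simp del: brace.simps) (rule signed_cong, auto)
  have "(\<Sum>j<length ms. (\<Sum>k<j. (ms @ [m]) ! k) * (ms @ [m]) ! j) = (\<Sum>j<length ms. (\<Sum>k<j. ms ! k) * ms ! j)"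
    by (intro sum.cong refl arg_cong2[of _ _ _ _ "(*)"]) (simp_all add: nth_append)
  moreover have "(\<Sum>k<length ms. (ms @ [m]) ! k) = sum_list ms"
    unfolding sum_list_sum_nth atLeast0LessThan by (intro sum.cong refl) (simp add: nth_append)
  ultimately have 2: "(\<Sum>j<length (ms @ [m]). (\<Sum>k<j. (ms @ [m]) ! k) * (ms @ [m]) ! j)
     = (\<Sum>j<length ms. (\<Sum>k<j. ms ! k) * ms ! j) + sum_list ms * m"
    by (simp add: lessThan_Suc)
  show ?case unfolding z 2 rev_append using 1 by (simp del: brace.simps)
qed

text \<open>The Koszul sign \<open>?C\<close> of the tensor product is the sign of the unfolded
  brace with reversed letters, and the sign \<open>?E\<close> of the operation undoes the reversal;
  both cancel and only the power of \<open>lam\<close> remains.\<close>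

lemma higher_op_brace:
  assumes "hmap (int n) f" "list_all2 (\<lambda>m \<xi>. hmap (int m) \<xi>) ms \<xi>s" "length ms \<le> n + 1"
  shows "higher_op scale lam n f ms \<xi>s = (\<lambda>X. scale (lam ^ (length ms - 1)) (brace f (zip (map odd ms) \<xi>s) X))"
proof
  fix X
  let ?bs = "rev (map Suc ms) @ [n + 1 - length ms]"
  let ?E = "\<Sum>j<length ms. (\<Sum>k<j. ms ! k) * ms ! j" and ?C = "\<Sum>j<length ms. \<Sum>k<j. ms ! k * (ms ! j + 1)"
  let ?L = "lam ^ (length ms - 1)"
  let ?z = "zip (map odd ms) \<xi>s"
  have len: "length ms = length \<xi>s" using assms(2) by (rule list_all2_lengthD)
  have gz: "alt_word ?z" and z: "list_all2 (\<lambda>m x. hmap m (snd x)) (map int ms) ?z"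
    using assms(2) hmap_alt_map hmap_has_parity[of "int _"]
    by (auto simp: alt_word_def list_all2_conv_all_nth set_zip)
  have pow: "scale ((- 1) ^ k) x = signed (odd k) x" for k x
    using scale_sign_unit[of "odd k" x] unfolding sign_unit_power .
  have app: "higher_op scale lam n f ms \<xi>s X = (\<Sum>\<tau>\<in>Sh ?bs.
     scale ((- 1) ^ ?E * ?L) (scale (of_int (sign \<tau>)) (comp_tensor scale n f ms \<xi>s (permute_list \<tau> X))))"
    unfolding higher_op_def sum_apply fun_scale_def inv_action_def ..
  show "higher_op scale lam n f ms \<xi>s X = scale ?L (brace f ?z X)"
  proof (cases "length X = sum_list (map Suc ms) + (n + 1 - length ms)")
    case False
    have "int (length X) \<noteq> int n + sum_list (map int ms) + 1"
    proof -
      have "sum_list (map Suc ms) = sum_list ms + length ms" by (induction ms) auto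
      moreover have "sum_list (map int ms) = int (sum_list ms)" by (induction ms) auto
      ultimately show ?thesis using False assms(3) by linarith
    qed
    then have "brace f ?z X = 0"
      using hmap_brace[OF assms(1) z] has_degreeD unfolding hmap_def by blast
    then show ?thesis
      unfolding app using False by (simp add: comp_tensor_def)
  next
    case True
    have r: "sum_list (map Suc (rev ms)) = sum_list (map Suc ms)"
      by (metis rev_map sum_list_rev)
    have lX: "length X = sum_list ?bs"
      using True r by (simp add: rev_map)
    let ?H = "\<lambda>B. f (map2 (\<lambda>\<xi> a. \<xi> a) (rev \<xi>s) (butlast B) @ last B)"
    have "comp_tensor scale n f ms \<xi>s Y = signed (odd ?C) (?H (blocks ?bs Y))" if "length Y = length X" for Y
      using that True unfolding comp_tensor_def blocks_snoc
      by (simp add: pow rev_map r del: power_Suc)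
    then have "higher_op scale lam n f ms \<xi>s X = (\<Sum>\<tau>\<in>Sh ?bs. scale ?L (signed (odd ?E \<noteq> odd ?C)
        (signed (inv_odd (\<lambda>i. True) (perm_word \<tau> (length X))) (?H (blocks ?bs (permute_list \<tau> X))))))"
      unfolding app
      by (intro sum.cong refl)
        (simp add: scale_scale[symmetric] pow scale_sign[of _ "length X"] lX Sh_def scale_signed mult.commute[of _ ?L]
          del: scale_scale, rule signed_cong, auto)
    also have "\<dots> = scale ?L (signed (odd ?E \<noteq> odd ?C) (\<Sum>\<tau>\<in>Sh ?bs. signed (inv_odd (\<lambda>i. True) (perm_word \<tau> (length X))) (?H (blocks ?bs (permute_list \<tau> X)))))"
      by (simp add: scale_sum_right signed_def sum_negf)
    also have "(\<Sum>\<tau>\<in>Sh ?bs. signed (inv_odd (\<lambda>i. True) (perm_word \<tau> (length X))) (?H (blocks ?bs (permute_list \<tau> X))))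
      = unshuffles (\<lambda>_. True) ?bs ?H X"
      by (rule sum_Sh[OF lX])
    also have "unshuffles (\<lambda>_. True) ?bs ?H X = signed (odd ?C) (brace f (rev ?z) X)"
    proof -
      have "brace f (zip (map odd (rev ms)) (rev \<xi>s)) X = signed (koszul_parity (rev ms)) (unshuffles (\<lambda>_. True) (map Suc (rev ms) @ [n + 1 - length (rev ms)]) ?H X)"
        by (rule brace_unshuffles[OF assms(1)]) (use assms(2,3) True r in simp_all)
      moreover have "zip (map odd (rev ms)) (rev \<xi>s) = rev ?z"
        using len zip_rev[of "map odd ms" \<xi>s] by (simp add: rev_map)
      ultimately show ?thesis
        by (simp add: koszul_parity_rev rev_map)
    qed
    also have "brace f (rev ?z) X = signed (odd ?E) (brace f ?z X)"
      by (rule brace_rev[OF hmap_alt_map[OF assms(1)] len gz])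
    also have "signed (odd ?E \<noteq> odd ?C) (signed (odd ?C) (signed (odd ?E) (brace f ?z X))) = brace f ?z X"
      by (cases "odd ?E"; cases "odd ?C") (simp_all del: brace.simps)
    finally show ?thesis .
  qed
qed

end

section \<open>Grading of the total space; linearity, degree and symmetry of the operations on
  letters\<close>

context weighted_NR_structure
begin

abbreviation smult where "smult \<equiv> sM_A_scale scale"

lemma smult_simps [simp]: "fst (smult c x) = (\<lambda>X. scale c (fst x X))" "snd (smult c x) = (\<lambda>X. scale c (snd x X))"
  by (cases x; simp add: sM_A_scale_def prod_scale_def fun_scale_def)+

lemma sM_A_iff: "x \<in> sM_A scale d \<longleftrightarrow> hmap (d + 1) (fst x) \<and> hmap d (snd x)"
  by (cases x) (simp add: sM_A_def dsum_def shift_def Hom_ext_hmap)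

lemma vector_space_smult: "vector_space smult"
  by unfold_locales
    (auto intro!: prod_eqI ext simp: scale_right_distrib scale_left_distrib)

text \<open>Evaluation at a list of length d + k + 1 isolates \<open>h d\<close>, because maps of
  other degrees vanish there. The offset \<open>k\<close> is 1 for the shifted summand and 0 for
  A.\<close>

lemma has_degree_independent:
  assumes "finite D" "\<And>d. d \<in> D \<Longrightarrow> has_degree (d + k) (h d)" "(\<Sum>d\<in>D. h d) = 0" "d \<in> D"
  shows "h d = 0"
proof
  fix X
  show "h d X = 0 X"
  proof (cases "int (length X) = d + k + 1")
    case True
    have "0 = (\<Sum>d\<in>D. h d) X" using assms(3) by simp
    also have "\<dots> = (\<Sum>d\<in>D. h d X)" by (rule sum_apply)
    also have "\<dots> = (\<Sum>d\<in>{d}. h d X)"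
      using assms True by (intro sum.mono_neutral_right) (auto intro!: has_degreeD)
    finally show ?thesis by simp
  next
    case False
    then show ?thesis using assms(2)[OF assms(4)] by (auto intro!: has_degreeD)
  qed
qed

lemma graded_vector_space_smult: "graded_vector_space smult (sM_A scale)"
proof -
  interpret vs: vector_space smult by (rule vector_space_smult)
  show ?thesis
  proof
    show "vs.subspace (sM_A scale d)" for d
      using hmap_0 hmap_add hmap_scale
      by (auto simp: vs.subspace_def sM_A_iff plus_fun_def zero_fun_def)
  next
    fix D :: "int set" and x d
    assume D: "finite D" "\<And>d. d \<in> D \<Longrightarrow> x d \<in> sM_A scale d" "(\<Sum>d\<in>D. x d) = 0" "d \<in> D"
    have "(\<Sum>d\<in>D. fst (x d)) = 0" "(\<Sum>d\<in>D. snd (x d)) = 0"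
      using D(3) by (simp_all add: fst_sum[symmetric] snd_sum[symmetric])
    then show "x d = 0"
      using has_degree_independent[OF D(1), of 1 "\<lambda>d. fst (x d)" d]
        has_degree_independent[OF D(1), of 0 "\<lambda>d. snd (x d)" d] D(2,4)
      by (intro prod_eqI) (simp_all add: sM_A_iff hmap_def)
  qed
qed

definition alt_pair :: "('b list \<Rightarrow> 'b) \<times> ('b list \<Rightarrow> 'b) \<Rightarrow> bool" where
  "alt_pair x \<longleftrightarrow> alt_map (fst x) \<and> alt_map (snd x)"

text \<open>A sum of homogeneous elements has no degree, but it is still alternating, and this is
  what multilinearity on the total space rests on.\<close>

lemma total_alt_pair:
  assumes "x \<in> graded_vector_space.total smult (sM_A scale)"
  shows "alt_pair x"
proof -
  interpret gvs: graded_vector_space smult "sM_A scale" by (rule graded_vector_space_smult)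
  have "gvs.subspace {x. alt_pair x}"
    using alt_map_0 alt_map_add alt_map_scale
    by (auto simp: gvs.subspace_def alt_pair_def plus_fun_def)
  then have "gvs.total \<subseteq> {x. alt_pair x}"
    unfolding gvs.total_def by (intro gvs.span_minimal) (auto simp: alt_pair_def sM_A_iff hmap_def)
  then show ?thesis using assms by auto
qed

text \<open>Linearity of one component evaluated at one tuple of vectors, so that values lie in
  \<gg> and its sign and scalar lemmas apply.\<close>

definition lin_form :: "(('b list \<Rightarrow> 'b) \<times> ('b list \<Rightarrow> 'b) \<Rightarrow> 'b) \<Rightarrow> bool" where
  "lin_form T \<longleftrightarrow> (\<forall>x y. T (x + y) = T x + T y) \<and> (\<forall>c x. T (smult c x) = scale c (T x))"

lemma lin_formD: "lin_form T \<Longrightarrow> T (x + y) = T x + T y" "lin_form T \<Longrightarrow> T (smult c x) = scale c (T x)"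
  unfolding lin_form_def by blast+

lemma lin_form_add: "lin_form T \<Longrightarrow> lin_form T' \<Longrightarrow> lin_form (\<lambda>x. T x + T' x)"
  unfolding lin_form_def by (simp add: scale_right_distrib)

lemma lin_form_signed: "lin_form T \<Longrightarrow> lin_form (\<lambda>x. signed c (T x))"
  unfolding lin_form_def by (simp add: signed_add scale_signed)

lemma lin_form_0: "lin_form (\<lambda>x. 0)"
  unfolding lin_form_def by simp

lemma pull_lin_form_const:
  assumes "\<And>y b. y \<in> set w \<Longrightarrow> set b \<subseteq> set w \<Longrightarrow> lin_form (\<lambda>x. G x y b)"
  shows "lin_form (\<lambda>x. pull fst (G x) w)"
  using assms
proof (induction w arbitrary: G)
  case (Cons z w)
  have "lin_form (\<lambda>x. pull fst (\<lambda>y b. signed (fst z \<and> fst y) (G x y (z # b))) w)"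
    by (rule Cons.IH, rule lin_form_signed, rule Cons.prems) auto
  moreover have "lin_form (\<lambda>x. G x z w)"
    by (rule Cons.prems) auto
  ultimately show ?case by (simp add: lin_form_add)
qed (simp add: lin_form_0)

text \<open>The varying letter is either the one pulled out or one of those staying behind; the two
  hypotheses on \<open>G\<close> cover these cases.\<close>

lemma pull_lin_form:
  assumes "\<And>b. Ball (set b) P \<Longrightarrow> lin_form (\<lambda>x. G (p, x) b)"
    and "\<And>y u v. P y \<Longrightarrow> Ball (set u) P \<Longrightarrow> Ball (set v) P \<Longrightarrow> lin_form (\<lambda>x. G y (u @ (p, x) # v))"
    and "Ball (set u) P" "Ball (set v) P"
  shows "lin_form (\<lambda>x. pull fst G (u @ (p, x) # v))"
  using assms
proof (induction u arbitrary: G)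
  case Nil
  have "lin_form (\<lambda>x. pull fst (\<lambda>y w'. signed (p \<and> fst y) (G y ((p, x) # w'))) v)"
    by (rule pull_lin_form_const, rule lin_form_signed, rule Nil(2)[of _ "[]", simplified]) (use Nil(4) in auto)
  then show ?case using Nil(1,4) by (simp add: lin_form_add)
next
  case (Cons z u)
  have "lin_form (\<lambda>x. pull fst (\<lambda>y w'. signed (fst z \<and> fst y) (G y (z # w'))) (u @ (p, x) # v))"
  proof (rule Cons.IH)
    show "lin_form (\<lambda>x. signed (fst z \<and> fst (p, x)) (G (p, x) (z # b)))" if "Ball (set b) P" for b
      using lin_form_signed[OF Cons.prems(1)[of "z # b"], of "fst z \<and> p"] that Cons.prems(3) by simp
    show "lin_form (\<lambda>x. signed (fst z \<and> fst y) (G y (z # u @ (p, x) # v)))"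
      if "P y" "Ball (set u) P" "Ball (set v) P" for y u v
      using lin_form_signed[OF Cons.prems(2)[of y "z # u" v], of "fst z \<and> fst y"] that Cons.prems(3) by simp
  qed (use Cons.prems in auto)
  moreover have "lin_form (\<lambda>x. G z (u @ (p, x) # v))"
    using Cons.prems by auto
  ultimately show ?case by (simp add: lin_form_add)
qed

lemma act_lin_map_fun:
  assumes "alt_word \<Xi>"
  shows "lin_form (\<lambda>x. act lam p (fst x) \<Xi> X)"
  unfolding lin_form_def
proof (intro conjI allI)
  have h: "alt_map (snd (hd \<Xi>))" if "length \<Xi> = 1"
    using that assms by (cases \<Xi>) auto
  show "act lam p (fst (x + y)) \<Xi> X = act lam p (fst x) \<Xi> X + act lam p (fst y) \<Xi> X" for x y
    using h by (simp add: act_def plus_fun_def brace_add plug_add_right signed_add scale_right_distrib)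
  show "act lam p (fst (smult c x)) \<Xi> X = scale c (act lam p (fst x) \<Xi> X)" for c x
    using h by (simp add: act_def brace_hom[of "scale c"] plug_scale_right scale_signed scale_right_distrib
        scale_right_diff_distrib mult.commute)
qed

lemma act_lin_map_slot:
  assumes "alt_map f"
  shows "lin_form (\<lambda>x. act lam p f (map A_letter (u @ (q, x) # v)) X)"
  unfolding lin_form_def
proof (intro conjI allI)
  show "act lam p f (map A_letter (u @ (q, x + y) # v)) X
    = act lam p f (map A_letter (u @ (q, x) # v)) X + act lam p f (map A_letter (u @ (q, y) # v)) X" for x y
    using brace_slot_add[OF assms, of "map A_letter u" q "snd x" "snd y" "map A_letter v" X]
    by (cases u; cases v) (simp_all add: act_def A_letter_def plus_fun_def plug_add_left signed_add scale_right_distrib del: brace.simps)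
  show "act lam p f (map A_letter (u @ (q, smult c x) # v)) X = scale c (act lam p f (map A_letter (u @ (q, x) # v)) X)" for c x
    using brace_slot_scale[OF assms, of "map A_letter u" q c "snd x" "map A_letter v" X]
    by (cases u; cases v) (simp_all add: act_def A_letter_def plug_scale_left scale_signed scale_right_diff_distrib mult.commute del: brace.simps)
qed

lemma lin_form_op_A:
  assumes "Ball (set u) proper" "Ball (set v) proper"
  shows "lin_form (\<lambda>x. op_A (u @ (p, x) # v) X)"
  unfolding op_A_def
proof (rule pull_lin_form[where P = proper])
  show "lin_form (\<lambda>x. act lam (\<not> fst (p, x)) (M_part (p, x)) (map A_letter b) X)" if "Ball (set b) proper" for b
    using act_lin_map_fun[OF alt_word_A_letter, of b "\<not> p" X] that by simp
  show "lin_form (\<lambda>x. act lam (\<not> fst y) (M_part y) (map A_letter (u @ (p, x) # v)) X)"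
    if "proper y" for y u v
    using that by (intro act_lin_map_slot) (simp add: proper_def)
qed (use assms in auto)

lemma bracket_linear:
  assumes "alt_map f"
  shows "bracket p (\<lambda>X. g X + h X) q f X = bracket p g q f X + bracket p h q f X"
    "bracket p f q (\<lambda>X. g X + h X) X = bracket p f q g X + bracket p f q h X"
    "bracket p (\<lambda>X. scale c (g X)) q f X = scale c (bracket p g q f X)"
    "bracket p f q (\<lambda>X. scale c (g X)) X = scale c (bracket p f q g X)"
  using assms by (simp_all add: bracket_def plug_add_left plug_add_right plug_scale_left plug_scale_right signed_add scale_right_diff_distrib scale_signed)

lemma lin_form_op_M:
  assumes "Ball (set u) proper" "Ball (set v) proper"
  shows "lin_form (\<lambda>x. op_M (u @ (p, x) # v) X)"
proof -
  have 0: "op_M w X = 0" if "length w \<noteq> 2" for w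
    using that by (auto simp: op_M_def split: list.splits)
  show ?thesis
  proof (cases "length (u @ v) = 1")
    case False
    then show ?thesis by (simp add: 0 lin_form_0)
  next
    case True
    then consider y where "u = [y]" "v = []" | y where "u = []" "v = [y]"
      by (cases u; cases v) auto
    then show ?thesis
    proof cases
      case 1
      then have "alt_map (M_part y)" using assms by (simp add: proper_def)
      then show ?thesis
        unfolding 1 lin_form_def by (simp add: op_M_def plus_fun_def bracket_linear signed_add scale_signed)
    next
      case 2
      then have "alt_map (M_part y)" using assms by (simp add: proper_def)
      then show ?thesis
        unfolding 2 lin_form_def by (simp add: op_M_def plus_fun_def bracket_linear signed_add scale_signed)
    qed
  qed
qed

lemma op_lin_map:
  assumes "Ball (set u) proper" "Ball (set v) proper"
  shows "op (u @ (p, x + y) # v) = op (u @ (p, x) # v) + op (u @ (p, y) # v)"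
    and "op (u @ (p, smult c x) # v) = smult c (op (u @ (p, x) # v))"
  unfolding op_def using lin_formD[OF lin_form_op_M[OF assms]] lin_formD[OF lin_form_op_A[OF assms]]
  by (intro prod_eqI ext; simp)+

lemma op_zero:
  assumes "Ball (set u) proper" "Ball (set v) proper"
  shows "op (u @ (p, 0) # v) = 0"
  using op_lin_map(1)[OF assms, of p 0 0] by simp

definition hom_letter :: "int \<Rightarrow> 'b letter \<Rightarrow> bool" where
  "hom_letter d z \<longleftrightarrow> fst z = odd d \<and> snd z \<in> sM_A scale d"

lemma hom_letter_proper: "hom_letter d z \<Longrightarrow> proper z"
  using hmap_has_parity[of "d + 1"] hmap_has_parity[of d] hmap_alt_map by (auto simp: hom_letter_def proper_def sM_A_iff)

text \<open>Serves for degrees: each summand distributes the same total degree over the pulled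
  letter and the rest.\<close>

lemma pull_closed:
  fixes ds :: "int list"
  assumes "list_all2 Q ds w"
    and "\<And>y b d ds'. Q d y \<Longrightarrow> list_all2 Q ds' b \<Longrightarrow> d + sum_list ds' = sum_list ds \<Longrightarrow> P (G y b)"
    and "P 0" "\<And>x y. P x \<Longrightarrow> P y \<Longrightarrow> P (x + y)" "\<And>c x. P x \<Longrightarrow> P (signed c x)"
  shows "P (pull e G w)"
  using assms(1,2)
proof (induction ds w arbitrary: G)
  case (Cons d ds z w)
  have "P (pull e (\<lambda>y b. signed (e z \<and> e y) (G y (z # b))) w)"
  proof (rule Cons.IH, rule assms(5))
    fix y b d' ds' assume *: "Q d' y" "list_all2 Q ds' b" "d' + sum_list ds' = sum_list ds"
    show "P (G y (z # b))"
      by (rule Cons.prems[of d' y "d # ds'"]) (use *(1,2) Cons.hyps in \<open>simp_all add: *(3)[symmetric] add.left_commute\<close>)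
  qed
  moreover have "P (G z w)" by (rule Cons.prems[of d z ds]) (use Cons.hyps in auto)
  ultimately show ?case by (simp add: assms(4))
qed (simp add: assms(3))

lemma hmap_op_A:
  assumes "list_all2 hom_letter ds w"
  shows "hmap (sum_list ds + 1) (op_A w)"
proof -
  have e: "op_A w = pull fst (\<lambda>x w'. act lam (\<not> fst x) (M_part x) (map A_letter w')) w"
    using pull_hom[of "\<lambda>f. f _" fst "\<lambda>x w'. act lam (\<not> fst x) (M_part x) (map A_letter w')" w]
    by (auto simp: op_A_def fun_eq_iff)
  show ?thesis
    unfolding e
  proof (rule pull_closed[OF assms, where P = "hmap (sum_list ds + 1)"])
    fix y b d ds' assume *: "hom_letter d y" "list_all2 hom_letter ds' b" "d + sum_list ds' = sum_list ds"
    have "list_all2 (\<lambda>m x. hmap m (snd x)) ds' (map A_letter b)"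
      unfolding list_all2_map2 using *(2) by (rule list_all2_mono) (simp add: hom_letter_def sM_A_iff)
    then have "hmap (d + 1 + sum_list ds') (act lam (\<not> fst y) (M_part y) (map A_letter b))"
      using *(1) by (intro hmap_act[of "d + 1"]) (simp_all add: hom_letter_def sM_A_iff)
    moreover have "d + 1 + sum_list ds' = sum_list ds + 1" using *(3) by simp
    ultimately show "hmap (sum_list ds + 1) (act lam (\<not> fst y) (M_part y) (map A_letter b))" by simp
  qed (use hmap_0 hmap_add hmap_signed in \<open>auto simp: plus_fun_def signed_fun[abs_def]\<close>)
qed

lemma hmap_bracket: "hmap n f \<Longrightarrow> hmap m g \<Longrightarrow> hmap (n + m) (bracket p f q g)"
  unfolding bracket_def using hmap_plug[of n f m g] hmap_plug[of m g n f]
  by (intro hmap_diff hmap_signed) (simp_all add: add.commute)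

lemma hmap_op_M:
  assumes "list_all2 hom_letter ds w"
  shows "hmap (sum_list ds + 2) (op_M w)"
proof (cases "length w = 2")
  case False
  then have "op_M w = (\<lambda>X. 0)" by (auto simp: op_M_def fun_eq_iff split: list.splits)
  then show ?thesis using hmap_0 by simp
next
  case True
  then obtain x y where w: "w = [x, y]" by (auto simp: numeral_2_eq_2 length_Suc_conv)
  then obtain d e where ds: "ds = [d, e]" "hom_letter d x" "hom_letter e y"
    using assms by (auto simp: list_all2_Cons2)
  have "op_M w = (\<lambda>X. signed (\<not> fst x) (bracket (\<not> fst x) (M_part x) (\<not> fst y) (M_part y) X))"
    by (simp add: op_M_def w fun_eq_iff)
  moreover have "hmap ((d + 1) + (e + 1)) (bracket (\<not> fst x) (M_part x) (\<not> fst y) (M_part y))"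
    using ds by (intro hmap_bracket) (simp_all add: hom_letter_def sM_A_iff)
  moreover have "(d + 1) + (e + 1) = sum_list ds + 2" using ds by simp
  ultimately show ?thesis using hmap_signed by simp
qed

lemma op_degree: "list_all2 hom_letter ds w \<Longrightarrow> op w \<in> sM_A scale (sum_list ds + 1)"
  using hmap_op_A hmap_op_M[of ds w] by (simp add: op_def sM_A_iff add.assoc)

text \<open>Braces are symmetric in proper letters, whereas \<open>gsym\<close> quantifies over all
  words; hence the extension by 0. Written as an unshuffle with one-letter first part,
  \<open>op_A\<close> inherits symmetry from \<open>unshuffle_gsym\<close>.\<close>

lemma gsym_op_A: "gsym fst (\<lambda>w. if Ball (set w) proper then op_A w X else 0)"
proof -
  define G where "G z b = (if proper z \<and> Ball (set b) proper then act lam (\<not> fst z) (M_part z) (map A_letter b) X else 0)" for z b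
  have G: "gsym fst (G z)" for z
    unfolding gsym_def
  proof (intro allI)
    fix u x y v
    show "G z (u @ x # y # v) = signed (fst x \<and> fst y) (G z (u @ y # x # v))"
    proof (cases "proper z \<and> Ball (set (u @ x # y # v)) proper")
      case True
      then have g: "alt_map (M_part z)" "alt_word (map A_letter (u @ x # y # v))"
        by (simp add: proper_def) (use True in \<open>intro alt_word_A_letter, auto\<close>)
      have "brace (M_part z) (map A_letter (u @ x # y # v)) X = signed (fst x \<and> fst y) (brace (M_part z) (map A_letter (u @ y # x # v)) X)"
        using brace_swap[OF g(1), of "map A_letter u" "A_letter x" "A_letter y" "map A_letter v" X] g(2) by (simp del: brace.simps)
      then have "act lam (\<not> fst z) (M_part z) (map A_letter (u @ x # y # v)) X
        = signed (fst x \<and> fst y) (act lam (\<not> fst z) (M_part z) (map A_letter (u @ y # x # v)) X)"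
        unfolding act_def by (simp add: scale_signed del: brace.simps)
      then show ?thesis using True by (auto simp: G_def)
    next
      case False
      have "G z (u @ x # y # v) = 0" unfolding G_def using False by (rule if_not_P)
      moreover have "\<not> (proper z \<and> Ball (set (u @ y # x # v)) proper)" using False by auto
      then have "G z (u @ y # x # v) = 0" unfolding G_def by (rule if_not_P)
      ultimately show ?thesis by simp
    qed
  qed
  let ?F = "\<lambda>a b. if length a = 1 then G (hd a) b else 0"
  have "gsym fst (unshuffle fst ?F)"
  proof (rule unshuffle_gsym)
    show "gsym fst (\<lambda>a. ?F a b)" for b
      unfolding gsym_def by simp
    show "gsym fst (?F a)" for a
      using G by (cases "length a = 1") (simp_all, simp add: gsym_def)
  qed
  moreover have "unshuffle fst ?F = (\<lambda>w. if Ball (set w) proper then op_A w X else 0)"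
  proof
    fix w
    show "unshuffle fst ?F w = (if Ball (set w) proper then op_A w X else 0)"
    proof (cases "Ball (set w) proper")
      case True
      have "pull fst G w = op_A w X"
        unfolding op_A_def by (rule pull_cong) (use True in \<open>auto simp: G_def\<close>)
      then show ?thesis unfolding pull_unshuffle using True by simp
    next
      case False
      have "unshuffle fst ?F w = 0"
      proof (rule unshuffle_zero)
        fix a b assume s: "set a \<union> set b = set w"
        show "?F a b = 0"
        proof (cases "length a = 1")
          case True
          then obtain x where "a = [x]" by (auto simp: length_Suc_conv)
          then have "\<not> (proper x \<and> Ball (set b) proper)" using False s by auto
          then show ?thesis using \<open>a = [x]\<close> by (simp only: G_def) auto
        qed simp
      qed
      then show ?thesis using False by auto
    qed
  qed
  ultimately show ?thesis by (simp only:)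
qed

text \<open>With p, q the parities of the unshifted maps, (-1)^p [f, g] = (-1)^((p+1)(q+1)) (-1)^q
  [g, f]: the shift turns graded antisymmetry into graded symmetry.\<close>

lemma gsym_op_M: "gsym fst (\<lambda>w. op_M w X)"
  unfolding gsym_def
proof (intro allI)
  fix u v and x y :: "'b letter"
  show "op_M (u @ x # y # v) X = signed (fst x \<and> fst y) (op_M (u @ y # x # v) X)"
  proof (cases "u = [] \<and> v = []")
    case True
    then show ?thesis
      by (cases "fst x"; cases "fst y") (simp_all add: op_M_def bracket_def)
  next
    case False
    have 0: "op_M w X = 0" if "length w \<noteq> 2" for w
      using that by (auto simp: op_M_def split: list.splits)
    show ?thesis using False by (subst (1 2) 0) auto
  qed
qed

lemma op_permute:
  assumes "Ball (set w) proper" "\<sigma> permutes {..<length w}"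
  shows "op w = smult (sign_unit (inv_odd (\<lambda>i. fst (w ! i)) (perm_word \<sigma> (length w)))) (op (permute_list \<sigma> w))"
proof -
  have s: "set (permute_list \<sigma> w) = set w"
    using set_permute_list[OF assms(2)] .
  have "op_M w X = signed (inv_odd (\<lambda>i. fst (w ! i)) (perm_word \<sigma> (length w))) (op_M (permute_list \<sigma> w) X)" for X
    by (rule gsym_permute[OF gsym_op_M assms(2)])
  moreover have "op_A w X = signed (inv_odd (\<lambda>i. fst (w ! i)) (perm_word \<sigma> (length w))) (op_A (permute_list \<sigma> w) X)" for X
    using gsym_permute[OF gsym_op_A assms(2), of X] assms(1) unfolding s by simp
  ultimately show ?thesis
    unfolding op_def by (intro prod_eqI ext) (simp_all add: scale_sign_unit)
qed

lemma op_Jacobi: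
  assumes "Ball (set w) proper"
  shows "unshuffle fst (\<lambda>a b. op ((\<not> wodd fst a, op a) # b)) w = 0"
proof -
  have "fst (unshuffle fst (\<lambda>a b. op ((\<not> wodd fst a, op a) # b)) w) X = unshuffle fst (\<lambda>a b. op_M ((\<not> wodd fst a, op a) # b) X) w" for X
    by (subst unshuffle_hom[of "\<lambda>z. fst z X"]) (simp_all add: op_def[of "_ # _"])
  moreover have "snd (unshuffle fst (\<lambda>a b. op ((\<not> wodd fst a, op a) # b)) w) X = unshuffle fst (\<lambda>a b. op_A ((\<not> wodd fst a, op a) # b) X) w" for X
    by (subst unshuffle_hom[of "\<lambda>z. snd z X"]) (simp_all add: op_def[of "_ # _"])
  ultimately show ?thesis
    using M_Jacobi[OF assms] A_Jacobi[OF assms] by (intro prod_eqI ext) simp_all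
qed

end

lemma unshuffle_sum: "unshuffle d (\<lambda>a b. \<Sum>i\<in>A. F i a b) w = (\<Sum>i\<in>A. unshuffle d (F i) w)"
  by (induction A rule: infinite_finite_induct) (simp_all add: unshuffle_add)

lemma wodd_cong: "(\<And>y. y \<in> set L \<Longrightarrow> d y = d' y) \<Longrightarrow> wodd d L = wodd d' L"
  by (induction L) auto

lemma inv_odd_cong: "(\<And>i. i \<in> set L \<Longrightarrow> e i = e' i) \<Longrightarrow> inv_odd e L = inv_odd e' L"
proof (induction L)
  case (Cons x L)
  have "wodd (\<lambda>y. y < x \<and> e x \<and> e y) L = wodd (\<lambda>y. y < x \<and> e' x \<and> e' y) L"
    by (rule wodd_cong) (use Cons.prems in auto)
  then show ?case using Cons by simp
qed simp

lemma list_all2_Ball: "list_all2 P ds xs \<Longrightarrow> (\<And>d x. P d x \<Longrightarrow> Q x) \<Longrightarrow> Ball (set xs) Q"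
  by (induction rule: list_all2_induct) auto

lemma map2_update:
  "i < length ps \<Longrightarrow> length ps = length xs \<Longrightarrow>
    map2 h ps (xs[i := z]) = take i (map2 h ps xs) @ h (ps ! i) z # drop (Suc i) (map2 h ps xs)"
  by (subst upd_conv_take_nth_drop[symmetric]) (auto intro!: nth_equalityI simp: nth_list_update)

context weighted_NR_structure
begin

section \<open>The \<open>L\<^sub>\<infinity>[1]\<close>-structure\<close>

text \<open>Elements of the total space need not be homogeneous. Since all signs depend on the parities of the
  degrees only, it suffices to sum over the even and odd parts of the arguments.\<close>

definition parity_part :: "bool \<Rightarrow> ('b list \<Rightarrow> 'b) \<Rightarrow> 'b list \<Rightarrow> 'b" where
  "parity_part p f = (\<lambda>X. if odd (length X) = p then 0 else f X)"

definition letter :: "bool \<Rightarrow> ('b list \<Rightarrow> 'b) \<times> ('b list \<Rightarrow> 'b) \<Rightarrow> 'b letter" where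
  "letter p x = (p, parity_part (\<not> p) (fst x), parity_part p (snd x))"

definition linf_op :: "nat \<Rightarrow> (('b list \<Rightarrow> 'b) \<times> ('b list \<Rightarrow> 'b)) list \<Rightarrow> ('b list \<Rightarrow> 'b) \<times> ('b list \<Rightarrow> 'b)" where
  "linf_op n xs = (\<Sum>ps | length ps = n. op (map2 letter ps xs))"

lemma alt_map_parity_part: "alt_map f \<Longrightarrow> alt_map (parity_part p f)"
proof -
  assume f: "alt_map f"
  have "lin_map (\<lambda>x. parity_part p f (u @ x # v))" for u v
    using alt_mapD_lin_map[OF f, of u v] by (cases "odd (length (u @ 0 # v)) = p") (simp_all add: parity_part_def lin_map_def)
  moreover have "parity_part p f (u @ x # y # v) = signed (True \<and> True) (parity_part p f (u @ y # x # v))" for u v x y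
    using gsymD[OF alt_mapD_gsym[OF f], of u x y v] by (auto simp: parity_part_def)
  ultimately show ?thesis unfolding alt_map_def gsym_def by blast
qed

lemma has_parity_parity_part: "has_parity p (parity_part p f)"
  by (simp add: has_parity_def parity_part_def)

lemma proper_letter: "alt_pair x \<Longrightarrow> proper (letter p x)"
  using alt_map_parity_part has_parity_parity_part[of "\<not> p"] has_parity_parity_part[of p] by (simp add: proper_def alt_pair_def letter_def)

lemma letter_lin_map:
  "letter p (x + y) = (p, snd (letter p x) + snd (letter p y))"
  "letter p (smult c x) = (p, smult c (snd (letter p x)))"
  by (auto simp: letter_def parity_part_def plus_fun_def intro!: prod_eqI ext)

lemma op_letter:
  assumes "Ball (set u) proper" "Ball (set v) proper"
  shows "op (u @ letter p (x + y) # v) = op (u @ letter p x # v) + op (u @ letter p y # v)"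
    and "op (u @ letter p (smult c x) # v) = smult c (op (u @ letter p x # v))"
proof -
  have e: "(p, snd (letter p z)) = letter p z" for z by (simp add: letter_def)
  show "op (u @ letter p (x + y) # v) = op (u @ letter p x # v) + op (u @ letter p y # v)"
    using op_lin_map(1)[OF assms, of p "snd (letter p x)" "snd (letter p y)"] unfolding letter_lin_map e .
  show "op (u @ letter p (smult c x) # v) = smult c (op (u @ letter p x # v))"
    using op_lin_map(2)[OF assms, of p c "snd (letter p x)"] unfolding letter_lin_map e .
qed

lemma parity_part_id: "has_parity p f \<Longrightarrow> parity_part p f = f"
  by (auto simp: parity_part_def has_parity_def fun_eq_iff)

lemma parity_part_0: "has_parity (\<not> p) f \<Longrightarrow> parity_part p f = 0"
  by (auto simp: parity_part_def has_parity_def fun_eq_iff)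

lemma letter_homogeneous:
  assumes "x \<in> sM_A scale d"
  shows "letter (odd d) x = (odd d, x)" "p \<noteq> odd d \<Longrightarrow> letter p x = (p, 0)"
proof -
  have "has_parity (\<not> odd d) (fst x)" "has_parity (odd d) (snd x)"
    using assms hmap_has_parity[of "d + 1" "fst x"] hmap_has_parity[of d "snd x"] by (auto simp: sM_A_iff)
  then show "letter (odd d) x = (odd d, x)" "p \<noteq> odd d \<Longrightarrow> letter p x = (p, 0)"
    using parity_part_id[of "\<not> odd d"] parity_part_id[of "odd d"] parity_part_0[of "\<not> p"] parity_part_0[of p]
    by (auto simp: letter_def zero_prod_def)
qed

lemma sM_A_alt_pair: "x \<in> sM_A scale d \<Longrightarrow> alt_pair x"
  by (simp add: alt_pair_def sM_A_iff hmap_def)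

lemma proper_map2: "Ball (set xs) alt_pair \<Longrightarrow> Ball (set (map2 letter ps xs)) proper"
  by (auto dest!: set_zip_rightD intro: proper_letter)

lemma proper_take_drop:
  "Ball (set W) proper \<Longrightarrow> Ball (set (take i W)) proper"
  "Ball (set W) proper \<Longrightarrow> Ball (set (drop i W)) proper"
  by (auto dest: in_set_takeD in_set_dropD)

lemma linf_op_zero: "(\<And>ps. length ps = n \<Longrightarrow> op (map2 letter ps xs) = 0) \<Longrightarrow> linf_op n xs = 0"
  unfolding linf_op_def by (rule sum.neutral) auto

lemma finite_parities: "finite {ps :: bool list. length ps = n}"
  using finite_lists_length_eq[of "UNIV :: bool set" n] by simp

text \<open>Only the parities of the actual degrees survive in the sum, as any other choice replaces
  some argument by 0.\<close>

lemma linf_op_homogeneous: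
  assumes "list_all2 (\<lambda>d x. x \<in> sM_A scale d) ds xs"
  shows "linf_op (length xs) xs = op (map2 (\<lambda>d x. (odd d, x)) ds xs)"
proof -
  let ?P = "{ps. length ps = length xs}"
  have len: "length ds = length xs" using assms by (rule list_all2_lengthD)
  have g: "Ball (set xs) alt_pair"
    using assms sM_A_alt_pair by (rule list_all2_Ball)
  have "op (map2 letter ps xs) = 0" if ps: "length ps = length xs" "ps \<noteq> map odd ds" for ps
  proof -
    obtain i where i: "i < length xs" "ps ! i \<noteq> odd (ds ! i)"
      using ps len by (auto simp: list_eq_iff_nth_eq)
    let ?W = "map2 letter ps xs"
    have "xs ! i \<in> sM_A scale (ds ! i)" using assms i by (simp add: list_all2_conv_all_nth)
    then have "?W ! i = (ps ! i, 0)"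
      using i ps letter_homogeneous(2) by simp
    then have "?W = take i ?W @ (ps ! i, 0) # drop (Suc i) ?W"
      using i ps id_take_nth_drop[of i ?W] by simp
    moreover have "op (take i ?W @ (ps ! i, 0) # drop (Suc i) ?W) = 0"
      by (intro op_zero proper_take_drop proper_map2 g)
    ultimately show ?thesis by simp
  qed
  then have "linf_op (length xs) xs = (\<Sum>ps\<in>{map odd ds}. op (map2 letter ps xs))"
    unfolding linf_op_def using len finite_parities by (intro sum.mono_neutral_right) auto
  also have "\<dots> = op (map2 letter (map odd ds) xs)"
    by simp
  also have "map2 letter (map odd ds) xs = map2 (\<lambda>d x. (odd d, x)) ds xs"
    using assms letter_homogeneous(1) by (intro nth_equalityI) (auto simp: list_all2_conv_all_nth)
  finally show ?thesis .
qed

lemma hom_letter_map2: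
  "list_all2 (\<lambda>d x. x \<in> sM_A scale d) ds xs \<Longrightarrow> list_all2 hom_letter ds (map2 (\<lambda>d x. (odd d, x)) ds xs)"
  by (simp add: list_all2_conv_all_nth hom_letter_def)

lemma wodd_map2: "length ds = length xs \<Longrightarrow> wodd fst (map2 (\<lambda>d x. (odd d, x)) ds xs) = odd (sum_list (ds :: int list))"
  by (induction ds xs rule: list_induct2) auto

lemma hom_letter_all_proper: "list_all2 hom_letter ds w \<Longrightarrow> Ball (set w) proper"
  by (erule list_all2_Ball) (rule hom_letter_proper)

lemma smult_sign_unit: "smult (sign_unit c) z = signed c z"
  by (cases c) (auto intro!: prod_eqI ext)

text \<open>All axioms on the operations except multilinearity concern homogeneous arguments, where
  \<open>linf_op\<close> is \<open>op\<close> on letters tagged with the parities of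
  \<open>ds\<close>, and the results on \<open>op\<close> apply.\<close>

lemma L_infinity: "L_infinity_1_algebra smult (sM_A scale) linf_op"
proof -
  interpret gvs: graded_vector_space smult "sM_A scale" by (rule graded_vector_space_smult)
  let ?hl = "\<lambda>d x. (odd d, x) :: 'b letter"
  have perm: "list_all2 (\<lambda>d x. x \<in> sM_A scale d) (permute_list \<sigma> ds) (permute_list \<sigma> xs)"
    "map2 ?hl (permute_list \<sigma> ds) (permute_list \<sigma> xs) = permute_list \<sigma> (map2 ?hl ds xs)"
    "(koszul_sign ds \<sigma> :: 'k) = sign_unit (inv_odd (\<lambda>i. fst (map2 ?hl ds xs ! i)) (perm_word \<sigma> (length xs)))"
    if "list_all2 (\<lambda>d x. x \<in> sM_A scale d) ds xs" "\<sigma> permutes {..<length xs}" for \<sigma> ds xs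
  proof -
    have len: "length ds = length xs" using that by (simp add: list_all2_lengthD)
    note p = that(2)
    have p': "\<sigma> permutes {..<length ds}" using p len by simp
    have b: "\<sigma> i < length xs" if "i < length xs" for i
      using permutes_in_image[OF p, of i] that by simp
    show "list_all2 (\<lambda>d x. x \<in> sM_A scale d) (permute_list \<sigma> ds) (permute_list \<sigma> xs)"
      using that(1) len b by (simp add: list_all2_conv_all_nth permute_list_nth[OF p] permute_list_nth[OF p'])
    show "map2 ?hl (permute_list \<sigma> ds) (permute_list \<sigma> xs) = permute_list \<sigma> (map2 ?hl ds xs)"
      using len b p by (intro nth_equalityI) (simp_all add: permute_list_nth p')
    have "inv_odd (\<lambda>i. odd (ds ! i)) (perm_word \<sigma> (length xs)) = inv_odd (\<lambda>i. fst (map2 ?hl ds xs ! i)) (perm_word \<sigma> (length xs))"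
      by (rule inv_odd_cong) (simp add: perm_word_props(2)[OF p] len)
    then show "(koszul_sign ds \<sigma> :: 'k) = sign_unit (inv_odd (\<lambda>i. fst (map2 ?hl ds xs ! i)) (perm_word \<sigma> (length xs)))"
      using koszul_sign_inv_odd[OF p'] len by simp
  qed
  show ?thesis
  proof
    fix n :: nat assume "n \<ge> 1"
    have "linf_op n (xs[i := x + y]) = linf_op n (xs[i := x]) + linf_op n (xs[i := y])"
      "linf_op n (xs[i := smult c x]) = smult c (linf_op n (xs[i := x]))"
      if xs: "length xs = n" "set xs \<subseteq> gvs.total" "i < n" for xs i x y c
    proof -
      have g: "Ball (set xs) alt_pair" using xs total_alt_pair by auto
      have e: "linf_op n (xs[i := z]) = (\<Sum>ps | length ps = n. op (take i (map2 letter ps xs) @ letter (ps ! i) z # drop (Suc i) (map2 letter ps xs)))" for z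
        unfolding linf_op_def using xs by (intro sum.cong refl) (simp add: map2_update)
      show "linf_op n (xs[i := x + y]) = linf_op n (xs[i := x]) + linf_op n (xs[i := y])"
        unfolding e sum.distrib[symmetric]
        by (intro sum.cong refl op_letter proper_take_drop proper_map2 g)
      show "linf_op n (xs[i := smult c x]) = smult c (linf_op n (xs[i := x]))"
        unfolding e gvs.scale_sum_right
        by (intro sum.cong refl op_letter proper_take_drop proper_map2 g)
    qed
    then show "multilinear_on smult smult gvs.total n (linf_op n)"
      unfolding multilinear_on_def by blast
  next
    fix n xs ds assume *: "n \<ge> 1" "length xs = n" "gvs.homogeneous ds xs"
    then show "linf_op n xs \<in> sM_A scale (sum_list ds + 1)"
      using linf_op_homogeneous[of ds xs] op_degree[OF hom_letter_map2[of ds xs]]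
      by (simp add: gvs.homogeneous_def)
  next
    fix n xs ds \<sigma> assume *: "n \<ge> 1" "length xs = n" "gvs.homogeneous ds xs" "\<sigma> permutes {..<n}"
    then have h: "list_all2 (\<lambda>d x. x \<in> sM_A scale d) ds xs" and p: "\<sigma> permutes {..<length xs}"
      by (simp_all add: gvs.homogeneous_def)
    have len: "length ds = length xs" using h by (rule list_all2_lengthD)
    show "linf_op n xs = smult (koszul_sign ds \<sigma>) (linf_op n (permute_list \<sigma> xs))"
      using op_permute[OF hom_letter_all_proper[OF hom_letter_map2[OF h]], of \<sigma>] p len
        linf_op_homogeneous[OF h] linf_op_homogeneous[OF perm(1)[OF h p]]
      unfolding perm(2,3)[OF h p] *(2)[symmetric] by simp
  next
    fix n xs ds assume *: "n \<ge> 1" "length xs = n" "gvs.homogeneous ds xs"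
    then have h: "list_all2 (\<lambda>d x. x \<in> sM_A scale d) ds xs"
      by (simp add: gvs.homogeneous_def)
    have len: "length ds = n" using h *(2) by (simp add: list_all2_lengthD)
    let ?w = "map2 ?hl ds xs" and ?J = "\<lambda>a b. op ((\<not> wodd fst a, op a) # b)"
    have g: "Ball (set ?w) proper" by (rule hom_letter_all_proper[OF hom_letter_map2[OF h]])
    have lw: "length ?w = n" using len * by simp
    \<comment> \<open>The inner value has degree one more than its arguments together, so the letter
      made of it carries the negated parity, as in \<open>op_Jacobi\<close>.\<close>
    have t: "smult (koszul_sign ds \<sigma>) (linf_op (n - i + 1) (linf_op i (take i (permute_list \<sigma> xs)) # drop i (permute_list \<sigma> xs)))
      = signed (inv_odd (\<lambda>i. fst (?w ! i)) (perm_word \<sigma> (length ?w))) (?J (take i (permute_list \<sigma> ?w)) (drop i (permute_list \<sigma> ?w)))"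
      if i: "i \<le> n" and \<sigma>: "\<sigma> permutes {..<n}" for i \<sigma>
    proof -
      let ?d = "permute_list \<sigma> ds" and ?x = "permute_list \<sigma> xs"
      have p: "\<sigma> permutes {..<length xs}" using \<sigma> * by simp
      note h' = perm(1)[OF h p]
      have ht: "list_all2 (\<lambda>d x. x \<in> sM_A scale d) (take i ?d) (take i ?x)"
        and hd: "list_all2 (\<lambda>d x. x \<in> sM_A scale d) (drop i ?d) (drop i ?x)"
        using h' by (auto intro: list_all2_takeI list_all2_dropI)
      have w: "map2 ?hl (take i ?d) (take i ?x) = take i (permute_list \<sigma> ?w)"
        "map2 ?hl (drop i ?d) (drop i ?x) = drop i (permute_list \<sigma> ?w)"
        unfolding perm(2)[OF h p, symmetric] by (simp_all add: take_map drop_map take_zip drop_zip)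
      have li: "linf_op i (take i ?x) = op (take i (permute_list \<sigma> ?w))"
        using linf_op_homogeneous[OF ht] w(1) i * by simp
      have "op (take i (permute_list \<sigma> ?w)) \<in> sM_A scale (sum_list (take i ?d) + 1)"
        using op_degree[OF hom_letter_map2[OF ht]] unfolding w .
      then have "list_all2 (\<lambda>d x. x \<in> sM_A scale d) ((sum_list (take i ?d) + 1) # drop i ?d) (linf_op i (take i ?x) # drop i ?x)"
        using hd li by simp
      from linf_op_homogeneous[OF this]
      have "linf_op (n - i + 1) (linf_op i (take i ?x) # drop i ?x)
        = op ((odd (sum_list (take i ?d) + 1), op (take i (permute_list \<sigma> ?w))) # drop i (permute_list \<sigma> ?w))"
        using * w(2) li by simp
      moreover have "odd (sum_list (take i ?d) + 1) = (\<not> wodd fst (take i (permute_list \<sigma> ?w)))"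
        unfolding w(1)[symmetric] using len * by (subst wodd_map2) simp_all
      ultimately show ?thesis
        using perm(3)[OF h p] lw * by (simp only: smult_sign_unit)
    qed
    have "(\<Sum>i = 1..n. \<Sum>\<sigma>\<in>Sh [i, n - i]. smult (koszul_sign ds \<sigma>)
        (linf_op (n - i + 1) (linf_op i (take i (permute_list \<sigma> xs)) # drop i (permute_list \<sigma> xs))))
      = (\<Sum>i = 1..n. unshuffle fst (\<lambda>a c. if length a = i then ?J a c else 0) ?w)"
    proof (rule sum.cong[OF refl])
      fix i assume "i \<in> {1..n}"
      then have i: "i \<le> n" "length ?w = i + (n - i)" using lw by auto
      have "(\<Sum>\<sigma>\<in>Sh [i, n - i]. smult (koszul_sign ds \<sigma>)
        (linf_op (n - i + 1) (linf_op i (take i (permute_list \<sigma> xs)) # drop i (permute_list \<sigma> xs))))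
        = (\<Sum>\<sigma>\<in>Sh [i, n - i]. signed (inv_odd (\<lambda>i. fst (?w ! i)) (perm_word \<sigma> (length ?w)))
          (?J (take i (permute_list \<sigma> ?w)) (drop i (permute_list \<sigma> ?w))))"
        using i by (intro sum.cong[OF refl] t) (auto simp: Sh_def)
      also have "\<dots> = unshuffle fst (\<lambda>a c. if length a = i then ?J a c else 0) ?w"
        by (rule sum_Sh2[OF i(2)])
      finally show "(\<Sum>\<sigma>\<in>Sh [i, n - i]. smult (koszul_sign ds \<sigma>)
        (linf_op (n - i + 1) (linf_op i (take i (permute_list \<sigma> xs)) # drop i (permute_list \<sigma> xs))))
        = unshuffle fst (\<lambda>a c. if length a = i then ?J a c else 0) ?w" .
    qed
    also have "\<dots> = unshuffle fst (\<lambda>a c. \<Sum>i = 1..n. if length a = i then ?J a c else 0) ?w"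
      by (rule unshuffle_sum[symmetric])
    also have "\<dots> = unshuffle fst ?J ?w"
    proof (rule unshuffle_cong)
      fix a c assume ac: "length a + length c = length ?w" "set a \<union> set c = set ?w"
      \<comment> \<open>The Jacobi sum begins at i = 1, while the unshuffle includes the splitting
        with \<open>a = []\<close>; that term has the letter 0 in front and vanishes.\<close>
      have "op [] = 0" by (auto simp: op_def op_M_def op_A_def fun_eq_iff zero_prod_def)
      moreover have "Ball (set c) proper" using ac(2) g by blast
      ultimately have "?J [] c = 0"
        using op_zero[of "[]" c True] by simp
      then show "(\<Sum>i = 1..n. if length a = i then ?J a c else 0) = ?J a c"
        using ac(1) lw by (cases "a = []") (simp_all add: Suc_le_eq)
    qed
    also have "\<dots> = 0" by (rule op_Jacobi[OF g])
    finally show "(\<Sum>i = 1..n. \<Sum>\<sigma>\<in>Sh [i, n - i]. smult (koszul_sign ds \<sigma>)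
        (linf_op (n - i + 1) (linf_op i (take i (permute_list \<sigma> xs)) # drop i (permute_list \<sigma> xs)))) = 0" .
  qed
qed

section \<open>Values of the operations on pure arguments\<close>

lemma hmap_sM_A: "hmap (int n) f \<Longrightarrow> (f, 0) \<in> sM_A scale (int n - 1)" "hmap (int n) f \<Longrightarrow> (0, f) \<in> sM_A scale (int n)"
  by (simp_all add: sM_A_iff hmap_0)

lemma plug_0: "plug 0 f = 0" "alt_map f \<Longrightarrow> plug f 0 = 0"
  using plug_zero_left[of f] plug_zero_right[of f] by (auto simp: fun_eq_iff zero_fun_def)

lemma brace_0_left: "brace 0 \<Xi> X = 0"
  by (simp add: zero_fun_def)

lemma act_0: "alt_word \<Xi> \<Longrightarrow> act lam p 0 \<Xi> X = 0"
  using act_f_0[of \<Xi> p X] by (simp add: zero_fun_def)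

lemma act_slot_0: "alt_map f \<Longrightarrow> act lam p f (u @ (q, 0) # v) X = 0"
  using act_lin_map_slot[of f p "map (\<lambda>x. (fst x, 0, snd x)) u" q "map (\<lambda>x. (fst x, 0, snd x)) v" X]
    lin_formD(1)[of _ 0 0] by (force simp: o_def A_letter_def)

text \<open>As sf has degree n - 1, its tag is \<open>even n\<close>. The A-component is 0 because
  each letter would act on the zero A-part of the other.\<close>

lemma linf_op2_MM:
  assumes "hmap (int n) f" "hmap (int m) g"
  shows "linf_op 2 [(f, 0), (g, 0)] = (fun_scale scale ((-1) ^ n) (nr_bracket scale n m f g), 0)"
proof -
  have "linf_op 2 [(f, 0), (g, 0)] = op [(even n, f, 0), (even m, g, 0)]"
    using linf_op_homogeneous[of "[int n - 1, int m - 1]" "[(f, 0), (g, 0)]"] hmap_sM_A assms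
    by (simp add: numeral_2_eq_2)
  also have "op_A [(even n, f, 0), (even m, g, 0)] = 0"
    using act_slot_0[OF hmap_alt_map[OF assms(1)], of "odd n" "[]" _ "[]"]
      act_slot_0[OF hmap_alt_map[OF assms(2)], of "odd m" "[]" _ "[]"]
    by (auto simp: op_A_def fun_eq_iff)
  then have "op [(even n, f, 0), (even m, g, 0)] = (\<lambda>X. signed (odd n) (bracket (odd n) f (odd m) g X), 0)"
    by (simp add: op_def op_M_def fun_eq_iff)
  also have "(\<lambda>X. signed (odd n) (bracket (odd n) f (odd m) g X)) = fun_scale scale ((-1) ^ n) (nr_bracket scale n m f g)"
    unfolding fun_scale_def nr_bracket_bracket[OF assms] sign_unit_power[symmetric] scale_sign_unit ..
  finally show ?thesis .
qed

text \<open>On a single letter \<open>act\<close> is f{\<xi>} with coefficient \<lambda>^0 minus the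
  linear term, which together are the bracket.\<close>

lemma linf_op2_MA:
  assumes "hmap (int n) f" "hmap (int m) \<xi>"
  shows "linf_op 2 [(f, 0), (0, \<xi>)] = (0, nr_bracket scale n m f \<xi>)"
proof -
  have "linf_op 2 [(f, 0), (0, \<xi>)] = op [(even n, f, 0), (odd m, 0, \<xi>)]"
    using linf_op_homogeneous[of "[int n - 1, int m]" "[(f, 0), (0, \<xi>)]"] hmap_sM_A assms
    by (simp add: numeral_2_eq_2)
  also have "op_M [(even n, f, 0), (odd m, 0, \<xi>)] = 0"
    using hmap_alt_map[OF assms(1)] by (simp add: op_M_def bracket_def plug_0 fun_eq_iff)
  then have "op [(even n, f, 0), (odd m, 0, \<xi>)] = (0, bracket (odd n) f (odd m) \<xi>)"
    using act_0[of "[(even n, 0)]"] alt_map_0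
    by (simp add: op_def op_A_def fun_eq_iff act_def brace_single bracket_def plug_0 has_parity_def del: brace.simps)
  finally show ?thesis unfolding nr_bracket_bracket[OF assms] .
qed

lemma op_long: "length w > 2 \<Longrightarrow> op w = (0, op_A w)"
  by (auto simp: op_def op_M_def fun_eq_iff split: list.splits)

lemma op_A_no_fun:
  assumes "Ball (set w) proper" "\<forall>x\<in>set w. M_part x = 0"
  shows "op_A w X = 0"
proof -
  have "op_A w X = pull fst (\<lambda>x w'. 0) w"
    unfolding op_A_def
  proof (rule pull_cong)
    fix x w' assume "x \<in> set w" "set w' \<subseteq> set w"
    then show "act lam (\<not> fst x) (M_part x) (map A_letter w') X = 0"
      using assms by (auto intro!: act_0 alt_word_A_letter)
  qed
  then show ?thesis by simp
qed

text \<open>Any other acting letter has M-part 0 and acts on at least two letters, where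
  \<open>act\<close> has no linear term and is a brace of 0.\<close>

lemma op_A_one_fun:
  assumes "Ball (set w) proper" "\<forall>x\<in>set w. M_part x = 0" "length w \<ge> 2"
  shows "op_A (z # w) X = act lam (\<not> fst z) (M_part z) (map A_letter w) X"
proof -
  have "pull fst (\<lambda>y w'. signed (fst z \<and> fst y) (act lam (\<not> fst y) (M_part y) (map A_letter (z # w')) X)) w
    = pull fst (\<lambda>y w'. 0) w"
  proof (rule pull_cong)
    fix y and w' :: "'b letter list" assume y: "y \<in> set w" "length w = Suc (length w')"
    then have "length w' \<ge> 1" using assms(3) by simp
    then have "act lam (\<not> fst y) 0 (map A_letter (z # w')) X = 0"
      by (auto simp: act_def brace_0_left simp del: brace.simps)
    then show "signed (fst z \<and> fst y) (act lam (\<not> fst y) (M_part y) (map A_letter (z # w')) X) = 0"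
      using assms(2) y(1) by simp
  qed
  then show ?thesis by (simp add: op_A_def)
qed

lemma linf_op_higher:
  assumes "hmap (int n) f" "list_all2 (\<lambda>m \<xi>. hmap (int m) \<xi>) ms \<xi>s" "2 \<le> length ms" "length ms \<le> n + 1"
  shows "linf_op (Suc (length ms)) ((f, 0) # map (Pair 0) \<xi>s) = (0, higher_op scale lam n f ms \<xi>s)"
proof -
  let ?w = "map2 (\<lambda>d x. (odd d, x)) (map int ms) (map (Pair 0) \<xi>s) :: 'b letter list"
  have len: "length ms = length \<xi>s" using assms(2) by (rule list_all2_lengthD)
  have h: "list_all2 (\<lambda>d x. x \<in> sM_A scale d) (map int ms) (map (Pair 0) \<xi>s)"
    using assms(2) hmap_sM_A(2) by (simp add: list_all2_conv_all_nth)
  have w: "map A_letter ?w = zip (map odd ms) \<xi>s"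
    using len by (intro nth_equalityI) simp_all
  have "linf_op (Suc (length ms)) ((f, 0) # map (Pair 0) \<xi>s) = op ((even n, f, 0) # ?w)"
    using linf_op_homogeneous[of "(int n - 1) # map int ms" "(f, 0) # map (Pair 0) \<xi>s"] h hmap_sM_A(1)[OF assms(1)] len
    by simp
  also have "\<dots> = (0, op_A ((even n, f, 0) # ?w))"
    by (rule op_long) (use len assms(3) in simp)
  also have "op_A ((even n, f, 0) # ?w) X = act lam (odd n) f (map A_letter ?w) X" for X
  proof -
    have "\<forall>x\<in>set ?w. M_part x = 0"
      by (auto dest!: set_zip_rightD)
    from op_A_one_fun[OF hom_letter_all_proper[OF hom_letter_map2[OF h]] this, of "(even n, f, 0)" X]
    show ?thesis using len assms(3) by simp
  qed
  then have "op_A ((even n, f, 0) # ?w) = higher_op scale lam n f ms \<xi>s"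
    unfolding w higher_op_brace[OF assms(1,2,4)] using assms(3) len
    by (auto simp: act_def fun_eq_iff simp del: brace.simps)
  finally show ?thesis .
qed

lemma linf_op_1: "linf_op 1 [x] = 0"
proof (rule linf_op_zero)
  fix ps :: "bool list" assume "length ps = 1"
  then obtain p where "ps = [p]" by (auto simp: length_Suc_conv)
  then show "op (map2 letter ps [x]) = 0"
    by (simp add: op_def op_M_def op_A_def act_def zero_prod_def fun_eq_iff)
qed

lemma M_part_letter: "M_part (letter p (0, \<xi>)) = 0"
  by (auto simp: letter_def parity_part_def fun_eq_iff)

lemma linf_op_A:
  assumes "\<forall>\<xi>\<in>set \<xi>s. alt_map \<xi>"
  shows "linf_op n (map (Pair 0) \<xi>s) = 0"
proof (rule linf_op_zero)
  fix ps :: "bool list"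
  let ?w = "map2 letter ps (map (Pair 0) \<xi>s)"
  have g: "Ball (set ?w) proper"
    using assms alt_map_0 by (intro proper_map2) (auto simp: alt_pair_def)
  have z: "\<forall>x\<in>set ?w. M_part x = 0"
    using M_part_letter by (auto dest!: set_zip_rightD)
  have "op_M ?w X = 0" for X
    using z by (auto simp: op_M_def bracket_def plug_0 split: list.splits)
  then show "op ?w = 0"
    using op_A_no_fun[OF g z] by (auto simp: op_def zero_prod_def fun_eq_iff)
qed

text \<open>Each letter occupies one of the n + 1 arguments of \<open>f\<close>.\<close>

lemma linf_op_too_many:
  assumes "hmap (int n) f" "\<forall>\<xi>\<in>set \<xi>s. alt_map \<xi>" "length \<xi>s > n + 1"
  shows "linf_op (Suc (length \<xi>s)) ((f, 0) # map (Pair 0) \<xi>s) = 0"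
proof (rule linf_op_zero)
  fix ps :: "bool list" assume "length ps = Suc (length \<xi>s)"
  then obtain p qs where ps: "ps = p # qs" "length qs = length \<xi>s" by (auto simp: length_Suc_conv)
  let ?w = "map2 letter qs (map (Pair 0) \<xi>s)" and ?z = "letter p (f, 0)"
  have g: "Ball (set ?w) proper"
    using assms(2) alt_map_0 by (intro proper_map2) (auto simp: alt_pair_def)
  have z: "\<forall>x\<in>set ?w. M_part x = 0"
    using M_part_letter by (auto dest!: set_zip_rightD)
  have len: "length ?w = length \<xi>s" using ps by simp
  have "has_degree (int n) (M_part ?z)"
    using assms(1) by (auto simp: letter_def parity_part_def has_degree_def hmap_def)
  then have "brace (M_part ?z) (map A_letter ?w) X = 0" for X
    by (rule brace_too_many) (use len assms(3) in simp)
  then have "act lam (\<not> fst ?z) (M_part ?z) (map A_letter ?w) X = 0" for X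
    using len assms(3) by (simp add: act_def del: brace.simps)
  then have "op_A (?z # ?w) X = 0" for X
    using op_A_one_fun[OF g z] len assms(3) by simp
  then show "op (map2 letter ps ((f, 0) # map (Pair 0) \<xi>s)) = 0"
    using op_long[of "?z # ?w"] ps len assms(3) by (simp add: zero_prod_def fun_eq_iff)
qed

text \<open>Only one letter acts, so \<open>(f, 0)\<close> or \<open>(g, 0)\<close> ends up in a
  slot, where its zero A-part kills the term; \<open>op_M\<close> is 0 on more than two
  letters.\<close>

lemma linf_op_MM:
  assumes "alt_map f" "alt_map g" "length xs \<ge> 1" "\<forall>x\<in>set xs. alt_pair x"
  shows "linf_op (Suc (Suc (length xs))) ((f, 0) # (g, 0) # xs) = 0"
proof (rule linf_op_zero)
  fix ps :: "bool list" assume "length ps = Suc (Suc (length xs))"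
  then obtain p q qs where ps: "ps = p # q # qs" "length qs = length xs" by (auto simp: length_Suc_conv)
  let ?w = "map2 letter qs xs" and ?x = "letter p (f, 0)" and ?y = "letter q (g, 0)"
  have g: "Ball (set ?w) proper" using assms(4) by (intro proper_map2) auto
  have gx: "proper ?x" "proper ?y" using assms alt_map_0 by (auto intro!: proper_letter simp: alt_pair_def)
  have A_letter: "A_letter ?x = (p, 0)" "A_letter ?y = (q, 0)"
    by (auto simp: letter_def parity_part_def fun_eq_iff)
  have z: "act lam r (M_part z) (u @ (c, 0) # v) X = 0" if "proper z" for z r u c v X
    using that by (intro act_slot_0) (simp add: proper_def)
  have "op_A (?x # ?y # ?w) X = 0" for X
  proof -
    have "pull fst (\<lambda>z w'. signed (fst ?y \<and> fst z) (signed (fst ?x \<and> fst z) (act lam (\<not> fst z) (M_part z) (map A_letter (?x # ?y # w')) X))) ?w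
      = pull fst (\<lambda>z w'. 0) ?w"
    proof (rule pull_cong)
      fix y b assume "y \<in> set ?w"
      then have "proper y" using g by blast
      from z[OF this, of "\<not> fst y" "[]" p "(q, 0) # map A_letter b" X]
      have "act lam (\<not> fst y) (M_part y) (map A_letter (?x # ?y # b)) X = 0"
        by (simp add: A_letter)
      then show "signed (fst ?y \<and> fst y) (signed (fst ?x \<and> fst y) (act lam (\<not> fst y) (M_part y) (map A_letter (?x # ?y # b)) X)) = 0"
        by (simp only: signed_simps)
    qed
    moreover have "act lam (\<not> fst ?x) (M_part ?x) (map A_letter (?y # ?w)) X = 0"
      "act lam (\<not> fst ?y) (M_part ?y) (map A_letter (?x # ?w)) X = 0"
      using z[OF gx(1), of _ "[]"] z[OF gx(2), of _ "[]"] by (simp_all add: A_letter)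
    ultimately show ?thesis by (simp add: op_A_def)
  qed
  then show "op (map2 letter ps ((f, 0) # (g, 0) # xs)) = 0"
    using op_long[of "?x # ?y # ?w"] ps assms(3) by (cases xs) (simp_all add: zero_prod_def fun_eq_iff)
qed

end

text \<open>Together with multilinearity and graded symmetry the clauses fix every operation of
  positive arity: they cover pure tuples with no entry from sM, with exactly one, and with two or
  more, up to reordering.\<close>

theorem proposition4p19:
  fixes s :: "'k::field_char_0 \<Rightarrow> 'v::ab_group_add \<Rightarrow> 'v" and lam :: 'k
  assumes "vector_space s"
  shows "\<exists>l. L_infinity_1_algebra (sM_A_scale s) (sM_A s) l
    \<and> (\<forall>n m. \<forall>f\<in>alternating_maps s (n + 1). \<forall>g\<in>alternating_maps s (m + 1).
         l 2 [(f, 0), (g, 0)] = (fun_scale s ((-1) ^ n) (nr_bracket s n m f g), 0))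
    \<and> (\<forall>n m. \<forall>f\<in>alternating_maps s (n + 1). \<forall>\<xi>\<in>alternating_maps s (m + 1).
         l 2 [(f, 0), (0, \<xi>)] = (0, nr_bracket s n m f \<xi>))
    \<and> (\<forall>n i ms \<xi>s. \<forall>f\<in>alternating_maps s (n + 1).
         3 \<le> i \<and> i \<le> n + 2 \<and> length ms = i - 1 \<and>
         list_all2 (\<lambda>m \<xi>. \<xi> \<in> alternating_maps s (m + 1)) ms \<xi>s \<longrightarrow>
         l i ((f, 0) # map (Pair 0) \<xi>s) = (0, higher_op s lam n f ms \<xi>s))
    \<and> (\<forall>x\<in>graded_vector_space.total (sM_A_scale s) (sM_A s). l 1 [x] = 0)
    \<and> (\<forall>i\<ge>1. \<forall>\<xi>s. length \<xi>s = i \<and> (\<forall>\<xi>\<in>set \<xi>s. \<exists>m. \<xi> \<in> alternating_maps s (m + 1)) \<longrightarrow>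
         l i (map (Pair 0) \<xi>s) = 0)
    \<and> (\<forall>n i \<xi>s. \<forall>f\<in>alternating_maps s (n + 1).
         i > n + 2 \<and> length \<xi>s = i - 1 \<and> (\<forall>\<xi>\<in>set \<xi>s. \<exists>m. \<xi> \<in> alternating_maps s (m + 1)) \<longrightarrow>
         l i ((f, 0) # map (Pair 0) \<xi>s) = 0)
    \<and> (\<forall>n m i xs. \<forall>f\<in>alternating_maps s (n + 1). \<forall>g\<in>alternating_maps s (m + 1).
         i \<ge> 3 \<and> length xs = i - 2 \<and> set xs \<subseteq> graded_vector_space.total (sM_A_scale s) (sM_A s) \<longrightarrow>
         l i ((f, 0) # (g, 0) # xs) = 0)"
proof -
  interpret vector_space s by (rule assms)
  interpret weighted_NR_structure s lam by unfold_locales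
  have alt_map: "alt_map \<xi>" if "\<exists>m. \<xi> \<in> alternating_maps s (m + 1)" for \<xi>
    using that alternating_maps_hmap hmap_alt_map by blast
  show ?thesis
  proof (intro exI[of _ linf_op] conjI allI ballI impI; (elim conjE)?)
    show "L_infinity_1_algebra (sM_A_scale s) (sM_A s) linf_op" by (rule L_infinity)
  next
    fix n m f g assume "f \<in> alternating_maps s (n + 1)" "g \<in> alternating_maps s (m + 1)"
    then show "linf_op 2 [(f, 0), (g, 0)] = (fun_scale s ((-1) ^ n) (nr_bracket s n m f g), 0)"
      unfolding alternating_maps_hmap by (rule linf_op2_MM)
  next
    fix n m f \<xi> assume "f \<in> alternating_maps s (n + 1)" "\<xi> \<in> alternating_maps s (m + 1)"
    then show "linf_op 2 [(f, 0), (0, \<xi>)] = (0, nr_bracket s n m f \<xi>)"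
      unfolding alternating_maps_hmap by (rule linf_op2_MA)
  next
    fix n i ms \<xi>s f
    assume *: "f \<in> alternating_maps s (n + 1)" "3 \<le> i" "i \<le> n + 2" "length ms = i - 1"
      "list_all2 (\<lambda>m \<xi>. \<xi> \<in> alternating_maps s (m + 1)) ms \<xi>s"
    then have "i = Suc (length ms)" "2 \<le> length ms" "length ms \<le> n + 1" by auto
    then show "linf_op i ((f, 0) # map (Pair 0) \<xi>s) = (0, higher_op s lam n f ms \<xi>s)"
      using linf_op_higher *(1,5) unfolding alternating_maps_hmap by simp
  next
    show "linf_op 1 [x] = 0" for x by (rule linf_op_1)
  next
    show "linf_op i (map (Pair 0) \<xi>s) = 0" if "\<forall>\<xi>\<in>set \<xi>s. \<exists>m. \<xi> \<in> alternating_maps s (m + 1)" for i \<xi>s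
      using that alt_map by (intro linf_op_A) blast
  next
    fix n i \<xi>s f
    assume *: "f \<in> alternating_maps s (n + 1)" "i > n + 2" "length \<xi>s = i - 1"
      "\<forall>\<xi>\<in>set \<xi>s. \<exists>m. \<xi> \<in> alternating_maps s (m + 1)"
    then have "i = Suc (length \<xi>s)" "length \<xi>s > n + 1" by auto
    then show "linf_op i ((f, 0) # map (Pair 0) \<xi>s) = 0"
      using linf_op_too_many[of n f \<xi>s] *(1,4) alt_map unfolding alternating_maps_hmap by blast
  next
    fix n m i xs f g
    assume *: "f \<in> alternating_maps s (n + 1)" "g \<in> alternating_maps s (m + 1)" "i \<ge> 3" "length xs = i - 2"
      "set xs \<subseteq> graded_vector_space.total (sM_A_scale s) (sM_A s)"
    then have "i = Suc (Suc (length xs))" "length xs \<ge> 1" by auto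
    then show "linf_op i ((f, 0) # (g, 0) # xs) = 0"
      using linf_op_MM[of f g xs] *(1,2,5) alt_map total_alt_pair by blast
  qed
qed

end
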